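(* Let $G$ be a 3-connected planar graph. Then $G$ has a 2-coloring which is intrinsically asymmetric in $S^3$ if and only if $G$ is not $K_4$. Moreover, $G$ has a 2-coloring which is intrinsically faithfully chiral in $S^3$ if and only if $G$ is not $K_4$.
   Context: A graph is a finite connected set of vertices and edges such that every edge has two distinct vertices and there is at most one edge between any pair of vertices. A 2-coloring of a graph assigns to each edge one of the colors "black" or "grey". A color preserving automorphism of $G$ is a graph automorphism taking grey edges to grey edges and black edges to black edges. For an embedding $\Gamma$ of a 2-colored graph in a space $E$, a color preserving homeomorphism of $(E,\Gamma)$ is a homeomorphism of $E$ mapping $\Gamma$ to itself whose restriction to $\Gamma$ is a color preserving automorphism. A 2-coloring of $G$ is intrinsically asymmetric in $E$ if for every embedding $\Gamma$ of $G$ in $E$, every color preserving homeomorphism of $(E,\Gamma)$ restricts to the trivial automorphism of $\Gamma$. A 2-coloring of $G$ is intrinsically faithfully chiral in $E$ if for every embedding $\Gamma$ of $G$ in $E$, every color preserving orientation reversing homeomorphism of $(E,\Gamma)$ restricts to the trivial automorphism of $\Gamma$. *)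

theory Defs
  imports "HOL-Homology.Homology"
begin

definition graph_connected :: "'a set \<Rightarrow> 'a set set \<Rightarrow> bool" where
  "graph_connected V E \<longleftrightarrow> (\<forall>u\<in>V. \<forall>v\<in>V. (u, v) \<in> {(x, y). {x, y} \<in> E}\<^sup>*)"

definition graph :: "'a set \<Rightarrow> 'a set set \<Rightarrow> bool" where
  "graph V E \<longleftrightarrow> finite V \<and> (\<forall>e\<in>E. e \<subseteq> V \<and> card e = 2) \<and> graph_connected V E"

definition vertex_connected :: "nat \<Rightarrow> 'a set \<Rightarrow> 'a set set \<Rightarrow> bool" where
  "vertex_connected k V E \<longleftrightarrow>
     card V > k \<and>
     (\<forall>S. S \<subseteq> V \<and> card S < k \<longrightarrow> graph_connected (V - S) {e\<in>E. e \<inter> S = {}})"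

definition complete_graph :: "nat \<Rightarrow> 'a set \<Rightarrow> 'a set set \<Rightarrow> bool" where
  "complete_graph n V E \<longleftrightarrow>
     card V = n \<and> E = {{u, v} |u v. u \<in> V \<and> v \<in> V \<and> u \<noteq> v}"

(* Barycentric coordinates: geometric_cell {v} is the single point with coordinate 1 at v, and
   geometric_cell {u, v} is the closed segment joining the points of u and v. *)
definition geometric_cell :: "'a set \<Rightarrow> ('a \<Rightarrow> real) set" where
  "geometric_cell s = {x. (\<forall>v. 0 \<le> x v) \<and> (\<forall>v. v \<notin> s \<longrightarrow> x v = 0) \<and> sum x s = 1}"

definition realization :: "'a set \<Rightarrow> 'a set set \<Rightarrow> ('a \<Rightarrow> real) topology" where
  "realization V E =
     subtopology (powertop_real UNIV)
       ((\<Union>v\<in>V. geometric_cell {v}) \<union> (\<Union>e\<in>E. geometric_cell e))"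

(* f is an embedding of the graph; the embedded graph is f ` topspace (realization V E). *)
definition graph_embedding ::
  "'b topology \<Rightarrow> 'a set \<Rightarrow> 'a set set \<Rightarrow> (('a \<Rightarrow> real) \<Rightarrow> 'b) \<Rightarrow> bool" where
  "graph_embedding X V E f \<longleftrightarrow> embedding_map (realization V E) X f"

definition planar :: "'a set \<Rightarrow> 'a set set \<Rightarrow> bool" where
  "planar V E \<longleftrightarrow> (\<exists>f. graph_embedding (euclidean :: complex topology) V E f)"

datatype color = Black | Grey

definition graph_automorphism :: "'a set \<Rightarrow> 'a set set \<Rightarrow> ('a \<Rightarrow> 'a) \<Rightarrow> bool" where
  "graph_automorphism V E \<sigma> \<longleftrightarrow>
     bij_betw \<sigma> V V \<and> (\<forall>u\<in>V. \<forall>v\<in>V. {u, v} \<in> E \<longleftrightarrow> {\<sigma> u, \<sigma> v} \<in> E)"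

(* A coloring is a function on all sets of vertices; only its values on edges matter. *)
definition color_preserving_automorphism ::
  "'a set \<Rightarrow> 'a set set \<Rightarrow> ('a set \<Rightarrow> color) \<Rightarrow> ('a \<Rightarrow> 'a) \<Rightarrow> bool" where
  "color_preserving_automorphism V E c \<sigma> \<longleftrightarrow>
     graph_automorphism V E \<sigma> \<and> (\<forall>e\<in>E. c (\<sigma> ` e) = c e)"

(* The restriction of h to the embedded graph is, as a graph automorphism, \<sigma>: vertices are mapped
   as \<sigma> prescribes, and each edge is mapped, as a set, onto the edge that \<sigma> prescribes. *)
definition restricts_to_automorphism ::
  "'a set \<Rightarrow> 'a set set \<Rightarrow> (('a \<Rightarrow> real) \<Rightarrow> 'b) \<Rightarrow> ('b \<Rightarrow> 'b) \<Rightarrow> ('a \<Rightarrow> 'a) \<Rightarrow> bool" where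
  "restricts_to_automorphism V E f h \<sigma> \<longleftrightarrow>
     (\<forall>v\<in>V. h ` f ` geometric_cell {v} = f ` geometric_cell {\<sigma> v}) \<and>
     (\<forall>e\<in>E. h ` f ` geometric_cell e = f ` geometric_cell (\<sigma> ` e))"

definition color_preserving_homeomorphism ::
  "'b topology \<Rightarrow> 'a set \<Rightarrow> 'a set set \<Rightarrow> ('a set \<Rightarrow> color) \<Rightarrow> (('a \<Rightarrow> real) \<Rightarrow> 'b) \<Rightarrow> ('b \<Rightarrow> 'b) \<Rightarrow> bool"
  where
  "color_preserving_homeomorphism X V E c f h \<longleftrightarrow>
     homeomorphic_map X X h \<and>
     h ` f ` topspace (realization V E) = f ` topspace (realization V E) \<and>
     (\<exists>\<sigma>. color_preserving_automorphism V E c \<sigma> \<and> restricts_to_automorphism V E f h \<sigma>)"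

definition intrinsically_asymmetric ::
  "'b topology \<Rightarrow> 'a set \<Rightarrow> 'a set set \<Rightarrow> ('a set \<Rightarrow> color) \<Rightarrow> bool" where
  "intrinsically_asymmetric X V E c \<longleftrightarrow>
     (\<forall>f h. graph_embedding X V E f \<and> color_preserving_homeomorphism X V E c f h
        \<longrightarrow> restricts_to_automorphism V E f h id)"

(* For h a homeomorphism of the n-sphere, whose degree is 1 or -1. *)
definition orientation_reversing :: "nat \<Rightarrow> ((nat \<Rightarrow> real) \<Rightarrow> (nat \<Rightarrow> real)) \<Rightarrow> bool" where
  "orientation_reversing n h \<longleftrightarrow> Brouwer_degree2 n h = - 1"

definition intrinsically_faithfully_chiral ::
  "nat \<Rightarrow> 'a set \<Rightarrow> 'a set set \<Rightarrow> ('a set \<Rightarrow> color) \<Rightarrow> bool" where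
  "intrinsically_faithfully_chiral n V E c \<longleftrightarrow>
     (\<forall>f h. graph_embedding (nsphere n) V E f \<and>
        color_preserving_homeomorphism (nsphere n) V E c f h \<and> orientation_reversing n h
        \<longrightarrow> restricts_to_automorphism V E f h id)"

end

theory Submission
  imports Defs "HOL-Analysis.Analysis"
begin

text \<open>If \<open>G\<close> is not \<open>K\<^sub>4\<close>, color black a few edges that no nontrivial automorphism of \<open>G\<close>
  preserves; then no embedding is needed to see asymmetry. On at least seven vertices a longest cycle
  yields a spider with legs of lengths 1, 2 and 3, an asymmetric tree, as black graph. So an automorphism
  preserving the coloring fixes a vertex together with three of its neighbors, and in a 3-connected
  planar graph this forces the identity, since otherwise \<open>G\<close> would have a \<open>K\<^sub>3\<^sub>,\<^sub>3\<close> minor. Graphs on five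
  or six vertices are treated directly; here \<open>K\<^sub>5\<close> and \<open>K\<^sub>3\<^sub>,\<^sub>3\<close> must be excluded.

  Conversely, each 2-coloring of \<open>K\<^sub>4\<close> is preserved by a transposition or by a product of two disjoint
  transpositions. Draw \<open>K\<^sub>4\<close> on an equatorial 2-sphere of the 3-sphere as a tetrahedron: both kinds of
  permutation are induced by an odd number of coordinate reflections.\<close>

section \<open>The theta curve\<close>

text \<open>By Whitney's theorem a 3-connected planar graph has essentially one drawing on the
  sphere, so an automorphism that fixes a vertex and three of its neighbors fixes the rotation there
  and is trivial. Two neighbors would not do: a reflection can fix a vertex and two of its
  neighbors. Minors stand in for that theorem here: a region of moved vertices, its image and a
  third connected set compete for the same three attachments. Of planarity only two consequences are
  used, no \<open>K\<^sub>3\<^sub>,\<^sub>3\<close> minor and no \<open>K\<^sub>5\<close>, and both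
  reduce to one fact about theta curves. The split by the number of vertices follows the sizes of
  the smallest asymmetric graphs. Apart from a single vertex, asymmetric trees need seven vertices
  and asymmetric graphs six. On six vertices the black graph is asymmetric and spanning; on five it
  always has a symmetry, which the other edges must break. For \<open>K\<^sub>4\<close> one drawing
  serves all colorings after renaming the vertices.\<close>

lemma connected_through_ball:
  fixes p :: "'a::real_normed_vector"
  assumes "connected K" "connected W" "open N" "p \<in> N" "p \<in> closure K" "p \<in> closure W"
    and "K \<subseteq> N" "W \<subseteq> N" "k \<in> K" "w \<in> W"
  shows "connected_component N k w"
proof -
  obtain e where e: "e > 0" "ball p e \<subseteq> N"
    using assms(3,4) open_contains_ball by blast
  \<comment> \<open>Both sets come arbitrarily close to \<open>p\<close>, so one ball inside
    \<open>N\<close> meets them both and serves as a bridge.\<close>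
  have K: "ball p e \<inter> K \<noteq> {}" and W: "ball p e \<inter> W \<noteq> {}"
    using assms(5,6) e(1) by (fastforce simp: closure_approachable dist_commute disjoint_iff)+
  have "connected (K \<union> ball p e)"
    using K assms(1) by (intro connected_Un) (auto simp: Int_commute)
  then have "connected (K \<union> ball p e \<union> W)"
    using W assms(2) by (intro connected_Un[of "K \<union> ball p e"]) blast+
  then show ?thesis
    using assms e(2) unfolding connected_component_def by (meson UnCI Un_least)
qed

text \<open>Neither \<open>c1 \<union> c3\<close> nor \<open>c2 \<union> c3\<close> separates \<open>K\<close> from the side of the Jordan curve \<open>c1 \<union> c2\<close>
  avoiding \<open>c3\<close>: cross at \<open>p2\<close> or \<open>p1\<close>. These two sets meet in the connected set \<open>c3\<close>, so Janiszewski's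
  theorem puts \<open>K\<close> on that side, away from \<open>c3\<close>.\<close>

lemma theta_curve_touching_set:
  fixes c1 c2 c3 :: "real \<Rightarrow> complex"
  assumes arcs: "arc c1" "arc c2" "arc c3"
    and s: "pathstart c1 = a" "pathstart c2 = a" "pathstart c3 = a"
    and t: "pathfinish c1 = b" "pathfinish c2 = b" "pathfinish c3 = b"
    and I12: "path_image c1 \<inter> path_image c2 = {a, b}"
    and I13: "path_image c1 \<inter> path_image c3 = {a, b}"
    and I23: "path_image c2 \<inter> path_image c3 = {a, b}"
    and K: "connected K" "K \<inter> (path_image c1 \<union> path_image c2 \<union> path_image c3) = {}"
    and p1: "p1 \<in> path_image c1" "p1 \<notin> {a, b}" "p1 \<in> closure K"
    and p2: "p2 \<in> path_image c2" "p2 \<notin> {a, b}" "p2 \<in> closure K"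
    and p3: "p3 \<in> path_image c3" "p3 \<notin> {a, b}" "p3 \<in> closure K"
  shows False
proof -
  let ?J = "c1 +++ reversepath c2"
  have J: "simple_path ?J"
    using arcs s t I12 by (intro simple_path_join_loop) (auto simp: arc_reversepath)
  have loop: "pathfinish ?J = pathstart ?J" using s by simp
  have imJ: "path_image ?J = path_image c1 \<union> path_image c2"
    using t by (subst path_image_join) auto
  obtain W U where W: "connected W" "open W" "frontier W = path_image c1 \<union> path_image c2" "W \<noteq> {}"
     and U: "connected U" "open U" and WU: "W \<inter> U = {}" "W \<union> U = - (path_image c1 \<union> path_image c2)"
     and "p3 \<in> U"
  proof -
    obtain A B where AB: "A \<noteq> {}" "open A" "connected A" "B \<noteq> {}" "open B" "connected B"
      "A \<inter> B = {}" "A \<union> B = - path_image ?J" "frontier A = path_image ?J" "frontier B = path_image ?J"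
      using Jordan_curve[OF J loop] by metis
    have "p3 \<in> A \<or> p3 \<in> B" using AB(8) imJ p3 I13 I23 by auto
    then show thesis
    proof
      assume "p3 \<in> A"
      show thesis
        by (rule that[of B A]) (use AB imJ \<open>p3 \<in> A\<close> in \<open>simp_all add: Un_commute Int_commute\<close>)
    next
      assume "p3 \<in> B"
      show thesis
        by (rule that[of A B]) (use AB imJ \<open>p3 \<in> B\<close> in simp_all)
    qed
  qed
  have "connected (path_image c3 - {a, b})"
    using connected_simple_path_endless[of c3] arcs s t arc_imp_simple_path by metis
  moreover have "path_image c3 - {a, b} \<subseteq> W \<union> U" using WU I13 I23 by auto
  ultimately have c3U: "path_image c3 - {a, b} \<subseteq> U"
    using connectedD[OF _ W(2) U(2), of "path_image c3 - {a, b}"] WU(1) \<open>p3 \<in> U\<close> p3 by blast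
  have ab: "a \<in> path_image c1" "b \<in> path_image c1" using I12 by auto
  have W3: "W \<inter> path_image c3 = {}" using c3U WU ab by auto
  obtain k where k: "k \<in> K" using p1(3) by fastforce
  obtain w where w: "w \<in> W" using W(4) by blast
  have clW: "path_image c1 \<union> path_image c2 \<subseteq> closure W" using W(3) by (auto simp: frontier_def)
  let ?S = "path_image c1 \<union> path_image c3" and ?T = "path_image c2 \<union> path_image c3"
  have comp: "compact ?S" "compact ?T"
    using arcs by (auto intro!: compact_Un compact_path_image simp: arc_imp_path)
  have op: "open (- ?S)" "open (- ?T)"
    using comp[THEN compact_imp_closed] by (auto simp only: open_Compl)
  have KST: "K \<subseteq> - ?S" "K \<subseteq> - ?T" using K(2) by blast+
  have WST: "W \<subseteq> - ?S" "W \<subseteq> - ?T" using WU(2) W3 by blast+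
  have p2S: "p2 \<in> - ?S" and p1T: "p1 \<in> - ?T" using p1 p2 I12 I13 I23 by blast+
  have cl: "p2 \<in> closure W" "p1 \<in> closure W" using p1 p2 clW by blast+
  have S: "connected_component (- ?S) k w"
    by (rule connected_through_ball[OF K(1) W(1) op(1) p2S p2(3) cl(1) KST(1) WST(1) k w])
  have T: "connected_component (- ?T) k w"
    by (rule connected_through_ball[OF K(1) W(1) op(2) p1T p1(3) cl(2) KST(2) WST(2) k w])
  have "?S \<inter> ?T = path_image c3" using I12 I13 by auto
  then have "connected (?S \<inter> ?T)" using arcs(3) by (simp add: connected_arc_image)
  then have "connected_component (- (?S \<union> ?T)) k w"
    using Janiszewski[OF comp(1) compact_imp_closed[OF comp(2)] _ S T] by blast
  then obtain Q where Q: "connected Q" "k \<in> Q" "w \<in> Q" "Q \<subseteq> - (?S \<union> ?T)"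
    unfolding connected_component_def by blast
  \<comment> \<open>Joined to \<open>W\<close> off all three arcs, \<open>K\<close> lies in
    \<open>W\<close>. Its limit point \<open>p3\<close> would then lie in the closure of
    \<open>W\<close>, but it lies in the open set \<open>U\<close> disjoint from
    \<open>W\<close>.\<close>
  have "connected (K \<union> Q)" using K(1) Q k by (intro connected_Un) auto
  moreover have "K \<union> Q \<subseteq> W \<union> U" using Q(4) K WU by auto
  ultimately have "K \<union> Q \<subseteq> W"
    using connectedD[OF _ W(2) U(2), of "K \<union> Q"] WU(1) Q(3) w by blast
  then have "p3 \<in> closure W" using p3(3) closure_mono by blast
  then show False using U(2) \<open>p3 \<in> U\<close> WU(1) by (metis IntI empty_iff open_Int_closure_eq_empty inf_commute)
qed

section \<open>Connected vertex sets, paths and minors\<close>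

definition adjacent :: "'a set set \<Rightarrow> 'a set \<Rightarrow> 'a set \<Rightarrow> bool" where
  "adjacent E A B \<longleftrightarrow> (\<exists>a\<in>A. \<exists>b\<in>B. {a, b} \<in> E)"

definition edge_rel :: "'a set set \<Rightarrow> 'a set \<Rightarrow> ('a \<times> 'a) set" where
  "edge_rel E A = {(x, y). x \<in> A \<and> y \<in> A \<and> {x, y} \<in> E}"

text \<open>Nonemptiness is built in, as for the branch sets of a minor. Nothing confines
  \<open>A\<close> to the vertices of the graph: a singleton is connected wherever it lies.\<close>

definition connected_in :: "'a set set \<Rightarrow> 'a set \<Rightarrow> bool" where
  "connected_in E A \<longleftrightarrow> A \<noteq> {} \<and> (\<forall>x\<in>A. \<forall>y\<in>A. (x, y) \<in> (edge_rel E A)\<^sup>*)"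

definition component_in :: "'a set set \<Rightarrow> 'a set \<Rightarrow> 'a \<Rightarrow> 'a set" where
  "component_in E A x = {y. (x, y) \<in> (edge_rel E A)\<^sup>*}"

definition graph_path :: "'a set set \<Rightarrow> 'a list \<Rightarrow> bool" where
  "graph_path E xs \<longleftrightarrow> xs \<noteq> [] \<and> distinct xs \<and> successively (\<lambda>x y. {x, y} \<in> E) xs"

lemma adjacentI: "a \<in> A \<Longrightarrow> b \<in> B \<Longrightarrow> {a, b} \<in> E \<Longrightarrow> adjacent E A B"
  by (auto simp: adjacent_def)

lemma adjacent_sym: "adjacent E A B \<longleftrightarrow> adjacent E B A"
  unfolding adjacent_def by (metis insert_commute)

lemma adjacent_mono: "adjacent E A B \<Longrightarrow> A \<subseteq> A' \<Longrightarrow> B \<subseteq> B' \<Longrightarrow> adjacent E A' B'"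
  by (auto simp: adjacent_def)

lemma edge_rel_sym: "(x, y) \<in> edge_rel E A \<Longrightarrow> (y, x) \<in> edge_rel E A"
  by (auto simp: edge_rel_def insert_commute)

lemma edge_rel_rtrancl_sym: "(x, y) \<in> (edge_rel E A)\<^sup>* \<Longrightarrow> (y, x) \<in> (edge_rel E A)\<^sup>*"
  by (meson edge_rel_sym symI sym_rtrancl symD)

lemma edge_rel_rtrancl_mono:
  "(x, y) \<in> (edge_rel E A)\<^sup>* \<Longrightarrow> A \<subseteq> B \<Longrightarrow> (x, y) \<in> (edge_rel E B)\<^sup>*"
  by (rule rtrancl_mono[THEN subsetD]) (auto simp: edge_rel_def)

lemma connected_inI:
  assumes "z \<in> A" "\<And>x. x \<in> A \<Longrightarrow> (z, x) \<in> (edge_rel E A)\<^sup>*"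
  shows "connected_in E A"
  unfolding connected_in_def using assms by (meson edge_rel_rtrancl_sym empty_iff rtrancl_trans)

lemma connected_in_singleton: "connected_in E {x}"
  by (rule connected_inI[of x]) auto

lemma connected_in_cut:
  assumes "connected_in E A" "X \<subseteq> A" "X \<noteq> {}" "X \<noteq> A"
  obtains x y where "x \<in> X" "y \<in> A - X" "{x, y} \<in> E"
proof -
  obtain a b where a: "a \<in> X" and b: "b \<in> A" "b \<notin> X" using assms by blast
  then have "(a, b) \<in> (edge_rel E A)\<^sup>*" using assms unfolding connected_in_def by blast
  then have "b \<in> X \<or> (\<exists>x\<in>X. \<exists>y\<in>A - X. {x, y} \<in> E)"
    by (induction rule: rtrancl_induct) (use a in \<open>auto simp: edge_rel_def\<close>)
  then show thesis using b that by blast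
qed

lemma connected_in_Un:
  assumes A: "connected_in E A" and B: "connected_in E B" and AB: "A \<inter> B \<noteq> {} \<or> adjacent E A B"
  shows "connected_in E (A \<union> B)"
proof -
  obtain a b where a: "a \<in> A" and b: "b \<in> B" and ab: "(a, b) \<in> (edge_rel E (A \<union> B))\<^sup>*"
    using AB unfolding adjacent_def edge_rel_def by blast
  show ?thesis
  proof (rule connected_inI[of a])
    fix x assume "x \<in> A \<union> B"
    then show "(a, x) \<in> (edge_rel E (A \<union> B))\<^sup>*"
    proof
      assume "x \<in> A"
      then show ?thesis using A a edge_rel_rtrancl_mono[of a x E A "A \<union> B"]
        by (auto simp: connected_in_def)
    next
      assume "x \<in> B"
      then have "(b, x) \<in> (edge_rel E (A \<union> B))\<^sup>*"
        using B b edge_rel_rtrancl_mono[of b x E B "A \<union> B"] by (auto simp: connected_in_def)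
      then show ?thesis using ab by (rule rtrancl_trans[rotated])
    qed
  qed (use a in simp)
qed

text \<open>Serves for unions of many pieces around a core, such as the translates of a path, or a
  connected set together with components left after its deletion.\<close>

lemma connected_in_star:
  assumes Z: "connected_in E Z" "Z \<subseteq> A"
    and "\<And>x. x \<in> A \<Longrightarrow> \<exists>C. connected_in E C \<and> x \<in> C \<and> C \<subseteq> A \<and> (Z \<inter> C \<noteq> {} \<or> adjacent E Z C)"
  shows "connected_in E A"
proof -
  obtain z where z: "z \<in> Z" using Z(1) by (auto simp: connected_in_def)
  show ?thesis
  proof (rule connected_inI[of z])
    fix x assume "x \<in> A"
    then obtain C where C: "connected_in E C" "x \<in> C" "C \<subseteq> A" "Z \<inter> C \<noteq> {} \<or> adjacent E Z C"
      using assms(3)[OF \<open>x \<in> A\<close>] by metis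
    then have "connected_in E (Z \<union> C)" using connected_in_Un[OF Z(1)] by metis
    then have "(z, x) \<in> (edge_rel E (Z \<union> C))\<^sup>*" using z C(2) by (auto simp: connected_in_def)
    then show "(z, x) \<in> (edge_rel E A)\<^sup>*" by (rule edge_rel_rtrancl_mono) (use C Z in auto)
  qed (use z Z in auto)
qed

lemma component_in_self: "x \<in> component_in E A x"
  by (simp add: component_in_def)

lemma component_in_subset: "x \<in> A \<Longrightarrow> component_in E A x \<subseteq> A"
proof
  fix y assume x: "x \<in> A" and "y \<in> component_in E A x"
  then have "(x, y) \<in> (edge_rel E A)\<^sup>*" by (simp add: component_in_def)
  then show "y \<in> A" by (induction rule: rtrancl_induct) (use x in \<open>auto simp: edge_rel_def\<close>)
qed

lemma component_in_closed:
  assumes "x \<in> A" "y \<in> component_in E A x" "z \<in> A" "{y, z} \<in> E"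
  shows "z \<in> component_in E A x"
proof -
  have "y \<in> A" using component_in_subset[OF assms(1)] assms(2) by blast
  then have "(y, z) \<in> edge_rel E A" using assms by (simp add: edge_rel_def)
  then show ?thesis using assms(2) by (auto simp: component_in_def)
qed

lemma connected_component_in:
  assumes "x \<in> A"
  shows "connected_in E (component_in E A x)"
proof (rule connected_inI[of x])
  fix y assume "y \<in> component_in E A x"
  then have "(x, y) \<in> (edge_rel E A)\<^sup>*" by (simp add: component_in_def)
  then show "(x, y) \<in> (edge_rel E (component_in E A x))\<^sup>*"
  proof (induction rule: rtrancl_induct)
    case (step y z)
    have "y \<in> component_in E A x" "z \<in> component_in E A x" "{y, z} \<in> E"
      using step(1,2) rtrancl_into_rtrancl[OF step(1,2)] by (simp_all add: component_in_def) (simp add: edge_rel_def)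
    then have "(y, z) \<in> edge_rel E (component_in E A x)" by (simp add: edge_rel_def)
    then show ?case using step by auto
  qed simp
qed (simp add: component_in_self)

lemma component_in_eq: "y \<in> component_in E A x \<Longrightarrow> component_in E A y = component_in E A x"
  unfolding component_in_def by (auto intro: rtrancl_trans edge_rel_rtrancl_sym)

lemma component_in_disjoint:
  "component_in E A x \<inter> component_in E A y \<noteq> {} \<Longrightarrow> component_in E A x = component_in E A y"
  using component_in_eq by (metis disjoint_iff)

lemma connected_subset_component:
  assumes "connected_in E C" "C \<subseteq> A" "x \<in> C"
  shows "C \<subseteq> component_in E A x"
  using assms edge_rel_rtrancl_mono[of x _ E C A] by (auto simp: component_in_def connected_in_def)

text \<open>Connectedness of \<open>D\<close> yields an edge out of the component. Its other end
  cannot lie in \<open>D - Z\<close>, or it would belong to the component, so it lies in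
  \<open>Z\<close>.\<close>

lemma component_of_diff_adjacent:
  assumes "connected_in E D" "Z \<subseteq> D" "Z \<noteq> {}" "x \<in> D - Z"
  shows "adjacent E Z (component_in E (D - Z) x)"
proof -
  let ?C = "component_in E (D - Z) x"
  have sub: "?C \<subseteq> D - Z" using component_in_subset[OF assms(4)] .
  have "?C \<subseteq> D" "?C \<noteq> {}" "?C \<noteq> D"
    using sub assms component_in_self[of x E "D - Z"] by auto
  then obtain u v where uv: "u \<in> ?C" "v \<in> D - ?C" "{u, v} \<in> E"
    using connected_in_cut[OF assms(1)] by metis
  have "v \<in> Z" using component_in_closed[OF assms(4) uv(1) _ uv(3)] uv(2) by blast
  then show ?thesis using uv by (auto intro: adjacentI simp: adjacent_sym[of E Z])
qed

section \<open>Simple paths as lists of vertices\<close>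

lemma graph_path_Cons:
  "graph_path E (x # xs) \<longleftrightarrow> xs = [] \<or> (graph_path E xs \<and> x \<notin> set xs \<and> {x, hd xs} \<in> E)"
  by (cases xs) (auto simp: graph_path_def)

lemma graph_path_append:
  "graph_path E (xs @ ys) \<longleftrightarrow> (xs = [] \<and> graph_path E ys) \<or> (ys = [] \<and> graph_path E xs) \<or>
     (graph_path E xs \<and> graph_path E ys \<and> set xs \<inter> set ys = {} \<and> {last xs, hd ys} \<in> E)"
  by (auto simp: graph_path_def successively_append_iff)

lemma graph_path_rev: "graph_path E (rev xs) \<longleftrightarrow> graph_path E xs"
  by (simp add: graph_path_def successively_rev insert_commute)

text \<open>From length 2 on every entry lies on an edge; a one-element list is a path whatever its
  entry.\<close>

lemma graph_path_vertices_subset: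
  assumes "\<And>e. e \<in> E \<Longrightarrow> e \<subseteq> V"
  shows "graph_path E xs \<Longrightarrow> 2 \<le> length xs \<Longrightarrow> set xs \<subseteq> V"
proof (induction xs)
  case (Cons x xs)
  then show ?case using assms[of "{x, hd xs}"]
    by (cases xs; cases "tl xs") (auto simp: graph_path_Cons)
qed simp

lemma connected_graph_path: "graph_path E xs \<Longrightarrow> connected_in E (set xs)"
proof (induction xs)
  case (Cons x xs)
  show ?case
  proof (cases "xs = []")
    case False
    then have "adjacent E {x} (set xs)" "connected_in E (set xs)"
      using Cons by (auto simp: adjacent_def graph_path_Cons intro!: bexI[of _ "hd xs"])
    then have "connected_in E ({x} \<union> set xs)" by (intro connected_in_Un connected_in_singleton) auto
    then show ?thesis by simp
  qed (simp add: connected_in_singleton)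
qed (simp add: graph_path_def)

lemma connected_in_obtain_path:
  assumes "connected_in E A" "x \<in> A" "y \<in> A"
  obtains xs where "graph_path E xs" "hd xs = x" "last xs = y" "set xs \<subseteq> A"
proof -
  have "(x, y) \<in> (edge_rel E A)\<^sup>*" using assms by (auto simp: connected_in_def)
  then have "\<exists>xs. graph_path E xs \<and> hd xs = x \<and> last xs = y \<and> set xs \<subseteq> A"
  proof (induction rule: rtrancl_induct)
    case base
    then show ?case using assms by (intro exI[of _ "[x]"]) (auto simp: graph_path_def)
  next
    case (step y z)
    then obtain xs where xs: "graph_path E xs" "hd xs = x" "last xs = y" "set xs \<subseteq> A" by blast
    have yz: "z \<in> A" "{y, z} \<in> E" using step by (auto simp: edge_rel_def)
    show ?case
    \<comment> \<open>If the walk runs into its own path, cutting the path at that vertex keeps it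
      free of repetitions.\<close>
    proof (cases "z \<in> set xs")
      case True
      then obtain us vs where "xs = us @ z # vs" by (meson split_list)
      then show ?thesis using xs
        by (intro exI[of _ "us @ [z]"]) (auto simp: graph_path_append graph_path_Cons hd_append)
    next
      case False
      then show ?thesis using xs yz
        by (intro exI[of _ "xs @ [z]"]) (auto simp: hd_append graph_path_def successively_append_iff)
    qed
  qed
  then show thesis using that by blast
qed

lemma connected_in_image:
  assumes "connected_in E A" "\<And>u v. {u, v} \<in> E \<Longrightarrow> {f u, f v} \<in> E"
  shows "connected_in E (f ` A)"
proof -
  obtain a where a: "a \<in> A" using assms by (auto simp: connected_in_def)
  show ?thesis
  proof (rule connected_inI[of "f a"])
    fix x assume "x \<in> f ` A"
    then obtain y where y: "y \<in> A" "x = f y" by blast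
    have "(a, y) \<in> (edge_rel E A)\<^sup>*" using assms a y by (auto simp: connected_in_def)
    then have "(f a, f y) \<in> (edge_rel E (f ` A))\<^sup>*"
    proof (induction rule: rtrancl_induct)
      case (step y z)
      then have "(f y, f z) \<in> edge_rel E (f ` A)" using assms(2) by (auto simp: edge_rel_def)
      then show ?case using step by auto
    qed simp
    then show "(f a, x) \<in> (edge_rel E (f ` A))\<^sup>*" using y by simp
  qed (use a in simp)
qed

text \<open>The minor is given by its six branch sets, so that no contracted graph has to be formed.
  The equations with unions amount to pairwise disjointness.\<close>

definition k33_minor :: "'a set set \<Rightarrow> bool" where
  "k33_minor E \<longleftrightarrow> (\<exists>A1 A2 A3 B1 B2 B3.
     connected_in E A1 \<and> connected_in E A2 \<and> connected_in E A3 \<and>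
     connected_in E B1 \<and> connected_in E B2 \<and> connected_in E B3 \<and>
     A1 \<inter> (A2 \<union> A3 \<union> B1 \<union> B2 \<union> B3) = {} \<and> A2 \<inter> (A3 \<union> B1 \<union> B2 \<union> B3) = {} \<and>
     A3 \<inter> (B1 \<union> B2 \<union> B3) = {} \<and> B1 \<inter> (B2 \<union> B3) = {} \<and> B2 \<inter> B3 = {} \<and>
     adjacent E A1 B1 \<and> adjacent E A1 B2 \<and> adjacent E A1 B3 \<and>
     adjacent E A2 B1 \<and> adjacent E A2 B2 \<and> adjacent E A2 B3 \<and>
     adjacent E A3 B1 \<and> adjacent E A3 B2 \<and> adjacent E A3 B3)"

lemma k33_minorI:
  assumes "connected_in E A1" "connected_in E A2" "connected_in E A3"
    "connected_in E B1" "connected_in E B2" "connected_in E B3"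
    "A1 \<inter> (A2 \<union> A3 \<union> B1 \<union> B2 \<union> B3) = {}" "A2 \<inter> (A3 \<union> B1 \<union> B2 \<union> B3) = {}"
    "A3 \<inter> (B1 \<union> B2 \<union> B3) = {}" "B1 \<inter> (B2 \<union> B3) = {}" "B2 \<inter> B3 = {}"
    "adjacent E A1 B1" "adjacent E A1 B2" "adjacent E A1 B3"
    "adjacent E A2 B1" "adjacent E A2 B2" "adjacent E A2 B3"
    "adjacent E A3 B1" "adjacent E A3 B2" "adjacent E A3 B3"
  shows "k33_minor E"
  unfolding k33_minor_def using assms by blast

section \<open>Automorphisms without fixed vertices on a region\<close>

lemma graph_path_segment:
  assumes "graph_path E xs" "j \<le> i" "i < length xs"
  obtains ys where "graph_path E ys" "hd ys = xs ! j" "last ys = xs ! i"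
    "length ys = Suc (i - j)" "set ys \<subseteq> set xs"
proof (rule that)
  have "graph_path E (drop j xs)"
    using assms graph_path_append[of E "take j xs" "drop j xs"] by auto
  then show "graph_path E (take (Suc (i - j)) (drop j xs))"
    using assms graph_path_append[of E "take (Suc (i - j)) (drop j xs)" "drop (Suc (i - j)) (drop j xs)"]
    unfolding append_take_drop_id by auto
  show len: "length (take (Suc (i - j)) (drop j xs)) = Suc (i - j)" using assms by simp
  show "hd (take (Suc (i - j)) (drop j xs)) = xs ! j" using assms by (simp add: hd_drop_conv_nth)
  have "take (Suc (i - j)) (drop j xs) \<noteq> []" using len by fastforce
  then show "last (take (Suc (i - j)) (drop j xs)) = xs ! i" using assms len by (simp add: last_conv_nth)
  show "set (take (Suc (i - j)) (drop j xs)) \<subseteq> set xs"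
    by (meson set_drop_subset set_take_subset subset_trans)
qed

text \<open>Taking permutations of the whole type lets images commute with differences of vertex
  sets. An automorphism of a graph enters after extension by the identity outside its
  vertices.\<close>

locale edge_permutation =
  fixes E :: "'a set set" and \<sigma> :: "'a \<Rightarrow> 'a"
  assumes bij: "bij \<sigma>" and edge_iff: "\<And>u v. {\<sigma> u, \<sigma> v} \<in> E \<longleftrightarrow> {u, v} \<in> E"
begin

lemma inj: "inj \<sigma>" using bij by (rule bij_is_inj)

lemma adjacent_image: "adjacent E (\<sigma> ` A) (\<sigma> ` B) \<longleftrightarrow> adjacent E A B"
  by (auto simp: adjacent_def edge_iff)

lemma connected_image: "connected_in E A \<Longrightarrow> connected_in E (\<sigma> ` A)"
  by (rule connected_in_image) (simp_all add: edge_iff)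

lemma image_rtrancl:
  assumes "\<sigma> ` A = A" "(x, y) \<in> (edge_rel E A)\<^sup>*"
  shows "(\<sigma> x, \<sigma> y) \<in> (edge_rel E A)\<^sup>*"
  using assms(2)
proof (induction rule: rtrancl_induct)
  case (step y z)
  then have "(\<sigma> y, \<sigma> z) \<in> edge_rel E A" using assms(1) by (auto simp: edge_rel_def edge_iff)
  then show ?case using step by auto
qed simp

lemma component_image:
  assumes "\<sigma> ` A = A" "x \<in> A"
  shows "\<sigma> ` component_in E A x = component_in E A (\<sigma> x)"
proof
  show "\<sigma> ` component_in E A x \<subseteq> component_in E A (\<sigma> x)"
    using image_rtrancl[OF assms(1)] by (auto simp: component_in_def)
  have sx: "\<sigma> x \<in> A" using assms by blast
  let ?C = "{y \<in> A. \<sigma> y \<in> component_in E A (\<sigma> x)}"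
  show "component_in E A (\<sigma> x) \<subseteq> \<sigma> ` component_in E A x"
  proof
    fix y assume "y \<in> component_in E A (\<sigma> x)"
    then have "(\<sigma> x, y) \<in> (edge_rel E A)\<^sup>*" by (simp add: component_in_def)
    then show "y \<in> \<sigma> ` component_in E A x"
    proof (induction rule: rtrancl_induct)
      case base
      then show ?case using component_in_self by fastforce
    next
      case (step y z)
      obtain y' where y': "y' \<in> component_in E A x" "y = \<sigma> y'" using step.IH by blast
      obtain z' where z': "z' \<in> A" "z = \<sigma> z'" using step.hyps assms(1) by (auto simp: edge_rel_def)
      have "{y', z'} \<in> E" using step.hyps y' z' by (simp add: edge_rel_def edge_iff)
      then have "z' \<in> component_in E A x" using component_in_closed[OF assms(2) y'(1) z'(1)] by simp
      then show ?case using z' by blast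
    qed
  qed
qed

lemma funpow_Suc_image: "(\<sigma> ^^ Suc k) ` A = \<sigma> ` (\<sigma> ^^ k) ` A"
  by (simp add: image_image)

lemma adjacent_power_image:
  assumes "\<sigma> ` A = A"
  shows "adjacent E ((\<sigma> ^^ k) ` I) A \<longleftrightarrow> adjacent E I A"
proof (induction k)
  case (Suc k)
  have "adjacent E ((\<sigma> ^^ Suc k) ` I) A = adjacent E (\<sigma> ` (\<sigma> ^^ k) ` I) (\<sigma> ` A)"
    using assms by (simp only: funpow_Suc_image)
  then show ?case using Suc adjacent_image by simp
qed simp

text \<open>A shortest path from some \<open>y\<close> to \<open>\<sigma> y\<close> meets its own image only in \<open>\<sigma> y\<close>.\<close>

lemma obtain_orbit_segment:
  assumes D: "finite D" "connected_in E D" "\<sigma> ` D = D" "\<And>x. x \<in> D \<Longrightarrow> \<sigma> x \<noteq> x"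
  obtains I Z where "connected_in E I" "I \<inter> \<sigma> ` I = {}" "I \<subseteq> Z" "Z \<subseteq> D" "connected_in E Z" "\<sigma> ` Z = Z"
    "\<And>z. z \<in> Z \<Longrightarrow> \<exists>k. z \<in> (\<sigma> ^^ k) ` I"
proof -
  let ?P = "\<lambda>xs. graph_path E xs \<and> last xs = \<sigma> (hd xs) \<and> set xs \<subseteq> D"
  obtain y where "y \<in> D" using D(2) by (auto simp: connected_in_def)
  then obtain ys where "?P ys" using connected_in_obtain_path[OF D(2), of y "\<sigma> y"] D(3) by (metis imageI)
  \<comment> \<open>The length is minimized over all starting vertices together; this is what makes
    the shortcuts below contradictory.\<close>
  then obtain xs where xs: "graph_path E xs" "last xs = \<sigma> (hd xs)" "set xs \<subseteq> D"
    and min: "\<And>ys. ?P ys \<Longrightarrow> length xs \<le> length ys"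
    using ex_has_least_nat[of ?P ys length] by blast
  have ne: "xs \<noteq> []" using xs(1) by (simp add: graph_path_def)
  \<comment> \<open>The last vertex is dropped because, as the image of the first, it lies in the
    image of this set.\<close>
  let ?I = "set (butlast xs)"
  have hdD: "hd xs \<in> D" using xs(3) ne hd_in_set by blast
  have "hd xs \<noteq> last xs" using D(4)[OF hdD] xs(2) by simp
  then have bne: "butlast xs \<noteq> []" using ne by (cases xs) auto
  then have hdI: "hd xs \<in> ?I" by (metis append_butlast_last_id hd_append2 hd_in_set ne)
  have I: "connected_in E ?I"
  proof (rule connected_graph_path)
    show "graph_path E (butlast xs)"
      using xs(1) bne graph_path_append[of E "butlast xs" "[last xs]"] append_butlast_last_id[OF ne] by auto
  qed
  have disj: "?I \<inter> \<sigma> ` ?I = {}"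
  \<comment> \<open>If \<open>xs ! i = \<sigma> (xs ! j)\<close> with both indices before the last,
    the part of the path between them, read in the right direction, is a shorter path from a vertex
    to its image.\<close>
  proof (rule ccontr)
    assume "?I \<inter> \<sigma> ` ?I \<noteq> {}"
    then obtain i j where ij: "i < length xs - 1" "j < length xs - 1" "xs ! i = \<sigma> (xs ! j)"
      by (auto simp: in_set_conv_nth nth_butlast)
    have lt: "i < length xs" "j < length xs" using ij by simp_all
    show False
    proof (cases "j \<le> i")
      case True
      obtain zs where zs: "graph_path E zs" "hd zs = xs ! j" "last zs = xs ! i"
        "length zs = Suc (i - j)" "set zs \<subseteq> set xs" using graph_path_segment[OF xs(1) True lt(1)] .
      have "set zs \<subseteq> D" using zs(5) xs(3) by (rule subset_trans)
      then have "length xs \<le> length zs" using min[of zs] zs ij by simp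
      then show False using zs(4) ij by simp
    next
      case False
      then have le: "i \<le> j" by simp
      obtain zs where zs: "graph_path E zs" "hd zs = xs ! i" "last zs = xs ! j"
        "length zs = Suc (j - i)" "set zs \<subseteq> set xs" using graph_path_segment[OF xs(1) le lt(2)] .
      have "set zs \<subseteq> D" using zs(5) xs(3) by (rule subset_trans)
      then have "length xs \<le> length (rev zs)"
        using min[of "rev zs"] zs ij by (simp add: graph_path_rev hd_rev last_rev)
      then show False using zs(4) ij by simp
    qed
  qed
  \<comment> \<open>Consecutive translates of the path share an end, which makes the orbit
    connected.\<close>
  let ?Z = "\<Union>k. (\<sigma> ^^ k) ` set xs"
  have powD: "(\<sigma> ^^ k) ` D = D" for k
    by (induction k) (use D(3) in \<open>simp_all add: funpow_Suc_image del: funpow.simps(2)\<close>)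
  have ZD: "?Z \<subseteq> D" using powD xs(3) by blast
  have sZ: "\<sigma> ` ?Z \<subseteq> ?Z"
  proof
    fix z assume "z \<in> \<sigma> ` ?Z"
    then obtain k x where "x \<in> set xs" "z = (\<sigma> ^^ Suc k) x" by auto
    then show "z \<in> ?Z" by blast
  qed
  \<comment> \<open>An injective map of a finite set into itself is onto, so nonnegative powers
    suffice.\<close>
  have "\<sigma> ` ?Z = ?Z"
    using sZ inj_on_subset[OF inj] finite_subset[OF ZD D(1)]
    by (metis endo_inj_surj subset_UNIV)
  moreover have "connected_in E ?Z"
  proof -
    have step: "connected_in E ((\<sigma> ^^ k) ` set xs)" for k
      by (induction k) (use xs(1) connected_graph_path connected_image in \<open>simp_all add: funpow_Suc_image del: funpow.simps(2)\<close>)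
    have "connected_in E (\<Union>k\<le>n. (\<sigma> ^^ k) ` set xs)" for n
    proof (induction n)
      case 0
      then show ?case using step[of 0] by simp
    next
      case (Suc n)
      have "(\<sigma> ^^ Suc n) (hd xs) = (\<sigma> ^^ n) (last xs)" using xs(2) by (simp add: funpow_swap1)
      then have "(\<sigma> ^^ Suc n) (hd xs) \<in> (\<Union>k\<le>n. (\<sigma> ^^ k) ` set xs) \<inter> (\<sigma> ^^ Suc n) ` set xs"
        using ne by (metis (no_types, lifting) IntI UN_I atMost_iff hd_in_set imageI last_in_set order_refl)
      then show ?case using connected_in_Un[OF Suc.IH step[of "Suc n"]]
        by (metis (no_types, lifting) UN_insert Un_commute atMost_Suc empty_iff)
    qed note pre = this
    show ?thesis
    proof (rule connected_in_star[of E "set xs"])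
      show "connected_in E (set xs)" using xs(1) connected_graph_path by blast
      show "set xs \<subseteq> ?Z" by (rule order_trans[OF _ UN_upper[of 0]]) auto
      fix x assume "x \<in> ?Z"
      then obtain n where n: "x \<in> (\<sigma> ^^ n) ` set xs" by blast
      have "set xs \<subseteq> (\<Union>k\<le>n. (\<sigma> ^^ k) ` set xs)" by (rule order_trans[OF _ UN_upper[of 0]]) auto
      then show "\<exists>C. connected_in E C \<and> x \<in> C \<and> C \<subseteq> ?Z \<and> (set xs \<inter> C \<noteq> {} \<or> adjacent E (set xs) C)"
        using n ne by (intro exI[of _ "\<Union>k\<le>n. (\<sigma> ^^ k) ` set xs"] conjI pre) (auto simp: Int_absorb2)
    qed
  qed
  moreover have "\<exists>k. z \<in> (\<sigma> ^^ k) ` ?I" if z: "z \<in> ?Z" for z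
  proof -
    obtain k x where k: "x \<in> set xs" "z = (\<sigma> ^^ k) x" using z by blast
    show ?thesis
    proof (cases "x \<in> ?I")
      case True
      then show ?thesis using k by blast
    next
      case False
      then have "x = last xs" using k(1) append_butlast_last_id[OF ne] by (metis Un_iff list.set(1,2) set_append singletonD)
      then have "z = (\<sigma> ^^ Suc k) (hd xs)" using k xs(2) by (simp add: funpow_swap1)
      then show ?thesis using hdI by blast
    qed
  qed
  moreover have "?I \<subseteq> ?Z"
  proof
    fix x assume "x \<in> ?I"
    then have "x \<in> (\<sigma> ^^ 0) ` set xs" by (auto dest: in_set_butlastD)
    then show "x \<in> ?Z" by blast
  qed
  ultimately show thesis using that[of ?I ?Z] I disj ZD by blast
qed

text \<open>If \<open>Y\<close> and its image differ, they are disjoint and, together with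
  \<open>T\<close>, face \<open>P\<close>, \<open>Q\<close> and an enlarged \<open>R\<close> in a
  \<open>K\<^sub>3\<^sub>,\<^sub>3\<close>. Otherwise \<open>Y\<close> is a smaller invariant region
  touching \<open>P\<close>, \<open>Q\<close> and an enlarged \<open>R\<close>, so an induction on
  the region can continue.\<close>

lemma component_step:
  assumes D: "connected_in E D" "\<sigma> ` D = D"
    and Z: "connected_in E Z" "Z \<subseteq> D" "\<sigma> ` Z = Z"
    and y: "y \<in> D - Z" and Y: "Y = component_in E (D - Z) y"
    and conn: "connected_in E P" "connected_in E Q" "connected_in E R" "connected_in E T"
    and inv: "\<sigma> ` P = P" "\<sigma> ` Q = Q" "\<sigma> ` R = R"
    and disj: "D \<inter> (P \<union> Q \<union> R \<union> T) = {}" "T \<inter> (P \<union> Q \<union> R) = {}" "P \<inter> (Q \<union> R) = {}" "Q \<inter> R = {}"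
    and adj: "adjacent E D R" "adjacent E Y P" "adjacent E Y Q"
      "adjacent E T P" "adjacent E T Q" "adjacent E T R"
  shows "k33_minor E \<or> (\<sigma> ` Y = Y \<and>
    (\<exists>R'. connected_in E R' \<and> \<sigma> ` R' = R' \<and> R \<subseteq> R' \<and> R' \<subseteq> R \<union> (D - Y) \<and> adjacent E Y R'))"
proof -
  let ?Y' = "\<sigma> ` Y" and ?W = "D - Y - \<sigma> ` Y"
  have DZ: "\<sigma> ` (D - Z) = D - Z" using D(2) Z(3) inj by (simp add: image_set_diff)
  have sy: "\<sigma> y \<in> D - Z" using y DZ by blast
  have Y': "?Y' = component_in E (D - Z) (\<sigma> y)" using component_image[OF DZ y] Y by simp
  have YD: "Y \<subseteq> D - Z" and Y'D: "?Y' \<subseteq> D - Z"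
    using component_in_subset[OF y] component_in_subset[OF sy] Y Y' by simp_all
  have Zne: "Z \<noteq> {}" using Z(1) by (simp add: connected_in_def)
  have cY: "connected_in E Y" "connected_in E ?Y'"
    using connected_component_in[OF y] connected_component_in[OF sy] Y Y' by simp_all
  have ZY: "adjacent E Z Y" "adjacent E Z ?Y'"
    using component_of_diff_adjacent[OF D(1) Z(2) Zne] y sy Y Y' by simp_all
  have ZW: "Z \<subseteq> ?W" using YD Y'D Z(2) by blast
  \<comment> \<open>What is left of \<open>D\<close> is \<open>Z\<close> with the other components
    of \<open>D - Z\<close>, each of which hangs on \<open>Z\<close>.\<close>
  have cW: "connected_in E ?W"
  proof (rule connected_in_star[OF Z(1) ZW])
    fix x assume x: "x \<in> ?W"
    show "\<exists>C. connected_in E C \<and> x \<in> C \<and> C \<subseteq> ?W \<and> (Z \<inter> C \<noteq> {} \<or> adjacent E Z C)"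
    proof (cases "x \<in> Z")
      case True
      then show ?thesis using Z(1) ZW by blast
    next
      case False
      then have xD: "x \<in> D - Z" using x by blast
      let ?C = "component_in E (D - Z) x"
      have "?C \<inter> Y = {}" "?C \<inter> ?Y' = {}"
        using component_in_disjoint[of E "D - Z" x y] component_in_disjoint[of E "D - Z" x "\<sigma> y"]
          component_in_self[of x E "D - Z"] x Y Y' by auto
      then have "?C \<subseteq> ?W" using component_in_subset[OF xD] by blast
      then show ?thesis using connected_component_in[OF xD] component_in_self[of x E "D - Z"]
          component_of_diff_adjacent[OF D(1) Z(2) Zne xD] by blast
    qed
  qed
  have Y'adj: "adjacent E ?Y' A \<longleftrightarrow> adjacent E Y A" if "\<sigma> ` A = A" for A
    using adjacent_image[of Y A] that by simp
  \<comment> \<open>If \<open>Y\<close> misses \<open>R\<close>, so does its image by invariance of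
    \<open>R\<close>. The edge from \<open>D\<close> to \<open>R\<close> then starts in the rest of
    \<open>D\<close>, which joins that rest to \<open>R\<close> and brings it next to
    \<open>Y\<close> through \<open>Z\<close>.\<close>
  define R' where "R' = (if adjacent E Y R then R else R \<union> ?W)"
  have R'sub: "R \<subseteq> R'" "R' \<subseteq> R \<union> ?W" by (auto simp: R'_def)
  have cR': "connected_in E R'"
  proof (cases "adjacent E Y R")
    case False
    then have "\<not> adjacent E ?Y' R" using Y'adj inv by blast
    then have "adjacent E ?W R" using False adj(1) unfolding adjacent_def by blast
    then show ?thesis using connected_in_Un[OF conn(3) cW] False adjacent_sym[of E R] by (simp add: R'_def)
  qed (use conn R'_def in simp)
  have R'Y: "adjacent E Y R' \<and> adjacent E ?Y' R'"
  proof (cases "adjacent E Y R")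
    case True
    then show ?thesis using Y'adj[OF inv(3)] by (simp add: R'_def)
  next
    case False
    then show ?thesis
      using adjacent_mono[OF ZY(1), of ?W Y] adjacent_mono[OF ZY(2), of ?W ?Y'] ZW
      by (auto simp: R'_def adjacent_sym[of E Y] adjacent_sym[of E ?Y'] intro: adjacent_mono)
  qed
  show ?thesis
  proof (cases "?Y' = Y")
    case True
    have "\<sigma> ` ?W = ?W" using True D(2) inj by (simp add: image_set_diff)
    then have "\<sigma> ` R' = R'" using inv(3) by (simp add: R'_def image_Un)
    then show ?thesis using True cR' R'sub R'Y by auto
  next
    case False
    then have YY': "Y \<inter> ?Y' = {}" using component_in_disjoint[of E "D - Z" y "\<sigma> y"] Y Y' by metis
    have "k33_minor E"
    proof (rule k33_minorI[of E Y ?Y' T P Q R'])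
      have YR: "Y \<inter> R' = {}" using R'sub(2) disj(1) YD by blast
      have Y'R: "?Y' \<inter> R' = {}" using R'sub(2) disj(1) Y'D by blast
      have TR: "T \<inter> R' = {}" using R'sub(2) disj(1,2) by blast
      have PR: "P \<inter> R' = {}" using R'sub(2) disj(1,3) by blast
      show QR: "Q \<inter> R' = {}" using R'sub(2) disj(1,4) by blast
      show "Y \<inter> (?Y' \<union> T \<union> P \<union> Q \<union> R') = {}" using YR YY' YD disj(1) by blast
      show "?Y' \<inter> (T \<union> P \<union> Q \<union> R') = {}" using Y'R Y'D disj(1) by blast
      show "T \<inter> (P \<union> Q \<union> R') = {}" using TR disj(2) by blast
      show "P \<inter> (Q \<union> R') = {}" using PR disj(3) by blast
      show "adjacent E T R'" using adjacent_mono[OF adj(6) subset_refl R'sub(1)] .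
    qed (use cY conn cR' adj R'Y Y'adj inv in simp_all)
    then show ?thesis ..
  qed
qed

text \<open>Makes the core \<open>Z\<close> itself touch the attachment: an edge from
  \<open>D - Z\<close> into \<open>P\<close> starts in a component that is absorbed, and that
  component touches \<open>Z\<close>. Since \<open>P\<close> is invariant, a component is absorbed
  together with its image.\<close>

lemma absorb_components:
  assumes D: "connected_in E D" "\<sigma> ` D = D"
    and Z: "connected_in E Z" "Z \<subseteq> D" "\<sigma> ` Z = Z"
    and P: "connected_in E P" "\<sigma> ` P = P" "adjacent E D P"
  defines "P' \<equiv> P \<union> {x \<in> D - Z. adjacent E (component_in E (D - Z) x) P}"
  shows "connected_in E P'" "\<sigma> ` P' = P'" "adjacent E Z P'"
proof -
  let ?C = "component_in E (D - Z)"
  have DZ: "\<sigma> ` (D - Z) = D - Z" using D(2) Z(3) inj by (simp add: image_set_diff)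
  have Zne: "Z \<noteq> {}" using Z(1) by (simp add: connected_in_def)
  have CP: "?C x \<subseteq> P'" if "x \<in> D - Z" "adjacent E (?C x) P" for x
    using that component_in_subset[of x "D - Z" E] component_in_eq[of _ E "D - Z" x] by (auto simp: P'_def)
  show "connected_in E P'"
  proof (rule connected_in_star[OF P(1)])
    fix x assume "x \<in> P'"
    then consider "x \<in> P" | "x \<in> D - Z" "adjacent E (?C x) P" by (auto simp: P'_def)
    then show "\<exists>C. connected_in E C \<and> x \<in> C \<and> C \<subseteq> P' \<and> (P \<inter> C \<noteq> {} \<or> adjacent E P C)"
    proof cases
      case 1
      then show ?thesis using P(1) by (intro exI[of _ P]) (auto simp: P'_def)
    next
      case 2
      then show ?thesis using CP[OF 2] connected_component_in[OF 2(1)] component_in_self[of x E]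
        by (intro exI[of _ "?C x"]) (auto simp: adjacent_sym[of E P])
    qed
  qed (auto simp: P'_def)
  have "\<sigma> ` {x \<in> D - Z. adjacent E (?C x) P} = {x \<in> D - Z. adjacent E (?C x) P}"
  proof -
    have *: "adjacent E (?C (\<sigma> x)) P \<longleftrightarrow> adjacent E (?C x) P" if "x \<in> D - Z" for x
      using component_image[OF DZ that] adjacent_image[of "?C x" P] P(2) by simp
    show ?thesis
    proof
      show "\<sigma> ` {x \<in> D - Z. adjacent E (?C x) P} \<subseteq> {x \<in> D - Z. adjacent E (?C x) P}"
        using * DZ by blast
      show "{x \<in> D - Z. adjacent E (?C x) P} \<subseteq> \<sigma> ` {x \<in> D - Z. adjacent E (?C x) P}"
      proof
        fix x assume x: "x \<in> {x \<in> D - Z. adjacent E (?C x) P}"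
        then obtain x' where x': "x' \<in> D - Z" "x = \<sigma> x'" using DZ by blast
        then show "x \<in> \<sigma> ` {x \<in> D - Z. adjacent E (?C x) P}" using x * by blast
      qed
    qed
  qed
  then show "\<sigma> ` P' = P'" using P(2) by (simp add: P'_def image_Un)
  obtain d p where dp: "d \<in> D" "p \<in> P" "{d, p} \<in> E" using P(3) by (auto simp: adjacent_def)
  show "adjacent E Z P'"
  proof (cases "d \<in> Z")
    case True
    then show ?thesis using dp by (auto simp: adjacent_def P'_def)
  next
    case False
    then have d: "d \<in> D - Z" using dp by blast
    have "adjacent E (?C d) P" using dp component_in_self[of d E] by (auto simp: adjacent_def)
    then show ?thesis
      using adjacent_mono[OF component_of_diff_adjacent[OF D(1) Z(2) Zne d] subset_refl CP[OF d]] by blast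
  qed
qed

text \<open>In a plane drawing, \<open>\<sigma>\<close> would act on \<open>D\<close> like a rotation or a reflection, and neither has
  room for three invariant attachments on the boundary of the face containing \<open>T\<close>.\<close>

lemma invariant_region_k33_minor:
  assumes "finite D" "connected_in E D" "\<sigma> ` D = D" "\<And>x. x \<in> D \<Longrightarrow> \<sigma> x \<noteq> x"
    and "connected_in E P" "connected_in E Q" "connected_in E R" "connected_in E T"
    and "\<sigma> ` P = P" "\<sigma> ` Q = Q" "\<sigma> ` R = R"
    and "D \<inter> (P \<union> Q \<union> R \<union> T) = {}" "T \<inter> (P \<union> Q \<union> R) = {}" "P \<inter> (Q \<union> R) = {}" "Q \<inter> R = {}"
    and "adjacent E D P" "adjacent E D Q" "adjacent E D R"
      "adjacent E T P" "adjacent E T Q" "adjacent E T R"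
  shows "k33_minor E"
  using assms
proof (induction "card D" arbitrary: D P Q R rule: less_induct)
  case less
  note D = less.prems(1-4) and conn = less.prems(5-8) and inv = less.prems(9-11)
    and disj = less.prems(12-15) and DP = less.prems(16-18) and TP = less.prems(19-21)
  obtain I Z where I: "connected_in E I" "I \<inter> \<sigma> ` I = {}" "I \<subseteq> Z"
    and Z: "Z \<subseteq> D" "connected_in E Z" "\<sigma> ` Z = Z"
    and orb: "\<And>z. z \<in> Z \<Longrightarrow> \<exists>k. z \<in> (\<sigma> ^^ k) ` I"
    by (rule obtain_orbit_segment[OF D]) (assumption | blast)+
  let ?C = "component_in E (D - Z)"
  have Zne: "Z \<noteq> {}" using Z(2) by (simp add: connected_in_def)
  \<comment> \<open>A component touching two attachments replaces \<open>D\<close> in the induction,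
    unless it is moved and yields the minor at once.\<close>
  have two: "k33_minor E" if y: "y \<in> D - Z" and adj: "adjacent E (?C y) P'" "adjacent E (?C y) Q'"
    and conn': "connected_in E P'" "connected_in E Q'" "connected_in E R'"
    and inv': "\<sigma> ` P' = P'" "\<sigma> ` Q' = Q'" "\<sigma> ` R' = R'"
    and disj': "D \<inter> (P' \<union> Q' \<union> R' \<union> T) = {}" "T \<inter> (P' \<union> Q' \<union> R') = {}" "P' \<inter> (Q' \<union> R') = {}" "Q' \<inter> R' = {}"
    and adj': "adjacent E D R'" "adjacent E T P'" "adjacent E T Q'" "adjacent E T R'"
    for y P' Q' R'
  proof -
    have CD: "?C y \<subseteq> D - Z" using component_in_subset[OF y] .
    then have "card (?C y) < card D" using D(1) Z(1) Zne by (intro psubset_card_mono) blast+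
    note IH = less.hyps[OF this]
    from component_step[OF D(2,3) Z(2,1,3) y refl conn' conn(4) inv' disj' adj'(1) adj adj'(2-4)]
    show ?thesis
    proof
      assume "\<sigma> ` ?C y = ?C y \<and> (\<exists>S. connected_in E S \<and> \<sigma> ` S = S \<and> R' \<subseteq> S \<and> S \<subseteq> R' \<union> (D - ?C y) \<and> adjacent E (?C y) S)"
      then obtain S where S: "\<sigma> ` ?C y = ?C y" "connected_in E S" "\<sigma> ` S = S" "R' \<subseteq> S" "S \<subseteq> R' \<union> (D - ?C y)" "adjacent E (?C y) S"
        by metis
      show ?thesis
      proof (rule IH[of P' Q' S])
        show "finite (?C y)" using CD D(1) by (meson finite_Diff finite_subset)
        show "connected_in E (?C y)" using connected_component_in[OF y] .
        show "\<sigma> x \<noteq> x" if "x \<in> ?C y" for x using D(4) CD that by blast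
        show "?C y \<inter> (P' \<union> Q' \<union> S \<union> T) = {}" using CD S(5) disj' by blast
        show "T \<inter> (P' \<union> Q' \<union> S) = {}" using S(5) disj' by blast
        show "P' \<inter> (Q' \<union> S) = {}" using S(5) disj' by blast
        show "Q' \<inter> S = {}" using S(5) disj' by blast
        show "adjacent E T S" using adjacent_mono[OF adj'(4) subset_refl S(4)] .
      qed (use S conn' inv' adj adj' conn in simp_all)
    qed
  qed
  show ?case
  proof (cases "\<exists>y\<in>D - Z. (adjacent E (?C y) P \<and> adjacent E (?C y) Q) \<or>
      (adjacent E (?C y) P \<and> adjacent E (?C y) R) \<or> (adjacent E (?C y) Q \<and> adjacent E (?C y) R)")
    case True
    then obtain y where y: "y \<in> D - Z" and
      *: "(adjacent E (?C y) P \<and> adjacent E (?C y) Q) \<or>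
      (adjacent E (?C y) P \<and> adjacent E (?C y) R) \<or> (adjacent E (?C y) Q \<and> adjacent E (?C y) R)" by metis
    have disj2: "D \<inter> (P \<union> R \<union> Q \<union> T) = {}" "T \<inter> (P \<union> R \<union> Q) = {}" "P \<inter> (R \<union> Q) = {}" "R \<inter> Q = {}"
      "D \<inter> (Q \<union> R \<union> P \<union> T) = {}" "T \<inter> (Q \<union> R \<union> P) = {}" "Q \<inter> (R \<union> P) = {}" "R \<inter> P = {}"
      using disj by blast+
    from * consider (a) "adjacent E (?C y) P" "adjacent E (?C y) Q" | (b) "adjacent E (?C y) P" "adjacent E (?C y) R"
      | (c) "adjacent E (?C y) Q" "adjacent E (?C y) R" by metis
    then show ?thesis
    proof cases
      case a
      show ?thesis by (rule two[OF y a conn(1,2,3) inv(1,2,3) disj DP(3) TP(1,2,3)])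
    next
      case b
      show ?thesis by (rule two[OF y b conn(1,3,2) inv(1,3,2) disj2(1-4) DP(2) TP(1,3,2)])
    next
      case c
      show ?thesis by (rule two[OF y c conn(2,3,1) inv(2,3,1) disj2(5-8) DP(1) TP(2,3,1)])
    qed
  next
    case False
    \<comment> \<open>No component touches two attachments, so absorbing components keeps the three
      attachments disjoint.\<close>
    define ab where "ab A = A \<union> {x \<in> D - Z. adjacent E (?C x) A}" for A
    note ab = absorb_components[OF D(2,3) Z(2,1,3), folded ab_def]
    \<comment> \<open>All translates of \<open>I\<close> touch the same invariant sets, so one edge
      from the orbit to \<open>A\<close> gives an edge from \<open>I\<close> and one from its image.
      Hence \<open>I\<close>, its image and \<open>T\<close> form one side of the minor.\<close>
    have aI: "adjacent E I A \<and> adjacent E (\<sigma> ` I) A" if "\<sigma> ` A = A" "adjacent E Z A" for A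
    proof -
      obtain z a where za: "z \<in> Z" "a \<in> A" "{z, a} \<in> E" using \<open>adjacent E Z A\<close> by (auto simp: adjacent_def)
      then obtain k where "z \<in> (\<sigma> ^^ k) ` I" using orb by blast
      then have "adjacent E ((\<sigma> ^^ k) ` I) A" using za by (auto simp: adjacent_def)
      then show ?thesis using adjacent_power_image[OF \<open>\<sigma> ` A = A\<close>] adjacent_image[of I A] \<open>\<sigma> ` A = A\<close> by simp
    qed
    note P' = ab[OF conn(1) inv(1) DP(1)] and Q' = ab[OF conn(2) inv(2) DP(2)] and R' = ab[OF conn(3) inv(3) DP(3)]
    have abD: "ab A \<subseteq> A \<union> (D - Z)" "A \<subseteq> ab A" for A by (auto simp: ab_def)
    have ID: "I \<subseteq> D" "\<sigma> ` I \<subseteq> D" and sI: "\<sigma> ` I \<subseteq> Z" using I Z by blast+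
    show ?thesis
    proof (rule k33_minorI[of E I "\<sigma> ` I" T "ab P" "ab Q" "ab R"])
      have dsj: "D \<inter> P = {}" "D \<inter> Q = {}" "D \<inter> R = {}" "D \<inter> T = {}" using disj(1) by blast+
      have IA: "I \<inter> ab A = {}" "\<sigma> ` I \<inter> ab A = {}" if "D \<inter> A = {}" for A
        using abD(1)[of A] that ID I(3) sI by blast+
      have TA: "T \<inter> ab A = {}" if "T \<inter> A = {}" for A
        using abD(1)[of A] that dsj(4) by blast
      have IT: "I \<inter> T = {}" "\<sigma> ` I \<inter> T = {}" using ID dsj(4) by blast+
      show "I \<inter> (\<sigma> ` I \<union> T \<union> ab P \<union> ab Q \<union> ab R) = {}" "\<sigma> ` I \<inter> (T \<union> ab P \<union> ab Q \<union> ab R) = {}"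
        by (simp_all only: Int_Un_distrib IA dsj IT I(2) Un_empty_left)
      show "T \<inter> (ab P \<union> ab Q \<union> ab R) = {}"
        using disj(2) by (simp add: Int_Un_distrib TA)
      have AB: "ab A \<inter> ab B = {}" if "A \<inter> B = {}" "D \<inter> A = {}" "D \<inter> B = {}"
        "\<And>y. y \<in> D - Z \<Longrightarrow> adjacent E (?C y) A \<Longrightarrow> \<not> adjacent E (?C y) B" for A B
        unfolding ab_def using that(1,2,3) that(4) by fast
      have PQ: "ab P \<inter> ab Q = {}" by (rule AB) (use disj(3) dsj False in \<open>simp_all add: Int_Un_distrib\<close>)
      have PR: "ab P \<inter> ab R = {}" by (rule AB) (use disj(3) dsj False in \<open>simp_all add: Int_Un_distrib\<close>)
      show QR: "ab Q \<inter> ab R = {}" by (rule AB) (use disj(4) dsj False in \<open>simp_all add: Int_Un_distrib\<close>)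
      show "ab P \<inter> (ab Q \<union> ab R) = {}" using PQ PR by (simp add: Int_Un_distrib)
      show "adjacent E T (ab P)" "adjacent E T (ab Q)" "adjacent E T (ab R)"
        using adjacent_mono[OF TP(1) subset_refl abD(2)] adjacent_mono[OF TP(2) subset_refl abD(2)]
          adjacent_mono[OF TP(3) subset_refl abD(2)] by simp_all
    qed (simp_all only: I(1) connected_image[OF I(1)] conn(4) P'(1) Q'(1) R'(1)
        aI[OF P'(2,3)] aI[OF Q'(2,3)] aI[OF R'(2,3)])
  qed
qed

end

section \<open>Automorphisms fixing a claw\<close>

definition neighborhood :: "'a set set \<Rightarrow> 'a set \<Rightarrow> 'a set" where
  "neighborhood E C = {x. x \<notin> C \<and> adjacent E C {x}}"

lemma neighborhood_singleton: "neighborhood E {v} = {x. x \<noteq> v \<and> {v, x} \<in> E}"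
  by (auto simp: neighborhood_def adjacent_def)

text \<open>A connected set can pass out of \<open>C\<close> only through the neighborhood of
  \<open>C\<close>.\<close>

lemma disjoint_if_neighborhood_disjoint:
  assumes T: "connected_in E T" and N: "T \<inter> neighborhood E C = {}" and y: "y \<in> T" "y \<notin> C"
  shows "T \<inter> C = {}"
proof (rule ccontr)
  assume "T \<inter> C \<noteq> {}"
  then obtain u w where "u \<in> T \<inter> C" "w \<in> T - T \<inter> C" "{u, w} \<in> E"
    using connected_in_cut[OF T, of "T \<inter> C"] y by (metis Int_iff Int_lower1)
  then have "w \<in> T \<inter> neighborhood E C" by (auto simp: neighborhood_def adjacent_def)
  then show False using N by blast
qed

lemma neighborhood_component:
  assumes "\<And>e. e \<in> E \<Longrightarrow> e \<subseteq> V" "x \<in> A"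
  shows "neighborhood E (component_in E A x) \<subseteq> V - A"
proof
  fix y assume "y \<in> neighborhood E (component_in E A x)"
  then obtain z where z: "y \<notin> component_in E A x" "z \<in> component_in E A x" "{z, y} \<in> E"
    by (auto simp: neighborhood_def adjacent_def)
  then show "y \<in> V - A" using component_in_closed[OF assms(2) z(2) _ z(3)] assms(1) by blast
qed

lemma vertex_connected_diff:
  assumes E: "\<And>e. e \<in> E \<Longrightarrow> e \<subseteq> V" and k: "vertex_connected k V E" and S: "S \<subseteq> V" "card S < k"
  shows "connected_in E (V - S)"
proof -
  have kV: "k < card V" using k by (simp add: vertex_connected_def)
  then have "V - S \<noteq> {}" using S by (metis Diff_eq_empty_iff less_asym' order.strict_trans subset_antisym)
  have gc: "graph_connected (V - S) {e \<in> E. e \<inter> S = {}}"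
    using k S by (simp add: vertex_connected_def)
  show ?thesis
    unfolding connected_in_def
  proof (intro conjI ballI)
    fix x y assume "x \<in> V - S" "y \<in> V - S"
    then have "(x, y) \<in> {(x, y). {x, y} \<in> {e \<in> E. e \<inter> S = {}}}\<^sup>*"
      using gc by (simp add: graph_connected_def)
    moreover have "{(x, y). {x, y} \<in> {e \<in> E. e \<inter> S = {}}} \<subseteq> edge_rel E (V - S)"
      using E by (fastforce simp: edge_rel_def)
    ultimately show "(x, y) \<in> (edge_rel E (V - S))\<^sup>*" by (meson rtrancl_mono subsetD)
  qed fact
qed

text \<open>The neighborhood separates \<open>C\<close> from what remains of
  \<open>V\<close>.\<close>

lemma card_neighborhood:
  assumes E: "\<And>e. e \<in> E \<Longrightarrow> e \<subseteq> V" and k: "vertex_connected k V E"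
    and C: "C \<subseteq> V" "C \<noteq> {}" "V - C - neighborhood E C \<noteq> {}"
  shows "k \<le> card (neighborhood E C)"
proof (rule ccontr)
  assume "\<not> k \<le> card (neighborhood E C)"
  moreover have NV: "neighborhood E C \<subseteq> V"
    using E by (fastforce simp: neighborhood_def adjacent_def)
  ultimately have con: "connected_in E (V - neighborhood E C)"
    using vertex_connected_diff[OF E k] by simp
  obtain y where y: "y \<in> V - C - neighborhood E C" using C(3) by blast
  have "(V - neighborhood E C) \<inter> C = {}"
    by (rule disjoint_if_neighborhood_disjoint[OF con, of _ y]) (use y in auto)
  moreover have "C \<inter> neighborhood E C = {}" by (auto simp: neighborhood_def)
  ultimately show False using C by blast
qed

lemma obtain_three_elements:
  assumes "3 \<le> card A"
  obtains p q r where "p \<in> A" "q \<in> A" "r \<in> A" "p \<noteq> q" "p \<noteq> r" "q \<noteq> r"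
proof -
  obtain B where B: "B \<subseteq> A" "card B = 3" using obtain_subset_with_card_n[OF assms] by metis
  from B(2) obtain p q r where "B = {p, q, r}" "p \<noteq> q" "q \<noteq> r" "p \<noteq> r" by (auto simp: card_3_iff)
  then show thesis using that[of p q r] B(1) by simp
qed

context edge_permutation begin

lemma neighborhood_image: "neighborhood E (\<sigma> ` C) = \<sigma> ` neighborhood E C"
proof -
  have *: "\<sigma> x \<in> neighborhood E (\<sigma> ` C) \<longleftrightarrow> x \<in> neighborhood E C" for x
    using adjacent_image[of C "{x}"] inj by (simp add: neighborhood_def inj_image_mem_iff)
  show ?thesis
  proof (rule Set.set_eqI)
    fix y
    obtain x where "y = \<sigma> x" using bij_is_surj[OF bij] by (rule surjE)
    then show "y \<in> neighborhood E (\<sigma> ` C) \<longleftrightarrow> y \<in> \<sigma> ` neighborhood E C"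
      using * inj by (simp add: inj_image_mem_iff)
  qed
qed

text \<open>A component \<open>D\<close> of the moved vertices attaches to fixed vertices only, so
  it shares its attachments with its image. A connected set \<open>T\<close> off both of them
  reaches three of these attachments. If \<open>D\<close> is moved off itself, \<open>D\<close>, its
  image and \<open>T\<close> against the attachments form a \<open>K\<^sub>3\<^sub>,\<^sub>3\<close>
  minor; if it is invariant, \<open>invariant_region_k33_minor\<close> supplies one.\<close>

lemma fixing_claw_eq_identity:
  assumes V: "finite V" "\<And>e. e \<in> E \<Longrightarrow> e \<subseteq> V" "\<sigma> ` V = V"
    and conn: "vertex_connected 3 V E" and nominor: "\<not> k33_minor E"
    and claw: "{v, a} \<in> E" "{v, b} \<in> E" "{v, c} \<in> E" "v \<notin> {a, b, c}" "a \<noteq> b" "a \<noteq> c" "b \<noteq> c"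
    and fixed: "\<sigma> v = v" "\<sigma> a = a" "\<sigma> b = b" "\<sigma> c = c"
    and "x \<in> V"
  shows "\<sigma> x = x"
proof (rule ccontr)
  assume nx: "\<sigma> x \<noteq> x"
  define F where "F = {y \<in> V. \<sigma> y = y}"
  define D where "D = component_in E (V - F) x"
  define N where "N = neighborhood E D"
  have xVF: "x \<in> V - F" using nx \<open>x \<in> V\<close> by (simp add: F_def)
  have "\<sigma> ` F = F" by (force simp: F_def)
  then have sVF: "\<sigma> ` (V - F) = V - F" using V(3) inj by (simp add: image_set_diff)
  have sxVF: "\<sigma> x \<in> V - F" using xVF sVF by blast
  have sD: "\<sigma> ` D = component_in E (V - F) (\<sigma> x)" using component_image[OF sVF xVF] by (simp add: D_def)
  have DVF: "D \<subseteq> V - F" "\<sigma> ` D \<subseteq> V - F"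
    using component_in_subset[OF xVF] component_in_subset[OF sxVF] sD by (simp_all add: D_def)
  have cD: "connected_in E D" using connected_component_in[OF xVF] by (simp add: D_def)
  have NF: "N \<subseteq> F" using neighborhood_component[OF V(2) xVF] by (auto simp: N_def D_def)
  have sN: "neighborhood E (\<sigma> ` D) = N" using NF by (force simp: neighborhood_image N_def F_def)
  have adjN: "adjacent E D {p} \<and> adjacent E (\<sigma> ` D) {p} \<and> \<sigma> p = p" if "p \<in> N" for p
    using that sN NF by (auto simp: N_def neighborhood_def F_def)
  have "v \<in> V" "a \<in> V" "b \<in> V" "c \<in> V" using V(2) claw by auto
  then have clawF: "v \<in> F" "a \<in> F" "b \<in> F" "c \<in> F" using fixed by (simp_all add: F_def)
  \<comment> \<open>If every fixed vertex is an attachment of \<open>D\<close>, then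
    \<open>v\<close> with its neighbors \<open>a\<close>, \<open>b\<close>, \<open>c\<close>
    provides \<open>T\<close>. Otherwise \<open>T\<close> grows from a fixed vertex outside
    \<open>N\<close>, and 3-connectedness gives it three neighbors in \<open>N\<close>.\<close>
  obtain T p q r where T: "connected_in E T" "T \<inter> D = {}" "T \<inter> \<sigma> ` D = {}" "T \<inter> {p, q, r} = {}"
    and pqr: "p \<in> N" "q \<in> N" "r \<in> N" "p \<noteq> q" "p \<noteq> r" "q \<noteq> r"
    and adjT: "adjacent E T {p}" "adjacent E T {q}" "adjacent E T {r}"
  proof (cases "F = N")
    case True
    show thesis
    proof (rule that[of "{v}" a b c])
      show "{v} \<inter> D = {}" "{v} \<inter> \<sigma> ` D = {}" using DVF clawF by blast+
    qed (use True clawF claw in \<open>auto simp: connected_in_singleton adjacent_def\<close>)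
  next
    case False
    then obtain y where y: "y \<in> F" "y \<notin> N" using NF by blast
    then have yVN: "y \<in> V - N" by (simp add: F_def)
    define T where "T = component_in E (V - N) y"
    have cT: "connected_in E T" using connected_component_in[OF yVN] by (simp add: T_def)
    have TVN: "T \<subseteq> V - N" using component_in_subset[OF yVN] by (simp add: T_def)
    have yT: "y \<in> T" by (simp add: T_def component_in_self)
    have TD: "T \<inter> D = {}"
      by (rule disjoint_if_neighborhood_disjoint[OF cT _ yT]) (use TVN N_def y DVF in blast)+
    have TsD: "T \<inter> \<sigma> ` D = {}"
      by (rule disjoint_if_neighborhood_disjoint[OF cT _ yT]) (use TVN sN y DVF in blast)+
    have NT: "neighborhood E T \<subseteq> N"
      using neighborhood_component[OF V(2) yVN] by (auto simp: T_def)
    have "x \<in> V - T - neighborhood E T"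
      using xVF TD NT NF component_in_self[of x E "V - F"] by (auto simp: D_def)
    then have "3 \<le> card (neighborhood E T)"
      using card_neighborhood[OF V(2) conn, of T] TVN yT by blast
    then obtain p q r where pqr: "p \<in> neighborhood E T" "q \<in> neighborhood E T" "r \<in> neighborhood E T"
      "p \<noteq> q" "p \<noteq> r" "q \<noteq> r" using obtain_three_elements by metis
    show thesis
    proof (rule that[OF cT TD TsD])
      show "T \<inter> {p, q, r} = {}" "adjacent E T {p}" "adjacent E T {q}" "adjacent E T {r}"
        using pqr(1-3) by (auto simp: neighborhood_def)
    qed (use pqr NT in auto)
  qed
  have DN: "p \<notin> D" "q \<notin> D" "r \<notin> D" "p \<notin> \<sigma> ` D" "q \<notin> \<sigma> ` D" "r \<notin> \<sigma> ` D"
    using pqr(1-3) NF DVF by blast+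
  have "k33_minor E"
  proof (cases "\<sigma> ` D = D")
    case True
    show ?thesis
    proof (rule invariant_region_k33_minor[of D "{p}" "{q}" "{r}" T])
      show "finite D" using DVF(1) V(1) by (meson finite_Diff finite_subset)
      show "\<sigma> y \<noteq> y" if "y \<in> D" for y using that DVF(1) by (auto simp: F_def)
      show "D \<inter> ({p} \<union> {q} \<union> {r} \<union> T) = {}" using DN T(2) by blast
      show "T \<inter> ({p} \<union> {q} \<union> {r}) = {}" using T(4) by blast
    qed (use True cD T(1) connected_in_singleton adjN pqr adjT in auto)
  next
    case False
    then have DD: "D \<inter> \<sigma> ` D = {}"
      using component_in_disjoint[of E "V - F" x "\<sigma> x"] sD D_def by metis
    show ?thesis
    proof (rule k33_minorI[of E D "\<sigma> ` D" T "{p}" "{q}" "{r}"])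
      show "D \<inter> (\<sigma> ` D \<union> T \<union> {p} \<union> {q} \<union> {r}) = {}" using DD T(2) DN by blast
      show "\<sigma> ` D \<inter> (T \<union> {p} \<union> {q} \<union> {r}) = {}" using T(3) DN by blast
      show "T \<inter> ({p} \<union> {q} \<union> {r}) = {}" using T(4) by blast
    qed (use cD connected_image T(1) connected_in_singleton adjN pqr adjT in auto)
  qed
  then show False using nominor by blast
qed

end

section \<open>Longest cycles\<close>

lemma three_le_degree:
  assumes E: "\<And>e. e \<in> E \<Longrightarrow> e \<subseteq> V" and conn: "vertex_connected 3 V E" and v: "v \<in> V" "finite V"
  shows "3 \<le> card (neighborhood E {v})"
proof (cases "V - {v} - neighborhood E {v} = {}")
  case True
  have NV: "neighborhood E {v} \<subseteq> V" using E by (fastforce simp: neighborhood_def adjacent_def)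
  have "card (V - {v}) \<le> card (neighborhood E {v})"
    using True finite_subset[OF NV v(2)] by (intro card_mono) auto
  moreover have "3 < card V" using conn by (simp add: vertex_connected_def)
  ultimately show ?thesis using v by simp
next
  case False
  show ?thesis by (rule card_neighborhood[OF E conn]) (use v False in auto)
qed

definition graph_cycle :: "'a set set \<Rightarrow> 'a list \<Rightarrow> bool" where
  "graph_cycle E xs \<longleftrightarrow> graph_path E xs \<and> 3 \<le> length xs \<and> {last xs, hd xs} \<in> E"

text \<open>Lets any vertex of a cycle be moved to the head of its list.\<close>

lemma graph_cycle_swap: "graph_cycle E (xs @ ys) \<Longrightarrow> graph_cycle E (ys @ xs)"
  by (cases "xs = []"; cases "ys = []") (auto simp: graph_cycle_def graph_path_append)

lemma graph_cycle_edges: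
  assumes "graph_cycle E xs"
  shows "Suc i < length xs \<Longrightarrow> {xs ! i, xs ! Suc i} \<in> E" "{xs ! (length xs - 1), xs ! 0} \<in> E"
proof -
  have "xs \<noteq> []" using assms by (auto simp: graph_cycle_def graph_path_def)
  then show "{xs ! (length xs - 1), xs ! 0} \<in> E"
    using assms by (simp add: graph_cycle_def hd_conv_nth last_conv_nth)
  show "Suc i < length xs \<Longrightarrow> {xs ! i, xs ! Suc i} \<in> E"
    using assms by (simp add: graph_cycle_def graph_path_def successively_conv_nth)
qed

definition longest_cycle :: "'a set set \<Rightarrow> 'a list \<Rightarrow> bool" where
  "longest_cycle E xs \<longleftrightarrow> graph_cycle E xs \<and> (\<forall>ys. graph_cycle E ys \<longrightarrow> length ys \<le> length xs)"

lemma longest_cycle_swap: "longest_cycle E (xs @ ys) \<Longrightarrow> longest_cycle E (ys @ xs)"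
  using graph_cycle_swap by (auto simp: longest_cycle_def add.commute)

text \<open>Two neighbors of a vertex \<open>v\<close> are joined by a path avoiding
  \<open>v\<close>, which closes to a cycle; no cycle is longer than \<open>card V\<close>.\<close>

lemma exists_longest_cycle:
  assumes E: "\<And>e. e \<in> E \<Longrightarrow> e \<subseteq> V" and conn: "vertex_connected 3 V E" and "finite V"
  shows "\<exists>xs. longest_cycle E xs"
proof -
  have kV: "3 < card V" using conn by (simp add: vertex_connected_def)
  then obtain v where v: "v \<in> V" by fastforce
  obtain a b where ab: "a \<in> neighborhood E {v}" "b \<in> neighborhood E {v}" "a \<noteq> b"
    using obtain_three_elements[OF three_le_degree[OF E conn v \<open>finite V\<close>]] by metis
  then have va: "{v, a} \<in> E" "{v, b} \<in> E" "a \<noteq> v" "b \<noteq> v" by (auto simp: neighborhood_def adjacent_def)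
  have con: "connected_in E (V - {v})" by (rule vertex_connected_diff[OF E conn]) (use v in auto)
  have "a \<in> V - {v}" "b \<in> V - {v}" using va E by auto
  from connected_in_obtain_path[OF con this] obtain ps where ps: "graph_path E ps" "hd ps = a" "last ps = b"
    "set ps \<subseteq> V - {v}" .
  have "ps \<noteq> []" using ps(1) by (simp add: graph_path_def)
  moreover from this have "length ps \<noteq> 1" using ps(2,3) ab(3) by (metis One_nat_def length_0_conv length_Suc_conv list.sel(1) last_ConsL)
  ultimately have "2 \<le> length ps" by (cases ps) (auto simp: Suc_le_eq)
  then have cyc: "graph_cycle E (v # ps)" using ps va \<open>ps \<noteq> []\<close>
    by (auto simp: graph_cycle_def graph_path_Cons insert_commute)
  have "length ys \<le> card V" if "graph_cycle E ys" for ys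
  proof -
    have "set ys \<subseteq> V" using that graph_path_vertices_subset[OF E] by (auto simp: graph_cycle_def)
    moreover have "card (set ys) = length ys" using that by (simp add: graph_cycle_def graph_path_def distinct_card)
    ultimately show ?thesis using card_mono[OF \<open>finite V\<close>] by metis
  qed
  then have "\<exists>xs. graph_cycle E xs \<and> (\<forall>ys. graph_cycle E ys \<longrightarrow> length ys \<le> length xs)"
    using ex_has_greatest_nat[of "graph_cycle E" "v # ps" length "Suc (card V)"] cyc by (simp add: less_Suc_eq_le)
  then show ?thesis by (simp add: longest_cycle_def)
qed

text \<open>Replacing the edge from \<open>a\<close> to \<open>b\<close> by a detour through
  \<open>D\<close> would lengthen the cycle.\<close>

lemma longest_cycle_no_consecutive_attachments:
  assumes L: "longest_cycle E (a # b # zs)" and D: "connected_in E D" "D \<inter> set (a # b # zs) = {}"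
    and ab: "a \<in> neighborhood E D" "b \<in> neighborhood E D"
  shows False
proof -
  obtain u w where uw: "u \<in> D" "{u, a} \<in> E" "w \<in> D" "{w, b} \<in> E"
    using ab by (auto simp: neighborhood_def adjacent_def)
  obtain ps where ps: "graph_path E ps" "hd ps = u" "last ps = w" "set ps \<subseteq> D"
    using connected_in_obtain_path[OF D(1) uw(1,3)] .
  have ne: "ps \<noteq> []" using ps(1) by (simp add: graph_path_def)
  have p: "graph_path E (a # b # zs)" "{last (b # zs), a} \<in> E"
    using L by (auto simp: longest_cycle_def graph_cycle_def)
  have bz: "graph_path E (b # zs)" "a \<notin> set (b # zs)" using p by (simp_all add: graph_path_Cons)
  have "set ps \<inter> set (b # zs) = {}" "a \<notin> set ps" using ps(4) D(2) by auto
  then have psb: "graph_path E (ps @ b # zs)"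
    using ps ne bz uw by (simp add: graph_path_append)
  have "graph_path E (a # ps @ b # zs)"
    using psb bz \<open>a \<notin> set ps\<close> ps(2) uw(2) ne by (subst graph_path_Cons) (auto simp: insert_commute hd_append)
  then have "graph_cycle E (a # ps @ b # zs)" using p(2) ne by (auto simp: graph_cycle_def Suc_le_eq)
  then have "length (a # ps @ b # zs) \<le> length (a # b # zs)" using L unfolding longest_cycle_def by metis
  then show False using ne by simp
qed

text \<open>A component off the cycle attaches to at least three cycle vertices, no two of them
  consecutive, which forces length at least six. The edge leaving the cycle comes from one of these
  attachments.\<close>

lemma nonspanning_longest_cycle:
  assumes E: "\<And>e. e \<in> E \<Longrightarrow> e \<subseteq> V" and conn: "vertex_connected 3 V E" and "finite V"
    and xs: "longest_cycle E xs" "set xs \<noteq> V"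
  obtains ys w where "graph_cycle E ys" "length ys = length xs" "6 \<le> length ys" "{hd ys, w} \<in> E" "w \<notin> set ys"
proof -
  have path: "graph_path E xs" "3 \<le> length xs" using xs(1) by (auto simp: longest_cycle_def graph_cycle_def)
  have xsV: "set xs \<subseteq> V" by (rule graph_path_vertices_subset[OF E path(1)]) (use path(2) in auto)
  then obtain y where y: "y \<in> V - set xs" using xs(2) by blast
  define D where "D = component_in E (V - set xs) y"
  define N where "N = neighborhood E D"
  have cD: "connected_in E D" using connected_component_in[OF y] by (simp add: D_def)
  have DV: "D \<subseteq> V - set xs" using component_in_subset[OF y] by (simp add: D_def)
  have NX: "N \<subseteq> set xs" using neighborhood_component[OF E y] by (auto simp: N_def D_def)
  have no: False if "longest_cycle E (a # b # zs)" "set (a # b # zs) = set xs" "a \<in> N" "b \<in> N" for a b zs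
    using longest_cycle_no_consecutive_attachments[OF that(1) cD] DV that N_def by blast
  have "3 \<le> card N"
  \<comment> \<open>If \<open>D\<close> and \<open>N\<close> exhaust \<open>V\<close>, every vertex
    of the cycle is an attachment, in particular two consecutive ones.\<close>
  proof (cases "V - D - N = {}")
    case True
    then have all: "set xs \<subseteq> N" using DV xsV by blast
    obtain a b zs where "xs = a # b # zs" using path(2) by (metis Suc_le_length_iff numeral_3_eq_3)
    then show ?thesis using no[of a b zs] xs(1) all by auto
  next
    case False
    show ?thesis using card_neighborhood[OF E conn, of D] False DV cD by (auto simp: N_def connected_in_def)
  qed
  then obtain p q r where pqr: "p \<in> N" "q \<in> N" "r \<in> N" "p \<noteq> q" "p \<noteq> r" "q \<noteq> r"
    using obtain_three_elements by metis
  then obtain us vs where "xs = us @ p # vs" using NX by (meson split_list subsetD)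
  \<comment> \<open>The cycle is rotated to start at the attachment \<open>p\<close>.\<close>
  define ys where "ys = p # vs @ us"
  have L: "longest_cycle E ys" and setys: "set ys = set xs" and len: "length ys = length xs"
    using longest_cycle_swap[of E us "p # vs"] xs(1) \<open>xs = us @ p # vs\<close> by (auto simp: ys_def)
  have cons: "\<not> (ys ! i \<in> N \<and> ys ! Suc i \<in> N)" if i: "Suc i < length ys" for i
  proof
    assume "ys ! i \<in> N \<and> ys ! Suc i \<in> N"
    moreover have "ys = take i ys @ ys ! i # ys ! Suc i # drop (Suc (Suc i)) ys"
      using i by (simp add: Cons_nth_drop_Suc)
    moreover from this have "longest_cycle E ((ys ! i # ys ! Suc i # drop (Suc (Suc i)) ys) @ take i ys)"
      "set ((ys ! i # ys ! Suc i # drop (Suc (Suc i)) ys) @ take i ys) = set ys"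
      using L longest_cycle_swap by (metis, metis set_append sup_commute)
    ultimately show False using no[of "ys ! i" "ys ! Suc i" "drop (Suc (Suc i)) ys @ take i ys"] setys by simp
  qed
  have yne: "ys \<noteq> []" "3 \<le> length ys" using path(2) len by (auto simp: ys_def)
  \<comment> \<open>The pair of last and first vertex is consecutive too.\<close>
  have lst: "last ys \<notin> N"
  proof
    assume "last ys \<in> N"
    obtain m where m: "vs @ us = m @ [last ys]" using yne by (cases "vs @ us" rule: rev_cases) (auto simp: ys_def)
    then have ysm: "ys = (p # m) @ [last ys]" by (simp add: ys_def)
    then have "longest_cycle E (last ys # p # m)" using L longest_cycle_swap[of E "p # m" "[last ys]"] by simp
    moreover have "set (last ys # p # m) = set xs" using arg_cong[OF ysm, of set] setys by auto
    ultimately show False using no pqr(1) \<open>last ys \<in> N\<close> by blast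
  qed
  have hd: "ys ! 0 = p" by (simp add: ys_def)
  obtain i where i: "i < length ys" "ys ! i = q" using pqr NX setys by (metis in_set_conv_nth subsetD)
  obtain j where j: "j < length ys" "ys ! j = r" using pqr NX setys by (metis in_set_conv_nth subsetD)
  have "6 \<le> length ys"
  proof -
    have lastn: "ys ! (length ys - 1) \<notin> N" using lst yne by (simp add: last_conv_nth)
    \<comment> \<open>With \<open>p\<close> at index 0, the other two attachments lie between index
      2 and \<open>length ys - 2\<close> and are at least two apart, hence length at least
      six.\<close>
    have *: "2 \<le> k \<and> k + 2 \<le> length ys" if "k < length ys" "ys ! k \<in> N" "ys ! k \<noteq> p" for k
    proof -
      have "k \<noteq> 0" using that(3) hd by metis
      moreover have "k \<noteq> 1" using cons[of 0] hd pqr(1) that yne by auto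
      moreover have "k \<noteq> length ys - 1" using that(2) lastn by metis
      ultimately show ?thesis using that(1) by linarith
    qed
    have "i \<noteq> j" using i j pqr by auto
    moreover have "Suc i \<noteq> j" using cons[of i] i j pqr by auto
    moreover have "Suc j \<noteq> i" using cons[of j] i j pqr by auto
    moreover have "2 \<le> i \<and> i + 2 \<le> length ys" by (rule *) (use i pqr in auto)
    moreover have "2 \<le> j \<and> j + 2 \<le> length ys" by (rule *) (use j pqr in auto)
    ultimately show ?thesis by linarith
  qed
  moreover obtain w where "{p, w} \<in> E" "w \<in> D"
    using pqr(1) by (auto simp: N_def neighborhood_def adjacent_def insert_commute)
  moreover have "w \<notin> set ys" using \<open>w \<in> D\<close> DV setys by blast
  ultimately show thesis using that[of ys w] L len by (simp add: longest_cycle_def ys_def)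
qed

text \<open>Apart from a single vertex, this is the smallest asymmetric tree, which explains the
  bound of seven vertices.\<close>

definition spider :: "'a set set \<Rightarrow> 'a \<Rightarrow> 'a \<Rightarrow> 'a \<Rightarrow> 'a \<Rightarrow> 'a \<Rightarrow> 'a \<Rightarrow> 'a \<Rightarrow> bool" where
  "spider E v a b b' c c' c'' \<longleftrightarrow> distinct [v, a, b, b', c, c', c''] \<and>
     {{v, a}, {v, b}, {b, b'}, {v, c}, {c, c'}, {c', c''}} \<subseteq> E"

text \<open>The legs start with the two cycle edges at a vertex and a third edge there. If the cycle
  is not spanning, the third edge leaves it and is the short leg, so six cycle vertices suffice; if
  it is spanning, the third edge is a chord, whose far end decides which leg it begins.\<close>

lemma exists_spider:
  assumes E: "\<And>e. e \<in> E \<Longrightarrow> e \<subseteq> V" and conn: "vertex_connected 3 V E" and fin: "finite V" and V: "7 \<le> card V"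
  shows "\<exists>v a b b' c c' c''. spider E v a b b' c c' c''"
proof -
  obtain xs where xs: "longest_cycle E xs" using exists_longest_cycle[OF E conn fin] by blast
  show ?thesis
  proof (cases "set xs = V")
    case False
    obtain ys w where ys: "graph_cycle E ys" "6 \<le> length ys" "{hd ys, w} \<in> E" "w \<notin> set ys"
      using nonspanning_longest_cycle[OF E conn fin xs False] by metis
    have d: "distinct ys" using ys(1) by (simp add: graph_cycle_def graph_path_def)
    let ?n = "length ys"
    note e = graph_cycle_edges[OF ys(1)]
    have hd: "hd ys = ys ! 0" using ys(2) by (metis hd_conv_nth list.size(3) not_numeral_le_zero)
    have "{{ys ! 0, w}, {ys ! 0, ys ! 1}, {ys ! 1, ys ! 2}, {ys ! 0, ys ! (?n - 1)},
        {ys ! (?n - 1), ys ! (?n - 2)}, {ys ! (?n - 2), ys ! (?n - 3)}} \<subseteq> E"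
      using ys(2,3) e(1)[of 0] e(1)[of 1] e(2) e(1)[of "?n - 2"] e(1)[of "?n - 3"]
      by (auto simp: hd insert_commute numeral_2_eq_2 Suc_diff_Suc numeral_3_eq_3)
    moreover have "distinct [ys ! 0, w, ys ! 1, ys ! 2, ys ! (?n - 1), ys ! (?n - 2), ys ! (?n - 3)]"
    proof -
      have w: "w \<noteq> ys ! i" "ys ! i \<noteq> w" if "i < ?n" for i using ys(4) that by auto
      have "0 < ?n" "Suc 0 < ?n" "2 < ?n" "ys \<noteq> []" using ys(2) by fastforce+
      then show ?thesis using ys(2) by (auto simp: nth_eq_iff_index_eq[OF d] w)
    qed
    ultimately show ?thesis unfolding spider_def by metis
  next
    case True
    have cyc: "graph_cycle E xs" using xs by (simp add: longest_cycle_def)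
    let ?n = "length xs"
    have d: "distinct xs" using cyc by (simp add: graph_cycle_def graph_path_def)
    then have n: "7 \<le> ?n" using V True distinct_card[OF d] by simp
    then have n0: "xs \<noteq> []" "0 < ?n" "Suc 0 < ?n" "2 < ?n" "3 < ?n" by fastforce+
    note e = graph_cycle_edges[OF cyc]
    have x0: "xs ! 0 \<in> V" using True n by (metis nth_mem not_numeral_le_zero gr0I)
    have "\<not> neighborhood E {xs ! 0} \<subseteq> {xs ! 1, xs ! (?n - 1)}"
    proof
      assume "neighborhood E {xs ! 0} \<subseteq> {xs ! 1, xs ! (?n - 1)}"
      then have "card (neighborhood E {xs ! 0}) \<le> card {xs ! 1, xs ! (?n - 1)}" by (intro card_mono) auto
      also have "\<dots> \<le> 2" by (simp add: card_insert_if)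
      finally show False using three_le_degree[OF E conn x0 fin] by simp
    qed
    then obtain z where z: "z \<in> neighborhood E {xs ! 0}" "z \<noteq> xs ! 1" "z \<noteq> xs ! (?n - 1)" by blast
    then have z0: "{xs ! 0, z} \<in> E" "z \<noteq> xs ! 0" by (auto simp: neighborhood_def adjacent_def)
    then have "z \<in> set xs" using True E by blast
    then obtain j where j: "j < ?n" "z = xs ! j" by (metis in_set_conv_nth)
    have "j \<noteq> 0" "j \<noteq> 1" "j \<noteq> ?n - 1" using z(2,3) z0(2) j(2) by metis+
    then have j2: "2 \<le> j" "j + 2 \<le> ?n" using j by linarith+
    have eL: "{xs ! 0, xs ! 1} \<in> E" "{xs ! 1, xs ! 2} \<in> E" "{xs ! 2, xs ! 3} \<in> E"
      using e(1)[of 0] e(1)[of 1] e(1)[of 2] n by (simp_all add: numeral_2_eq_2 numeral_3_eq_3)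
    have "Suc (?n - 2) = ?n - 1" "Suc (?n - 3) = ?n - 2" using n by simp_all
    then have eR: "{xs ! 0, xs ! (?n - 1)} \<in> E" "{xs ! (?n - 1), xs ! (?n - 2)} \<in> E" "{xs ! (?n - 2), xs ! (?n - 3)} \<in> E"
      using e(2) e(1)[of "?n - 2"] e(1)[of "?n - 3"] n by (simp_all add: insert_commute)
    have eJ: "{xs ! 0, xs ! j} \<in> E" using z0 j by simp
    \<comment> \<open>A chord to a vertex two steps away begins the leg of length 2, leaving the
      cycle vertex it skips as the short leg. Any longer chord is itself the short leg.\<close>
    consider (a) "j = 2" | (b) "j + 2 = ?n" | (c) "3 \<le> j" "j + 3 \<le> ?n" using j2 by linarith
    then show ?thesis
    proof cases
      case a
      have "spider E (xs ! 0) (xs ! 1) (xs ! 2) (xs ! 3) (xs ! (?n - 1)) (xs ! (?n - 2)) (xs ! (?n - 3))"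
        unfolding spider_def using n n0 d eL eR eJ a by (auto simp: nth_eq_iff_index_eq)
      then show ?thesis by blast
    next
      case b
      then have "?n - 2 = j" by simp
      have "spider E (xs ! 0) (xs ! (?n - 1)) (xs ! (?n - 2)) (xs ! (?n - 3)) (xs ! 1) (xs ! 2) (xs ! 3)"
        unfolding spider_def using n n0 d eL eR eJ \<open>?n - 2 = j\<close> by (auto simp: nth_eq_iff_index_eq)
      then show ?thesis by blast
    next
      case c
      show ?thesis
      \<comment> \<open>The leg of length 3 runs forward unless it would hit the far end of the
        chord; then the two directions are exchanged.\<close>
      proof (cases "j = 3")
        case True
        have "spider E (xs ! 0) (xs ! j) (xs ! 1) (xs ! 2) (xs ! (?n - 1)) (xs ! (?n - 2)) (xs ! (?n - 3))"
          unfolding spider_def using n n0 d eL eR eJ c True by (auto simp: nth_eq_iff_index_eq)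
        then show ?thesis by blast
      next
        case False
        have "spider E (xs ! 0) (xs ! j) (xs ! (?n - 1)) (xs ! (?n - 2)) (xs ! 1) (xs ! 2) (xs ! 3)"
          unfolding spider_def using n n0 d eL eR eJ c False by (auto simp: nth_eq_iff_index_eq)
        then show ?thesis by blast
      qed
    qed
  qed
qed

section \<open>Obstructions to planarity\<close>

definition vertex_point :: "'a \<Rightarrow> 'a \<Rightarrow> real" where
  "vertex_point v = (\<lambda>w. if w = v then 1 else 0)"

definition edge_point :: "'a \<Rightarrow> 'a \<Rightarrow> real \<Rightarrow> 'a \<Rightarrow> real" where
  "edge_point u v t = (\<lambda>w. (1 - t) * vertex_point u w + t * vertex_point v w)"

lemma edge_point_0 [simp]: "edge_point u v 0 = vertex_point u"
  and edge_point_1 [simp]: "edge_point u v 1 = vertex_point v"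
  by (simp_all add: edge_point_def)

lemma geometric_cell_singleton: "geometric_cell {v} = {vertex_point v}"
  by (auto simp: geometric_cell_def vertex_point_def fun_eq_iff)

lemma geometric_cell_edge:
  assumes "u \<noteq> v"
  shows "geometric_cell {u, v} = edge_point u v ` {0..1}"
proof (intro subset_antisym subsetI)
  fix x assume x: "x \<in> geometric_cell {u, v}"
  then have "x u + x v = 1" "0 \<le> x u" "0 \<le> x v" "\<And>w. w \<notin> {u, v} \<Longrightarrow> x w = 0"
    using assms by (simp_all add: geometric_cell_def)
  then have "x = edge_point u v (x v)" "x v \<in> {0..1}"
    using assms by (auto simp: edge_point_def vertex_point_def fun_eq_iff)
  then show "x \<in> edge_point u v ` {0..1}" by blast
next
  fix x assume "x \<in> edge_point u v ` {0..1}"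
  then show "x \<in> geometric_cell {u, v}"
    using assms by (auto simp: geometric_cell_def edge_point_def vertex_point_def)
qed

lemma continuous_map_edge_point: "continuous_map (top_of_set {0..1}) (powertop_real UNIV) (edge_point u v)"
  unfolding continuous_map_componentwise_UNIV
  by (auto simp: edge_point_def intro!: continuous_intros)

lemma edge_point_inj: "u \<noteq> v \<Longrightarrow> edge_point u v s = edge_point u v t \<Longrightarrow> s = t"
  by (drule fun_cong[of _ _ v]) (simp add: edge_point_def vertex_point_def)

lemma geometric_cell_support: "x \<in> geometric_cell e \<Longrightarrow> x v \<noteq> 0 \<Longrightarrow> v \<in> e"
  by (auto simp: geometric_cell_def)

lemma topspace_realization:
  "topspace (realization V E) = (\<Union>v\<in>V. geometric_cell {v}) \<union> (\<Union>e\<in>E. geometric_cell e)"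
  by (simp add: realization_def)

lemma vertex_point_if_support:
  assumes "x \<in> geometric_cell {u, v}" "u \<noteq> v" "\<And>w. x w \<noteq> 0 \<Longrightarrow> w = z"
  shows "x = vertex_point z"
proof -
  obtain t where t: "x = edge_point u v t" using assms(1) geometric_cell_edge[OF assms(2)] by blast
  have "t = 1 \<or> u = z" "t = 0 \<or> v = z"
    using assms(3)[of u] assms(3)[of v] assms(2) t by (auto simp: edge_point_def vertex_point_def)
  then show ?thesis using t assms(2) by auto
qed

text \<open>A list with a single vertex gets no point at all, whence the bounds
  \<open>2 \<le> length xs\<close> below.\<close>

fun path_cells :: "'a list \<Rightarrow> ('a \<Rightarrow> real) set" where
  "path_cells (x # y # zs) = geometric_cell {x, y} \<union> path_cells (y # zs)"
| "path_cells _ = {}"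

lemma path_cells_nth:
  "p \<in> path_cells xs \<Longrightarrow> \<exists>i. Suc i < length xs \<and> p \<in> geometric_cell {xs ! i, xs ! Suc i}"
proof (induction xs rule: path_cells.induct)
  case (1 x y zs)
  show ?case
  proof (cases "p \<in> geometric_cell {x, y}")
    case True
    then show ?thesis by (intro exI[of _ 0]) auto
  next
    case False
    then obtain i where "Suc i < length (y # zs)" "p \<in> geometric_cell {(y # zs) ! i, (y # zs) ! Suc i}"
      using 1 by auto
    then show ?thesis by (intro exI[of _ "Suc i"]) auto
  qed
qed auto

lemma path_cells_support: "p \<in> path_cells xs \<Longrightarrow> p v \<noteq> 0 \<Longrightarrow> v \<in> set xs"
  using path_cells_nth[of p xs] geometric_cell_support[of p _ v] by fastforce

lemma vertex_point_in_path_cells: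
  "v \<in> set xs \<Longrightarrow> 2 \<le> length xs \<Longrightarrow> vertex_point v \<in> path_cells xs"
proof (induction xs rule: path_cells.induct)
  case (1 x y zs)
  have *: "vertex_point x \<in> geometric_cell {x, y}" "vertex_point y \<in> geometric_cell {x, y}"
    by (auto simp: geometric_cell_def vertex_point_def sum.If_cases)
  show ?case
  proof (cases zs)
    case Nil
    then show ?thesis using 1 * by auto
  qed (use 1 * in auto)
qed auto

section \<open>Arcs and open stars in a plane drawing\<close>

locale plane_drawing =
  fixes V :: "'a set" and E :: "'a set set" and f :: "('a \<Rightarrow> real) \<Rightarrow> complex"
  assumes edge: "\<And>e. e \<in> E \<Longrightarrow> e \<subseteq> V \<and> card e = 2"
    and emb: "graph_embedding euclidean V E f"
begin

abbreviation G where "G \<equiv> topspace (realization V E)"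

lemma continuous_f: "continuous_map (realization V E) euclidean f"
  using emb by (auto simp: graph_embedding_def embedding_map_def continuous_map_in_subtopology
      dest: homeomorphic_imp_continuous_map)

lemma inj_f: "inj_on f G"
  using emb by (auto simp: graph_embedding_def embedding_map_def dest: homeomorphic_imp_injective_map)

lemma edge_distinct: "{u, v} \<in> E \<Longrightarrow> u \<noteq> v"
  using edge by fastforce

lemma cell_subset: "{u, v} \<in> E \<Longrightarrow> geometric_cell {u, v} \<subseteq> G"
  by (auto simp: topspace_realization)

lemma continuous_edge:
  assumes uv: "{u, v} \<in> E"
  shows "continuous_on {0..1} (\<lambda>t. f (edge_point u v t))"
proof -
  have "edge_point u v ` {0..1} \<subseteq> (\<Union>v\<in>V. geometric_cell {v}) \<union> (\<Union>e\<in>E. geometric_cell e)"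
    using cell_subset[OF uv] geometric_cell_edge[OF edge_distinct[OF uv]] topspace_realization by metis
  then have "continuous_map (top_of_set {0..1}) (realization V E) (edge_point u v)"
    using continuous_map_edge_point[of u v] by (auto simp: realization_def continuous_map_in_subtopology image_subset_iff)
  then have "continuous_map (top_of_set {0..1}) euclidean (f \<circ> edge_point u v)"
    using continuous_f continuous_map_compose by blast
  then show ?thesis by (simp add: comp_def)
qed

lemma arc_edge:
  assumes uv: "{u, v} \<in> E"
  defines "g \<equiv> \<lambda>t. f (edge_point u v t)"
  shows "arc g" "pathstart g = f (vertex_point u)" "pathfinish g = f (vertex_point v)"
    "path_image g = f ` geometric_cell {u, v}"
proof -
  note cell = geometric_cell_edge[OF edge_distinct[OF uv]]
  have "inj_on g {0..1}"
  proof (rule inj_onI)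
    fix s t :: real assume "s \<in> {0..1}" "t \<in> {0..1}" "g s = g t"
    moreover from this have "edge_point u v s \<in> G" "edge_point u v t \<in> G"
      using cell_subset[OF uv] cell by auto
    ultimately have "edge_point u v s = edge_point u v t" using inj_f by (auto simp: g_def inj_on_def)
    then show "s = t" using edge_point_inj[OF edge_distinct[OF uv]] by blast
  qed
  then show "arc g" using continuous_edge[OF uv] by (simp add: arc_def path_def g_def)
  show "path_image g = f ` geometric_cell {u, v}" by (simp add: path_image_def cell image_image g_def)
qed (simp_all add: pathstart_def pathfinish_def g_def)

lemma path_cells_subset: "graph_path E xs \<Longrightarrow> path_cells xs \<subseteq> G"
  by (induction xs rule: path_cells.induct) (use cell_subset in \<open>auto simp: graph_path_Cons\<close>)

lemma obtain_arc:
  assumes "graph_path E xs" "2 \<le> length xs"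
  obtains g where "arc g" "pathstart g = f (vertex_point (hd xs))" "pathfinish g = f (vertex_point (last xs))"
    "path_image g = f ` path_cells xs"
proof -
  have "\<exists>g. arc g \<and> pathstart g = f (vertex_point (hd xs)) \<and> pathfinish g = f (vertex_point (last xs)) \<and>
     path_image g = f ` path_cells xs"
    using assms
  proof (induction xs rule: path_cells.induct)
    case (1 x y zs)
    have xy: "{x, y} \<in> E" "x \<notin> set (y # zs)" using 1 by (auto simp: graph_path_Cons)
    note g1 = arc_edge[OF xy(1)]
    show ?case
    proof (cases "zs = []")
      case True
      then show ?thesis using g1 by (intro exI[of _ "\<lambda>t. f (edge_point x y t)"]) simp
    next
      case False
      have gp: "graph_path E (y # zs)" using 1(2) by (simp add: graph_path_Cons)
      then obtain g2 where g2: "arc g2" "pathstart g2 = f (vertex_point y)"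
        "pathfinish g2 = f (vertex_point (last (y # zs)))" "path_image g2 = f ` path_cells (y # zs)"
        using 1(1) False by (cases zs) auto
      let ?g = "(\<lambda>t. f (edge_point x y t)) +++ g2"
      \<comment> \<open>By injectivity a common point comes from one point of the graph. Its support
        lies in the edge and in the rest of the path, so it is \<open>{y}\<close>.\<close>
      have "path_image (\<lambda>t. f (edge_point x y t)) \<inter> path_image g2 \<subseteq> {pathstart g2}"
      proof
        fix z assume "z \<in> path_image (\<lambda>t. f (edge_point x y t)) \<inter> path_image g2"
        then obtain p q where pq: "p \<in> geometric_cell {x, y}" "q \<in> path_cells (y # zs)" "z = f p" "z = f q"
          using g1(4) g2(4) by auto
        then have "p = q" using inj_f cell_subset[OF xy(1)] path_cells_subset[OF gp] by (auto simp: inj_on_def)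
        then have "w = y" if "p w \<noteq> 0" for w
          using that pq path_cells_support[of q "y # zs" w] geometric_cell_support[of p "{x, y}" w] xy(2) by auto
        then have "p = vertex_point y" using vertex_point_if_support[OF pq(1)] xy(2) by auto
        then show "z \<in> {pathstart g2}" using pq g2(2) by simp
      qed
      then have "arc ?g" using g1 g2 by (intro arc_join) auto
      moreover have "path_image ?g = f ` path_cells (x # y # zs)"
        using g1 g2 by (subst path_image_join) (auto simp: image_Un)
      ultimately show ?thesis using g1 g2 by (intro exI[of _ ?g]) simp
    qed
  qed auto
  then show thesis using that by blast
qed

text \<open>The open star of \<open>A\<close>: its vertices and the edges at them, without the ends
  outside \<open>A\<close>. It misses every path that avoids \<open>A\<close>, and yet the neighbors
  of \<open>A\<close> lie in its closure.\<close>

definition star :: "'a set \<Rightarrow> ('a \<Rightarrow> real) set" where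
  "star A = {p \<in> G. \<exists>v\<in>A. p v \<noteq> 0}"

lemma star_path_cells_disjoint: "A \<inter> set xs = {} \<Longrightarrow> star A \<inter> path_cells xs = {}"
  using path_cells_support by (fastforce simp: star_def)

lemma initial_segment_in_star:
  assumes "{v, u} \<in> E" "v \<in> A"
  shows "edge_point v u ` {0..<1} \<subseteq> star A"
proof
  note ne = edge_distinct[OF assms(1)]
  fix p assume "p \<in> edge_point v u ` {0..<1}"
  then obtain t where t: "0 \<le> t" "t < 1" "p = edge_point v u t" by auto
  have "p \<in> edge_point v u ` {0..1}" using t by force
  then have "p \<in> G" using cell_subset[OF assms(1)] geometric_cell_edge[OF ne] by blast
  moreover have "p v \<noteq> 0" using t ne by (simp add: edge_point_def vertex_point_def)
  ultimately show "p \<in> star A" using assms(2) by (auto simp: star_def)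
qed

lemma connected_star_segment:
  assumes "{v, u} \<in> E" "v \<in> A" "0 \<le> t" "t \<le> 1" "t < 1 \<or> u \<in> A"
  shows "connected_component (f ` star A) (f (vertex_point v)) (f (edge_point v u t))"
  unfolding connected_component_def
proof (intro exI[of _ "(\<lambda>s. f (edge_point v u s)) ` {0..t}"] conjI)
  show "connected ((\<lambda>s. f (edge_point v u s)) ` {0..t})"
    using continuous_on_subset[OF continuous_edge[OF assms(1)], of "{0..t}"] assms
    by (intro connected_continuous_image) auto
  have "edge_point v u s \<in> star A" if s: "0 \<le> s" "s \<le> t" for s
  proof (cases "s < 1")
    case True
    then show ?thesis using initial_segment_in_star[OF assms(1,2)] s by auto
  next
    case False
    then have "s = 1" "u \<in> A" using s assms by auto
    moreover have "edge_point v u 1 = edge_point u v 0" by simp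
    moreover have "edge_point u v 0 \<in> star A"
      using initial_segment_in_star[of u v A] assms(1) \<open>u \<in> A\<close> by (auto simp: insert_commute simp del: edge_point_0)
    ultimately show ?thesis by simp
  qed
  then show "(\<lambda>s. f (edge_point v u s)) ` {0..t} \<subseteq> f ` star A" by auto
  show "f (vertex_point v) \<in> (\<lambda>s. f (edge_point v u s)) ` {0..t}"
    using assms by (intro image_eqI[of _ _ 0]) auto
qed (use assms in auto)

text \<open>Each point slides along its edge to a vertex of \<open>A\<close>, and these vertices are
  joined by edges inside \<open>A\<close>. That each vertex of \<open>A\<close> lies on an edge
  places its point in the realization.\<close>

lemma connected_star:
  assumes A: "connected_in E A" "\<And>v. v \<in> A \<Longrightarrow> \<exists>u. {v, u} \<in> E"
  shows "connected (f ` star A)"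
proof -
  have vertices: "connected_component (f ` star A) (f (vertex_point v)) (f (vertex_point w))"
    if v: "v \<in> A" and w: "w \<in> A" for v w
  proof -
    have "(v, w) \<in> (edge_rel E A)\<^sup>*" using A v w by (auto simp: connected_in_def)
    then show ?thesis
    proof (induction rule: rtrancl_induct)
      case base
      obtain u where "{v, u} \<in> E" using A v by blast
      then show ?case using connected_star_segment[of v u A 0] v by simp
    next
      case (step y z)
      then have "{y, z} \<in> E" "y \<in> A" "z \<in> A" by (auto simp: edge_rel_def)
      then show ?case using connected_star_segment[of y z A 1] step.IH connected_component_trans by fastforce
    qed
  qed
  have to_vertex: "\<exists>v\<in>A. connected_component (f ` star A) (f (vertex_point v)) (f p)" if p: "p \<in> star A" for p
  proof -
    obtain v where v: "v \<in> A" "p v \<noteq> 0" "p \<in> G" using p by (auto simp: star_def)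
    from v(3) consider z where "z \<in> V" "p = vertex_point z" | e where "e \<in> E" "p \<in> geometric_cell e"
      by (auto simp: topspace_realization geometric_cell_singleton)
    then show ?thesis
    proof cases
      case 1
      then have "z = v" using v(2) by (auto simp: vertex_point_def split: if_splits)
      then show ?thesis using vertices[OF v(1) v(1)] v(1) 1(2) by metis
    next
      case 2
      then have "v \<in> e" using geometric_cell_support v(2) by metis
      moreover have "card e = 2" using edge 2 by blast
      ultimately obtain u where e: "e = {v, u}" "v \<noteq> u" by (metis card_2_iff doubleton_eq_iff insertE singletonD)
      then obtain t where t: "0 \<le> t" "t \<le> 1" "p = edge_point v u t" using 2 geometric_cell_edge[OF e(2)] by auto
      then have "t \<noteq> 1" using v(2) e(2) by (auto simp: vertex_point_def split: if_splits)
      then show ?thesis using connected_star_segment[of v u A t] 2 e v t by auto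
    qed
  qed
  show ?thesis
    unfolding connected_iff_connected_component
  proof (intro ballI)
    fix a b assume "a \<in> f ` star A" "b \<in> f ` star A"
    then obtain p q where pq: "p \<in> star A" "q \<in> star A" "a = f p" "b = f q" by blast
    obtain v where v: "v \<in> A" "connected_component (f ` star A) (f (vertex_point v)) a" using to_vertex pq by blast
    obtain w where w: "w \<in> A" "connected_component (f ` star A) (f (vertex_point w)) b" using to_vertex pq by blast
    show "connected_component (f ` star A) a b"
      using connected_component_sym[OF v(2)] vertices[OF v(1) w(1)] w(2) connected_component_trans by metis
  qed
qed

text \<open>The point of \<open>p\<close> is the limit of a half-open edge that starts in
  \<open>A\<close>.\<close>

lemma closure_star:
  assumes "adjacent E A {p}"
  shows "f (vertex_point p) \<in> closure (f ` star A)"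
proof -
  obtain v where v: "v \<in> A" "{v, p} \<in> E" using assms by (auto simp: adjacent_def)
  let ?g = "\<lambda>t. f (edge_point v p t)"
  have cl: "closure {0..<1} = {0..1::real}" by (rule closure_atLeastLessThan) simp
  have "?g ` closure {0..<1} \<subseteq> closure (?g ` {0..<1})"
    by (rule image_closure_subset[OF _ closed_closure closure_subset]) (use continuous_edge[OF v(2)] cl in simp)
  moreover have "f (vertex_point p) \<in> ?g ` closure {0..<1}"
    unfolding cl by (intro image_eqI[of _ _ 1]) auto
  moreover have "?g ` {0..<1} \<subseteq> f ` star A" using initial_segment_in_star[OF v(2,1)] by blast
  ultimately show ?thesis using closure_mono by blast
qed

text \<open>The support of a common point consists of ends of \<open>xs\<close>. As
  \<open>xs\<close> has at least three vertices, none of its edges contains both ends, so the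
  support is a single vertex.\<close>

lemma path_cells_Int:
  assumes "graph_path E xs" "3 \<le> length xs" "set xs \<inter> set ys = {hd xs, last xs}"
  shows "path_cells xs \<inter> path_cells ys \<subseteq> {vertex_point (hd xs), vertex_point (last xs)}"
proof
  fix p assume p: "p \<in> path_cells xs \<inter> path_cells ys"
  then have sup: "v = hd xs \<or> v = last xs" if "p v \<noteq> 0" for v
    using that path_cells_support[of p xs v] path_cells_support[of p ys v] assms(3) by blast
  obtain i where i: "Suc i < length xs" "p \<in> geometric_cell {xs ! i, xs ! Suc i}"
    using path_cells_nth p by blast
  have "distinct xs" "xs \<noteq> []" using assms(1) by (auto simp: graph_path_def)
  then have ne: "xs ! i \<noteq> xs ! Suc i" using i by (simp add: nth_eq_iff_index_eq)
  have "\<not> (p (hd xs) \<noteq> 0 \<and> p (last xs) \<noteq> 0)"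
  proof
    assume *: "p (hd xs) \<noteq> 0 \<and> p (last xs) \<noteq> 0"
    then have "hd xs \<in> {xs ! i, xs ! Suc i}" "last xs \<in> {xs ! i, xs ! Suc i}"
      using geometric_cell_support[OF i(2)] by blast+
    then have "xs ! 0 \<in> {xs ! i, xs ! Suc i}" "xs ! (length xs - 1) \<in> {xs ! i, xs ! Suc i}"
      using \<open>xs \<noteq> []\<close> by (simp_all add: hd_conv_nth last_conv_nth)
    then have "0 = i \<or> 0 = Suc i" "length xs - 1 = i \<or> length xs - 1 = Suc i"
      using nth_eq_iff_index_eq[OF \<open>distinct xs\<close>, of 0] nth_eq_iff_index_eq[OF \<open>distinct xs\<close>, of "length xs - 1"]
        i(1) \<open>xs \<noteq> []\<close> by simp_all
    then show False using assms(2) by auto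
  qed
  then consider "p (hd xs) = 0" | "p (last xs) = 0" by blast
  then show "p \<in> {vertex_point (hd xs), vertex_point (last xs)}"
  proof cases
    case 1
    then have "w = last xs" if "p w \<noteq> 0" for w using sup[OF that] that by auto
    then show ?thesis using vertex_point_if_support[OF i(2) ne, of "last xs"] by blast
  next
    case 2
    then have "w = hd xs" if "p w \<noteq> 0" for w using sup[OF that] that by auto
    then show ?thesis using vertex_point_if_support[OF i(2) ne, of "hd xs"] by blast
  qed
qed

end

text \<open>The center is the first vertex at which a path from \<open>u3\<close> meets a path from
  \<open>u1\<close> to \<open>u2\<close>. It provides a branch vertex of the theta curve inside a
  branch set of the minor.\<close>

lemma connected_tripod:
  assumes A: "connected_in E A" "u1 \<in> A" "u2 \<in> A" "u3 \<in> A"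
  obtains x P1 P2 P3 where "x \<in> A"
    "graph_path E P1" "hd P1 = x" "last P1 = u1" "set P1 \<subseteq> A"
    "graph_path E P2" "hd P2 = x" "last P2 = u2" "set P2 \<subseteq> A"
    "graph_path E P3" "hd P3 = x" "last P3 = u3" "set P3 \<subseteq> A"
    "set P1 \<inter> set P2 = {x}" "set P1 \<inter> set P3 = {x}" "set P2 \<inter> set P3 = {x}"
proof -
  obtain W where W: "graph_path E W" "hd W = u1" "last W = u2" "set W \<subseteq> A"
    using connected_in_obtain_path[OF A(1,2,3)] .
  obtain Q where Q: "graph_path E Q" "hd Q = u3" "last Q = u1" "set Q \<subseteq> A"
    using connected_in_obtain_path[OF A(1,4,2)] .
  have ne: "W \<noteq> []" "Q \<noteq> []" using W(1) Q(1) by (simp_all add: graph_path_def)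
  then have "\<exists>z\<in>set Q. z \<in> set W" using W(2) Q(3) by (metis hd_in_set last_in_set)
  then obtain us x vs where Q': "Q = us @ x # vs" "x \<in> set W" "\<forall>y\<in>set us. y \<notin> set W"
    using split_list_first_prop[of Q "\<lambda>z. z \<in> set W"] by blast
  obtain as bs where W': "W = as @ x # bs" using Q'(2) by (meson split_list)
  have g: "graph_path E (us @ [x])" "graph_path E (as @ [x])" "graph_path E (x # bs)"
    using Q(1) W(1) unfolding Q'(1) W' by (auto simp: graph_path_append graph_path_Cons)
  have d: "distinct W" using W(1) by (simp add: graph_path_def)
  show thesis
  proof (rule that[of x "rev (as @ [x])" "x # bs" "rev (us @ [x])"])
    show "graph_path E (rev (as @ [x]))" "graph_path E (rev (us @ [x]))"
      using g by (simp_all only: graph_path_rev)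
    show "last (rev (as @ [x])) = u1" using W(2) W' by (cases as) auto
    show "last (x # bs) = u2" using W(3) W' by simp
    show "last (rev (us @ [x])) = u3" using Q(2) Q' by (cases us) auto
    show "set (rev (as @ [x])) \<inter> set (x # bs) = {x}" using d W' by auto
    show "set (rev (as @ [x])) \<inter> set (rev (us @ [x])) = {x}" using Q'(3) W' by auto
    show "set (x # bs) \<inter> set (rev (us @ [x])) = {x}" using Q'(3) W' by auto
  qed (use g W W' Q Q' in auto)
qed

text \<open>Ensures that the elements of a branch set are genuine vertices of the graph.\<close>

lemma connected_in_has_edge:
  assumes "connected_in E A" "adjacent E A B" "v \<in> A"
  shows "\<exists>u. {v, u} \<in> E"
proof (cases "A = {v}")
  case True
  then show ?thesis using assms by (auto simp: adjacent_def)
next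
  case False
  then obtain x y where "x \<in> {v}" "{x, y} \<in> E"
    using connected_in_cut[OF assms(1), of "{v}"] assms(3) by (metis empty_iff empty_subsetI insert_subset insertI1)
  then show ?thesis by blast
qed

text \<open>An edge from \<open>A\<close> to \<open>B\<close> may end off the paths in
  \<open>L\<close>. From there one walks inside \<open>B\<close> until \<open>L\<close> is met and
  stays in the component of \<open>A\<close> meanwhile; so the whole component, rather than
  \<open>A\<close>, is taken as the third hub.\<close>

lemma component_touches_branch_set:
  assumes A: "connected_in E A" "A \<inter> L = {}" "a \<in> A" and B: "connected_in E B" "B \<inter> L \<noteq> {}"
    and AB: "adjacent E A B"
  shows "\<exists>p\<in>B \<inter> L. adjacent E (component_in E (- L) a) {p}"
proof -
  let ?K = "component_in E (- L) a"
  have a: "a \<in> - L" using A by blast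
  have AK: "A \<subseteq> ?K" by (rule connected_subset_component) (use A in auto)
  obtain u b where ub: "u \<in> A" "b \<in> B" "{u, b} \<in> E" using AB by (auto simp: adjacent_def)
  show ?thesis
  proof (cases "b \<in> L")
    case True
    then show ?thesis using ub AK by (intro bexI[of _ b]) (auto simp: adjacent_def)
  next
    case False
    then have b: "b \<in> ?K" using component_in_closed[OF a _ _ ub(3)] AK ub(1) by blast
    have KL: "?K \<subseteq> - L" using component_in_subset[OF a] .
    have "B \<inter> ?K \<subseteq> B" "B \<inter> ?K \<noteq> {}" "B \<inter> ?K \<noteq> B" using b ub(2) B(2) KL by blast+
    then obtain x y where xy: "x \<in> B \<inter> ?K" "y \<in> B - B \<inter> ?K" "{x, y} \<in> E"
      using connected_in_cut[OF B(1)] by metis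
    then have "y \<in> L" using component_in_closed[OF a _ _ xy(3)] by blast
    then show ?thesis using xy by (intro bexI[of _ y]) (auto simp: adjacent_def)
  qed
qed

context plane_drawing begin

lemma vertex_point_in_G: "v \<in> V \<Longrightarrow> vertex_point v \<in> G"
  by (auto simp: topspace_realization geometric_cell_singleton)

lemma f_vertex_point_eq: "v \<in> V \<Longrightarrow> w \<in> V \<Longrightarrow> f (vertex_point v) = f (vertex_point w) \<longleftrightarrow> v = w"
  using inj_f vertex_point_in_G unfolding inj_on_def by (metis vertex_point_def zero_neq_one)

lemma path_images_Int:
  assumes g: "graph_path E xs" "3 \<le> length xs" "graph_path E ys"
    and ends: "hd ys = hd xs" "last ys = last xs" "2 \<le> length ys" "set xs \<inter> set ys = {hd xs, last xs}"
  shows "f ` path_cells xs \<inter> f ` path_cells ys = {f (vertex_point (hd xs)), f (vertex_point (last xs))}"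
proof -
  have "f ` path_cells xs \<inter> f ` path_cells ys = f ` (path_cells xs \<inter> path_cells ys)"
    using inj_on_image_Int[OF inj_f path_cells_subset[OF g(1)] path_cells_subset[OF g(3)]] by simp
  moreover have "path_cells xs \<inter> path_cells ys = {vertex_point (hd xs), vertex_point (last xs)}"
  proof
    have "hd xs \<in> set xs \<inter> set ys" "last xs \<in> set xs \<inter> set ys" using ends(4) by auto
    then show "{vertex_point (hd xs), vertex_point (last xs)} \<subseteq> path_cells xs \<inter> path_cells ys"
      using vertex_point_in_path_cells[of _ xs] vertex_point_in_path_cells[of _ ys] g(2) ends(3) by auto
  qed (rule path_cells_Int[OF g(1,2) ends(4)])
  ultimately show ?thesis by simp
qed

lemma no_theta_touching_set:
  assumes L: "graph_path E L1" "graph_path E L2" "graph_path E L3"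
    and hd: "hd L1 = x" "hd L2 = x" "hd L3 = x" and last: "last L1 = y" "last L2 = y" "last L3 = y"
    and Int: "set L1 \<inter> set L2 = {x, y}" "set L1 \<inter> set L3 = {x, y}" "set L2 \<inter> set L3 = {x, y}" and "x \<noteq> y"
    and K: "connected K" "K \<inter> (f ` path_cells L1 \<union> f ` path_cells L2 \<union> f ` path_cells L3) = {}"
    and p: "p1 \<in> set L1" "p1 \<notin> {x, y}" "f (vertex_point p1) \<in> closure K"
       "p2 \<in> set L2" "p2 \<notin> {x, y}" "f (vertex_point p2) \<in> closure K"
       "p3 \<in> set L3" "p3 \<notin> {x, y}" "f (vertex_point p3) \<in> closure K"
  shows False
proof -
  \<comment> \<open>The touching vertex, different from both ends, is a third vertex on each path;
    this is what \<open>path_images_Int\<close> needs.\<close>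
  have len: "3 \<le> length L" if "graph_path E L" "x \<in> set L" "y \<in> set L" "p \<in> set L" "p \<notin> {x, y}" for L p
  proof -
    have "card {x, y, p} \<le> card (set L)" using that by (intro card_mono) auto
    moreover have "card {x, y, p} = 3" using that(5) \<open>x \<noteq> y\<close> by auto
    moreover have "card (set L) = length L" using that(1) by (simp add: graph_path_def distinct_card)
    ultimately show ?thesis by simp
  qed
  have xy: "x \<in> set L1" "x \<in> set L2" "x \<in> set L3" "y \<in> set L1" "y \<in> set L2" "y \<in> set L3" using Int by auto
  have len: "3 \<le> length L1" "3 \<le> length L2" "3 \<le> length L3"
    using len L xy p by blast+
  then have len2: "2 \<le> length L1" "2 \<le> length L2" "2 \<le> length L3" by auto
  obtain g1 where g1: "arc g1" "pathstart g1 = f (vertex_point x)" "pathfinish g1 = f (vertex_point y)"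
    "path_image g1 = f ` path_cells L1" using obtain_arc[OF L(1) len2(1)] hd last by metis
  obtain g2 where g2: "arc g2" "pathstart g2 = f (vertex_point x)" "pathfinish g2 = f (vertex_point y)"
    "path_image g2 = f ` path_cells L2" using obtain_arc[OF L(2) len2(2)] hd last by metis
  obtain g3 where g3: "arc g3" "pathstart g3 = f (vertex_point x)" "pathfinish g3 = f (vertex_point y)"
    "path_image g3 = f ` path_cells L3" using obtain_arc[OF L(3) len2(3)] hd last by metis
  have I: "path_image g1 \<inter> path_image g2 = {f (vertex_point x), f (vertex_point y)}"
    "path_image g1 \<inter> path_image g3 = {f (vertex_point x), f (vertex_point y)}"
    "path_image g2 \<inter> path_image g3 = {f (vertex_point x), f (vertex_point y)}"
    using path_images_Int[OF L(1) len(1) L(2)] path_images_Int[OF L(1) len(1) L(3)] path_images_Int[OF L(2) len(2) L(3)]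
      hd last Int len2 g1(4) g2(4) g3(4) by simp_all
  have pV: "f (vertex_point p) \<in> path_image g \<and> f (vertex_point p) \<notin> {f (vertex_point x), f (vertex_point y)}"
    if "p \<in> set L" "p \<notin> {x, y}" "graph_path E L" "2 \<le> length L" "x \<in> set L" "y \<in> set L"
      "path_image g = f ` path_cells L" for p L g
  proof -
    have V: "p \<in> V" "x \<in> V" "y \<in> V" using graph_path_vertices_subset[OF conjunct1[OF edge] that(3,4)] that(1,5,6) by blast+
    show ?thesis
      using that vertex_point_in_path_cells[of p L] f_vertex_point_eq[OF V(1,2)] f_vertex_point_eq[OF V(1,3)] by simp
  qed
  note q = pV[OF p(1,2) L(1) len2(1) xy(1,4) g1(4)] pV[OF p(4,5) L(2) len2(2) xy(2,5) g2(4)]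
    pV[OF p(7,8) L(3) len2(3) xy(3,6) g3(4)]
  show False
    by (rule theta_curve_touching_set[OF g1(1) g2(1) g3(1) g1(2) g2(2) g3(2) g1(3) g2(3) g3(3) I K(1) _
        conjunct1[OF q(1)] conjunct2[OF q(1)] p(3) conjunct1[OF q(2)] conjunct2[OF q(2)] p(6)
        conjunct1[OF q(3)] conjunct2[OF q(3)] p(9)])
      (use K(2) g1(4) g2(4) g3(4) in simp)
qed

text \<open>Tripods in \<open>A1\<close> and \<open>A2\<close>, linked through \<open>B1\<close>,
  \<open>B2\<close> and \<open>B3\<close>, are drawn as a theta curve. The part of the graph
  reachable from \<open>A3\<close> off that curve touches all three arcs at inner vertices.\<close>

lemma no_k33_minor: "\<not> k33_minor E"
proof
  assume "k33_minor E"
  then obtain A1 A2 A3 B1 B2 B3 where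
    conn: "connected_in E A1" "connected_in E A2" "connected_in E A3"
      "connected_in E B1" "connected_in E B2" "connected_in E B3" and
    disj: "A1 \<inter> (A2 \<union> A3 \<union> B1 \<union> B2 \<union> B3) = {}" "A2 \<inter> (A3 \<union> B1 \<union> B2 \<union> B3) = {}"
      "A3 \<inter> (B1 \<union> B2 \<union> B3) = {}" "B1 \<inter> (B2 \<union> B3) = {}" "B2 \<inter> B3 = {}" and
    adj: "adjacent E A1 B1" "adjacent E A1 B2" "adjacent E A1 B3"
      "adjacent E A2 B1" "adjacent E A2 B2" "adjacent E A2 B3"
      "adjacent E A3 B1" "adjacent E A3 B2" "adjacent E A3 B3"
    unfolding k33_minor_def by metis
  obtain u1 b1 where ub1: "u1 \<in> A1" "b1 \<in> B1" "{u1, b1} \<in> E" using adj(1) by (auto simp: adjacent_def)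
  obtain u2 b2 where ub2: "u2 \<in> A1" "b2 \<in> B2" "{u2, b2} \<in> E" using adj(2) by (auto simp: adjacent_def)
  obtain u3 b3 where ub3: "u3 \<in> A1" "b3 \<in> B3" "{u3, b3} \<in> E" using adj(3) by (auto simp: adjacent_def)
  obtain w1 c1 where wc1: "w1 \<in> A2" "c1 \<in> B1" "{w1, c1} \<in> E" using adj(4) by (auto simp: adjacent_def)
  obtain w2 c2 where wc2: "w2 \<in> A2" "c2 \<in> B2" "{w2, c2} \<in> E" using adj(5) by (auto simp: adjacent_def)
  obtain w3 c3 where wc3: "w3 \<in> A2" "c3 \<in> B3" "{w3, c3} \<in> E" using adj(6) by (auto simp: adjacent_def)
  obtain x P1 P2 P3 where x: "x \<in> A1"
    and P1: "graph_path E P1" "hd P1 = x" "last P1 = u1" "set P1 \<subseteq> A1"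
    and P2: "graph_path E P2" "hd P2 = x" "last P2 = u2" "set P2 \<subseteq> A1"
    and P3: "graph_path E P3" "hd P3 = x" "last P3 = u3" "set P3 \<subseteq> A1"
    and P: "set P1 \<inter> set P2 = {x}" "set P1 \<inter> set P3 = {x}" "set P2 \<inter> set P3 = {x}"
    using connected_tripod[OF conn(1) ub1(1) ub2(1) ub3(1)] .
  obtain y Q1 Q2 Q3 where y: "y \<in> A2"
    and Q1: "graph_path E Q1" "hd Q1 = y" "last Q1 = w1" "set Q1 \<subseteq> A2"
    and Q2: "graph_path E Q2" "hd Q2 = y" "last Q2 = w2" "set Q2 \<subseteq> A2"
    and Q3: "graph_path E Q3" "hd Q3 = y" "last Q3 = w3" "set Q3 \<subseteq> A2"
    and Q: "set Q1 \<inter> set Q2 = {y}" "set Q1 \<inter> set Q3 = {y}" "set Q2 \<inter> set Q3 = {y}"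
    using connected_tripod[OF conn(2) wc1(1) wc2(1) wc3(1)] .
  obtain R1 where R1: "graph_path E R1" "hd R1 = b1" "last R1 = c1" "set R1 \<subseteq> B1"
    using connected_in_obtain_path[OF conn(4) ub1(2) wc1(2)] .
  obtain R2 where R2: "graph_path E R2" "hd R2 = b2" "last R2 = c2" "set R2 \<subseteq> B2"
    using connected_in_obtain_path[OF conn(5) ub2(2) wc2(2)] .
  obtain R3 where R3: "graph_path E R3" "hd R3 = b3" "last R3 = c3" "set R3 \<subseteq> B3"
    using connected_in_obtain_path[OF conn(6) ub3(2) wc3(2)] .
  have join: "graph_path E (P @ R @ rev Q) \<and> hd (P @ R @ rev Q) = hd P \<and> last (P @ R @ rev Q) = hd Q"
    if "graph_path E P" "graph_path E R" "graph_path E Q" "{last P, hd R} \<in> E" "{last Q, last R} \<in> E"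
      "set P \<subseteq> A1" "set R \<subseteq> B" "set Q \<subseteq> A2" "A1 \<inter> A2 = {}" "A1 \<inter> B = {}" "A2 \<inter> B = {}" for P Q R B
  proof -
    have ne: "P \<noteq> []" "R \<noteq> []" "Q \<noteq> []" using that by (simp_all add: graph_path_def)
    have "set R \<inter> set Q = {}" "set P \<inter> set R = {}" "set P \<inter> set Q = {}"
      using that(6-11) by blast+
    then show ?thesis
      using that(1-5) ne by (auto simp: graph_path_append graph_path_rev hd_rev last_rev insert_commute)
  qed
  have d: "A1 \<inter> A2 = {}" "A1 \<inter> A3 = {}" "A1 \<inter> B1 = {}" "A1 \<inter> B2 = {}" "A1 \<inter> B3 = {}"
    "A2 \<inter> A3 = {}" "A2 \<inter> B1 = {}" "A2 \<inter> B2 = {}" "A2 \<inter> B3 = {}"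
    "A3 \<inter> B1 = {}" "A3 \<inter> B2 = {}" "A3 \<inter> B3 = {}" "B1 \<inter> B2 = {}" "B1 \<inter> B3 = {}" "B2 \<inter> B3 = {}"
    using disj by (simp_all add: Int_Un_distrib)
  let ?L1 = "P1 @ R1 @ rev Q1" and ?L2 = "P2 @ R2 @ rev Q2" and ?L3 = "P3 @ R3 @ rev Q3"
  note J1 = join[OF P1(1) R1(1) Q1(1) _ _ P1(4) R1(4) Q1(4) d(1,3,7)]
  note J2 = join[OF P2(1) R2(1) Q2(1) _ _ P2(4) R2(4) Q2(4) d(1,4,8)]
  note J3 = join[OF P3(1) R3(1) Q3(1) _ _ P3(4) R3(4) Q3(4) d(1,5,9)]
  have J1: "graph_path E ?L1" "hd ?L1 = x" "last ?L1 = y" using J1 P1 Q1 R1 ub1 wc1 by simp_all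
  have J2: "graph_path E ?L2" "hd ?L2 = x" "last ?L2 = y" using J2 P2 Q2 R2 ub2 wc2 by simp_all
  have J3: "graph_path E ?L3" "hd ?L3 = x" "last ?L3 = y" using J3 P3 Q3 R3 ub3 wc3 by simp_all
  have int: "set (P @ R @ rev Q) \<inter> set (P' @ R' @ rev Q') = {x, y}"
    if "set P \<inter> set P' = {x}" "set Q \<inter> set Q' = {y}" "set P \<subseteq> A1" "set P' \<subseteq> A1" "set Q \<subseteq> A2" "set Q' \<subseteq> A2"
      "set R \<subseteq> B" "set R' \<subseteq> B'" "B \<inter> B' = {}" "A1 \<inter> B = {}" "A1 \<inter> B' = {}" "A2 \<inter> B = {}" "A2 \<inter> B' = {}"
    for P P' Q Q' R R' B B'
  proof -
    have "set P \<inter> set R' = {}" "set P \<inter> set Q' = {}" "set R \<inter> set P' = {}" "set R \<inter> set R' = {}"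
      "set R \<inter> set Q' = {}" "set Q \<inter> set P' = {}" "set Q \<inter> set R' = {}"
      using that(3-13) d(1) by blast+
    then show ?thesis using that(1,2) by (simp add: Int_Un_distrib Int_Un_distrib2 insert_commute)
  qed
  have I: "set ?L1 \<inter> set ?L2 = {x, y}" "set ?L1 \<inter> set ?L3 = {x, y}" "set ?L2 \<inter> set ?L3 = {x, y}"
    by (rule int[OF P(1) Q(1) P1(4) P2(4) Q1(4) Q2(4) R1(4) R2(4) d(13,3,4,7,8)],
        rule int[OF P(2) Q(2) P1(4) P3(4) Q1(4) Q3(4) R1(4) R3(4) d(14,3,5,7,9)],
        rule int[OF P(3) Q(3) P2(4) P3(4) Q2(4) Q3(4) R2(4) R3(4) d(15,4,5,8,9)])
  define L where "L = set ?L1 \<union> set ?L2 \<union> set ?L3"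
  obtain a where a: "a \<in> A3" using conn(3) by (auto simp: connected_in_def)
  have LA: "A3 \<inter> L = {}"
  proof -
    have "L \<subseteq> A1 \<union> A2 \<union> B1 \<union> B2 \<union> B3" unfolding L_def using P1(4) P2(4) P3(4) Q1(4) Q2(4) Q3(4) R1(4) R2(4) R3(4) by auto
    then show ?thesis using d(2,6,10,11,12) by blast
  qed
  let ?K = "component_in E (- L) a"
  have aL: "a \<in> - L" using a LA by blast
  have Rne: "R1 \<noteq> []" "R2 \<noteq> []" "R3 \<noteq> []" using R1 R2 R3 by (simp_all add: graph_path_def)
  have B1L: "B1 \<inter> L \<noteq> {}" unfolding L_def using hd_in_set[OF Rne(1)] R1(4) by auto
  have B2L: "B2 \<inter> L \<noteq> {}" unfolding L_def using hd_in_set[OF Rne(2)] R2(4) by auto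
  have B3L: "B3 \<inter> L \<noteq> {}" unfolding L_def using hd_in_set[OF Rne(3)] R3(4) by auto
  obtain p1 where p1: "p1 \<in> B1 \<inter> L" "adjacent E ?K {p1}"
    using component_touches_branch_set[OF conn(3) LA a conn(4) B1L adj(7)] by blast
  obtain p2 where p2: "p2 \<in> B2 \<inter> L" "adjacent E ?K {p2}"
    using component_touches_branch_set[OF conn(3) LA a conn(5) B2L adj(8)] by blast
  obtain p3 where p3: "p3 \<in> B3 \<inter> L" "adjacent E ?K {p3}"
    using component_touches_branch_set[OF conn(3) LA a conn(6) B3L adj(9)] by blast
  have sub1: "set P1 \<inter> B = {} \<and> set P2 \<inter> B = {} \<and> set P3 \<inter> B = {} \<and> set Q1 \<inter> B = {} \<and> set Q2 \<inter> B = {} \<and> set Q3 \<inter> B = {}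
      \<and> x \<notin> B \<and> y \<notin> B"
    if "A1 \<inter> B = {}" "A2 \<inter> B = {}" for B
    using P1(4) P2(4) P3(4) Q1(4) Q2(4) Q3(4) x y that by blast
  have q1: "p1 \<in> set ?L1" "p1 \<notin> {x, y}"
    using p1(1) sub1[OF d(3,7)] R2(4) R3(4) d(13,14) unfolding L_def by auto
  have q2: "p2 \<in> set ?L2" "p2 \<notin> {x, y}"
    using p2(1) sub1[OF d(4,8)] R1(4) R3(4) d(13,15) unfolding L_def by auto
  have q3: "p3 \<in> set ?L3" "p3 \<notin> {x, y}"
    using p3(1) sub1[OF d(5,9)] R1(4) R2(4) d(14,15) unfolding L_def by auto
  have KL: "?K \<inter> L = {}" using component_in_subset[OF aL] by blast
  have cK: "connected_in E ?K" using connected_component_in[OF aL] .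
  have "connected (f ` star ?K)" using connected_star[OF cK] connected_in_has_edge[OF cK p1(2)] by blast
  moreover have "f ` star ?K \<inter> (f ` path_cells ?L1 \<union> f ` path_cells ?L2 \<union> f ` path_cells ?L3) = {}"
  proof -
    have *: "f ` star ?K \<inter> f ` path_cells M = {}" if "graph_path E M" "set M \<subseteq> L" for M
    proof -
      have "?K \<inter> set M = {}" using that(2) KL by blast
      then have "star ?K \<inter> path_cells M = {}" by (rule star_path_cells_disjoint)
      then show ?thesis
        using inj_on_image_Int[OF inj_f _ path_cells_subset[OF that(1)], of "star ?K"] by (auto simp: star_def)
    qed
    show ?thesis using *[OF J1(1)] *[OF J2(1)] *[OF J3(1)] unfolding L_def Int_Un_distrib by blast
  qed
  moreover have "x \<noteq> y" using x y d(1) by blast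
  ultimately show False
    using no_theta_touching_set[OF J1(1) J2(1) J3(1) J1(2) J2(2) J3(2) J1(3) J2(3) J3(3) I]
      q1 q2 q3 closure_star[OF p1(2)] closure_star[OF p2(2)] closure_star[OF p3(2)] by blast
qed

text \<open>The open star of the edge \<open>{v1, v2}\<close> avoids the triangle on
  \<open>v3\<close>, \<open>v4\<close>, \<open>v5\<close> and so lies on one side of it. The other
  side plays the part of a third hub next to \<open>v1\<close> and \<open>v2\<close>, since it
  accumulates at all three corners.\<close>

lemma no_k5:
  assumes "distinct [v1, v2, v3, v4, v5]"
    and E: "\<And>u v. u \<in> {v1, v2, v3, v4, v5} \<Longrightarrow> v \<in> {v1, v2, v3, v4, v5} \<Longrightarrow> u \<noteq> v \<Longrightarrow> {u, v} \<in> E"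
  shows False
proof -
  have paths: "graph_path E [v3, v4, v5]" "graph_path E [v3, v5]"
    "graph_path E [v1, v3, v2]" "graph_path E [v1, v4, v2]" "graph_path E [v1, v5, v2]"
    using assms(1) by (auto simp: graph_path_def intro!: E)
  obtain g1 where g1: "arc g1" "pathstart g1 = f (vertex_point v3)" "pathfinish g1 = f (vertex_point v5)"
    "path_image g1 = f ` path_cells [v3, v4, v5]" using obtain_arc[OF paths(1)] by auto
  obtain g2 where g2: "arc g2" "pathstart g2 = f (vertex_point v3)" "pathfinish g2 = f (vertex_point v5)"
    "path_image g2 = f ` path_cells [v3, v5]" using obtain_arc[OF paths(2)] by auto
  have "set [v3, v4, v5] \<inter> set [v3, v5] = {v3, v5}" using assms(1) by auto
  then have int: "path_image g1 \<inter> path_image g2 = {f (vertex_point v3), f (vertex_point v5)}"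
    using path_images_Int[OF paths(1) _ paths(2)] g1(4) g2(4) by simp
  let ?J = "path_image g1 \<union> path_image g2"
  let ?g = "g1 +++ reversepath g2"
  have "simple_path ?g" using g1 g2 int by (intro simple_path_join_loop) (auto simp: arc_reversepath)
  moreover have "pathfinish ?g = pathstart ?g" using g1 g2 by simp
  moreover have "path_image ?g = ?J" using g1 g2 by (subst path_image_join) auto
  ultimately obtain X Y where XY: "open X" "connected X" "open Y" "connected Y"
    "X \<inter> Y = {}" "X \<union> Y = - ?J" "frontier X = ?J" "frontier Y = ?J"
    by (metis Jordan_curve)
  let ?S = "f ` star {v1, v2}"
  have ad: "adjacent E {v1, v2} {u}" if "u \<in> {v3, v4, v5}" for u
    using that assms(1) by (auto simp: adjacent_def intro!: E)
  have "connected_in E ({v1} \<union> {v2})"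
    using assms(1) by (intro connected_in_Un connected_in_singleton) (auto simp: adjacent_def intro!: E)
  then have c12: "connected_in E {v1, v2}" by (simp add: insert_commute)
  have cS: "connected ?S" using connected_star[OF c12] connected_in_has_edge[OF c12 ad[of v3]] by blast
  have SJ: "?S \<inter> ?J = {}"
  proof -
    have *: "?S \<inter> f ` path_cells M = {}" if "graph_path E M" "{v1, v2} \<inter> set M = {}" for M
      using inj_on_image_Int[OF inj_f _ path_cells_subset[OF that(1)], of "star {v1, v2}"]
        star_path_cells_disjoint[OF that(2)] by (auto simp: star_def)
    have "{v1, v2} \<inter> set [v3, v4, v5] = {}" "{v1, v2} \<inter> set [v3, v5] = {}" using assms(1) by auto
    then show ?thesis using *[OF paths(1)] *[OF paths(2)] g1(4) g2(4) by (simp add: Int_Un_distrib)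
  qed
  \<comment> \<open>\<open>W\<close> is the side of the triangle without the star. It is a face
    rather than a part of the graph, which is why the theta curve lemma admits any connected
    set.\<close>
  obtain W where W: "connected W" "W \<inter> ?S = {}" "W \<inter> ?J = {}" "frontier W = ?J"
  proof -
    have "X \<inter> ?S = {} \<or> Y \<inter> ?S = {}"
      using connectedD[OF cS XY(1) XY(3)] XY(5,6) SJ by blast
    then show thesis using that XY by (metis Compl_disjoint2 Int_Un_distrib2 Un_empty)
  qed
  have vG: "vertex_point u \<in> path_cells [v3, v4, v5]" if "u \<in> {v3, v4, v5}" for u
    using vertex_point_in_path_cells[of u "[v3, v4, v5]"] that by auto
  have cl: "f (vertex_point u) \<in> closure W" if "u \<in> {v3, v4, v5}" for u
    using vG[OF that] W(4) g1(4) by (auto simp: frontier_def)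
  have avoid: "W \<inter> f ` path_cells [v1, u, v2] = {}" if u: "u \<in> {v3, v4, v5}" for u
  proof -
    have pu: "graph_path E [v1, u, v2]" using u paths by auto
    have "f p \<notin> W" if p: "p \<in> path_cells [v1, u, v2]" for p
    \<comment> \<open>A point of the path with weight at \<open>v1\<close> or \<open>v2\<close> lies
      in the star; otherwise it is the corner \<open>u\<close> of the triangle.\<close>
    proof (cases "p v1 = 0 \<and> p v2 = 0")
      case True
      have "w = u" if "p w \<noteq> 0" for w using path_cells_support[OF p that] True that by auto
      moreover have "p \<in> geometric_cell {v1, u} \<or> p \<in> geometric_cell {u, v2}" using p by simp
      moreover have "v1 \<noteq> u" "u \<noteq> v2" using assms(1) u by auto
      ultimately have "p = vertex_point u" using vertex_point_if_support by metis
      then show ?thesis using vG[OF u] W(3) g1(4) by blast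
    next
      case False
      then have "p \<in> star {v1, v2}" using p path_cells_subset[OF pu] by (auto simp: star_def)
      then show ?thesis using W(2) by blast
    qed
    then show ?thesis by blast
  qed
  show False
  proof (rule no_theta_touching_set[OF paths(3-5), of v1 v2 W v3 v4 v5])
    show "W \<inter> (f ` path_cells [v1, v3, v2] \<union> f ` path_cells [v1, v4, v2] \<union> f ` path_cells [v1, v5, v2]) = {}"
      using avoid[of v3] avoid[of v4] avoid[of v5] by blast
  qed (use assms(1) cl W(1) in auto)
qed

end

section \<open>Symmetric drawings of the complete graph on four vertices\<close>

text \<open>Used to turn a continuous injection into the sphere into an embedding.\<close>

lemma compact_space_realization:
  assumes "finite V" "finite E" "\<And>e. e \<in> E \<Longrightarrow> card e = 2"
  shows "compact_space (realization V E)"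
proof -
  have *: "compactin (powertop_real UNIV) (geometric_cell e)" if eE: "e \<in> E" for e
  proof -
    obtain u v where e: "e = {u, v}" "u \<noteq> v" using assms(3)[OF eE] by (meson card_2_iff)
    have "compactin (top_of_set {0..1::real}) {0..1}"
      by (simp add: compactin_subtopology)
    from image_compactin[OF this continuous_map_edge_point] show ?thesis
      by (simp add: e geometric_cell_edge)
  qed
  have "compactin (powertop_real UNIV) (\<Union>v\<in>V. geometric_cell {v})"
    using assms(1) by (intro compactin_Union) (auto simp: geometric_cell_singleton)
  moreover have "compactin (powertop_real UNIV) (\<Union>e\<in>E. geometric_cell e)"
    using assms(2) * by (intro compactin_Union) auto
  ultimately show ?thesis
    unfolding realization_def by (intro compact_space_subtopology compactin_Un)
qed

text \<open>Moving vertices by \<open>\<tau>\<close> acts on coordinates by composition with the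
  inverse, which for an involution is \<open>\<tau>\<close> itself.\<close>

lemma geometric_cell_involution:
  assumes "\<And>v. \<tau> (\<tau> v) = v"
  shows "(\<lambda>x. x \<circ> \<tau>) ` geometric_cell s = geometric_cell (\<tau> ` s)"
proof -
  have inj: "inj_on \<tau> A" for A using assms by (metis inj_onI)
  have sub: "(\<lambda>x. x \<circ> \<tau>) ` geometric_cell t \<subseteq> geometric_cell (\<tau> ` t)" for t
  proof
    fix y assume "y \<in> (\<lambda>x. x \<circ> \<tau>) ` geometric_cell t"
    then obtain x where x: "x \<in> geometric_cell t" "y = x \<circ> \<tau>" by blast
    have "v \<in> \<tau> ` t" if "\<tau> v \<in> t" for v using that assms by (metis imageI)
    moreover have "sum (x \<circ> \<tau>) (\<tau> ` t) = sum x t"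
      using sum.reindex[OF inj, of "x \<circ> \<tau>" t] assms by (simp add: comp_def)
    ultimately show "y \<in> geometric_cell (\<tau> ` t)"
      using x by (auto simp: geometric_cell_def)
  qed
  show ?thesis
  proof
    show "geometric_cell (\<tau> ` s) \<subseteq> (\<lambda>x. x \<circ> \<tau>) ` geometric_cell s"
    proof
      fix y assume "y \<in> geometric_cell (\<tau> ` s)"
      then have "y \<circ> \<tau> \<in> geometric_cell (\<tau> ` \<tau> ` s)" using sub by blast
      moreover have "\<tau> ` \<tau> ` s = s" using assms by (simp add: image_image)
      moreover have "y = (y \<circ> \<tau>) \<circ> \<tau>" using assms by (simp add: comp_def)
      ultimately show "y \<in> (\<lambda>x. x \<circ> \<tau>) ` geometric_cell s" by (metis imageI)
    qed
  qed (rule sub)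
qed

text \<open>The boundary of a regular tetrahedron centred at the origin of the hyperplane where the last
  coordinate vanishes, projected radially to the sphere.\<close>

definition tetrahedron :: "'a \<Rightarrow> 'a \<Rightarrow> 'a \<Rightarrow> 'a \<Rightarrow> ('a \<Rightarrow> real) \<Rightarrow> nat \<Rightarrow> real" where
  "tetrahedron a b c d x i =
     (if i = 0 then x a - x b else if i = 1 then x c - x d else if i = 2 then x a + x b - x c - x d else 0)"

definition tetrahedron_norm :: "'a \<Rightarrow> 'a \<Rightarrow> 'a \<Rightarrow> 'a \<Rightarrow> ('a \<Rightarrow> real) \<Rightarrow> real" where
  "tetrahedron_norm a b c d x =
     sqrt ((x a - x b)\<^sup>2 + (x c - x d)\<^sup>2 + (x a + x b - x c - x d)\<^sup>2)"

definition spherical_tetrahedron :: "'a \<Rightarrow> 'a \<Rightarrow> 'a \<Rightarrow> 'a \<Rightarrow> ('a \<Rightarrow> real) \<Rightarrow> nat \<Rightarrow> real" where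
  "spherical_tetrahedron a b c d x = (\<lambda>i. tetrahedron a b c d x i / tetrahedron_norm a b c d x)"

section \<open>Orientation reversing symmetries of the 3-sphere\<close>

definition reflect_first :: "(nat \<Rightarrow> real) \<Rightarrow> nat \<Rightarrow> real" where
  "reflect_first x = (\<lambda>i. if i = 0 then - x i else x i)"

text \<open>Enters only through its square, which negates coordinates 1 and 3; then the degree
  matters only up to sign.\<close>

definition quarter_turn :: "(nat \<Rightarrow> real) \<Rightarrow> nat \<Rightarrow> real" where
  "quarter_turn x = (\<lambda>i. if i = 1 then - x 3 else if i = 3 then x 1 else x i)"

lemma continuous_reflect_first: "continuous_map (nsphere n) (nsphere n) reflect_first"
  unfolding reflect_first_def by (rule continuous_map_nsphere_reflection)

lemma degree_reflect_first: "Brouwer_degree2 n reflect_first = - 1"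
  unfolding reflect_first_def by (rule Brouwer_degree2_reflection)

lemma topspace_nsphere_3:
  "topspace (nsphere 3) = {x. (x 0)\<^sup>2 + (x 1)\<^sup>2 + (x 2)\<^sup>2 + (x 3)\<^sup>2 = 1 \<and> (\<forall>i>3. x i = 0)}"
  by (simp add: nsphere eval_nat_numeral)

lemma continuous_map_into_nsphere_3:
  assumes "\<And>i. continuous_map X euclideanreal (\<lambda>x. f x i)" "\<And>x. x \<in> topspace X \<Longrightarrow> f x \<in> topspace (nsphere 3)"
  shows "continuous_map X (nsphere 3) f"
  unfolding nsphere using assms
  by (auto simp: continuous_map_in_subtopology continuous_map_componentwise_UNIV nsphere)

lemma continuous_quarter_turn: "continuous_map (nsphere 3) (nsphere 3) quarter_turn"
proof (rule continuous_map_into_nsphere_3)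
  show "continuous_map (nsphere 3) euclideanreal (\<lambda>x. quarter_turn x i)" for i
    unfolding quarter_turn_def
    by (cases "i = 1"; cases "i = 3") (auto intro!: continuous_map_minus continuous_map_nsphere_projection)
  show "quarter_turn x \<in> topspace (nsphere 3)" if "x \<in> topspace (nsphere 3)" for x
    using that by (auto simp: topspace_nsphere_3 quarter_turn_def algebra_simps)
qed

text \<open>On the drawing, where coordinate 3 vanishes, this is the half turn that induces a double
  transposition. The half turn alone preserves orientation; negating coordinate 3 as well reverses
  it without moving the drawing further.\<close>

definition half_turn_reflection :: "(nat \<Rightarrow> real) \<Rightarrow> nat \<Rightarrow> real" where
  "half_turn_reflection = reflect_first \<circ> (quarter_turn \<circ> quarter_turn)"

lemma half_turn_reflection_eq: "half_turn_reflection x = (\<lambda>i. if i \<in> {0, 1, 3} then - x i else x i)"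
  by (auto simp: half_turn_reflection_def reflect_first_def quarter_turn_def)

lemma continuous_half_turn_reflection: "continuous_map (nsphere 3) (nsphere 3) half_turn_reflection"
  unfolding half_turn_reflection_def
  by (intro continuous_map_compose[OF _ continuous_reflect_first] continuous_map_compose[OF _ continuous_quarter_turn]
      continuous_quarter_turn)

text \<open>The fourth power of the quarter turn is the identity, so its integer degree has square
  1; the sign comes from \<open>reflect_first\<close>.\<close>

lemma degree_half_turn_reflection: "Brouwer_degree2 3 half_turn_reflection = - 1"
proof -
  let ?q = "Brouwer_degree2 3 quarter_turn"
  have c2: "continuous_map (nsphere 3) (nsphere 3) (quarter_turn \<circ> quarter_turn)"
    by (rule continuous_map_compose[OF continuous_quarter_turn continuous_quarter_turn])
  have "(quarter_turn \<circ> quarter_turn) \<circ> (quarter_turn \<circ> quarter_turn) = id"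
    by (auto simp: fun_eq_iff quarter_turn_def)
  then have "(?q * ?q) * (?q * ?q) = 1"
    using Brouwer_degree2_compose[OF c2 c2] Brouwer_degree2_compose[OF continuous_quarter_turn continuous_quarter_turn]
    by simp
  moreover have "0 \<le> ?q * ?q" by simp
  ultimately have "?q * ?q = 1" using zmult_eq_1_iff[of "?q * ?q" "?q * ?q"] by auto
  then show ?thesis
    unfolding half_turn_reflection_def
    using Brouwer_degree2_compose[OF c2 continuous_reflect_first] degree_reflect_first
      Brouwer_degree2_compose[OF continuous_quarter_turn continuous_quarter_turn] by simp
qed

section \<open>The tetrahedral drawing and its symmetries\<close>

locale k4 =
  fixes V :: "'a set" and E :: "'a set set" and a b c d :: 'a
  assumes V: "V = {a, b, c, d}" and dist: "distinct [a, b, c, d]"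
    and E: "E = {{u, v} |u v. u \<in> V \<and> v \<in> V \<and> u \<noteq> v}"
begin

abbreviation emb where "emb \<equiv> spherical_tetrahedron a b c d"
abbreviation nrm where "nrm \<equiv> tetrahedron_norm a b c d"

text \<open>The last conclusion places the graph on the boundary of the tetrahedron, where some
  barycentric coordinate vanishes.\<close>

lemma graph_points:
  assumes "x \<in> topspace (realization V E)"
  shows "\<And>v. 0 \<le> x v" "\<And>v. v \<notin> V \<Longrightarrow> x v = 0" "x a + x b + x c + x d = 1"
    "x a = 0 \<or> x b = 0 \<or> x c = 0 \<or> x d = 0"
proof -
  obtain e where e: "x \<in> geometric_cell e" "e \<subseteq> V" "card e \<le> 2"
  proof -
    have "x \<in> (\<Union>v\<in>V. geometric_cell {v}) \<or> x \<in> (\<Union>e\<in>E. geometric_cell e)"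
      using assms by (simp add: topspace_realization)
    then show thesis
    proof
      assume "x \<in> (\<Union>v\<in>V. geometric_cell {v})"
      then obtain v where "v \<in> V" "x \<in> geometric_cell {v}" by blast
      then show thesis by (intro that[of "{v}"]) auto
    next
      assume "x \<in> (\<Union>e\<in>E. geometric_cell e)"
      then obtain u v where "u \<in> V" "v \<in> V" "u \<noteq> v" "x \<in> geometric_cell {u, v}" by (auto simp: E)
      then show thesis by (intro that[of "{u, v}"]) auto
    qed
  qed
  show pos: "0 \<le> x v" for v using e(1) by (simp add: geometric_cell_def)
  have out: "x v = 0" if "v \<notin> e" for v using e(1) that by (simp add: geometric_cell_def)
  show "x v = 0" if "v \<notin> V" for v using out e(2) that by blast
  have "sum x V = sum x e"
    by (rule sum.mono_neutral_right) (use V e(2) out in auto)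
  also have "\<dots> = 1" using e(1) by (simp add: geometric_cell_def)
  finally show "x a + x b + x c + x d = 1" using dist by (simp add: V add.assoc)
  have "card V = 4" using dist by (simp add: V)
  then have "e \<noteq> V" using e(3) by auto
  then show "x a = 0 \<or> x b = 0 \<or> x c = 0 \<or> x d = 0" using e(2) out V by blast
qed

text \<open>Norm zero would make all four coordinates equal, which is the center of the tetrahedron
  and not on its boundary.\<close>

lemma norm_pos:
  assumes "x \<in> topspace (realization V E)"
  shows "0 < nrm x"
proof -
  note g = graph_points[OF assms]
  have "\<not> (x a = x b \<and> x c = x d \<and> x a + x b = x c + x d)" using g(3,4) by auto
  then have "0 < (x a - x b)\<^sup>2 \<or> 0 < (x c - x d)\<^sup>2 \<or> 0 < (x a + x b - x c - x d)\<^sup>2"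
    by (auto simp: zero_less_power2)
  then have "0 < (x a - x b)\<^sup>2 + (x c - x d)\<^sup>2 + (x a + x b - x c - x d)\<^sup>2"
    by (smt (verit) zero_le_power2)
  then show ?thesis by (simp add: tetrahedron_norm_def)
qed

text \<open>Points with the same image lie on one ray from the center, which reads
  \<open>x v = t * y v + (1 - t) / 4\<close> in every coordinate. For \<open>t < 1\<close> all
  coordinates of \<open>x\<close> would be positive, for \<open>1 < t\<close> all those of
  \<open>y\<close>; but each point has a vanishing one.\<close>

lemma inj_emb: "inj_on emb (topspace (realization V E))"
proof (rule inj_onI)
  fix x y assume x: "x \<in> topspace (realization V E)" and y: "y \<in> topspace (realization V E)" and eq: "emb x = emb y"
  define t where "t = nrm x / nrm y"
  have t: "0 < t" using norm_pos x y by (simp add: t_def)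
  have T: "tetrahedron a b c d x i = t * tetrahedron a b c d y i" for i
    using fun_cong[OF eq, of i] norm_pos[OF x] norm_pos[OF y]
    by (simp add: spherical_tetrahedron_def t_def field_simps)
  have e: "x a - x b = t * (y a - y b)" "x c - x d = t * (y c - y d)"
    "x a + x b - x c - x d = t * (y a + y b - y c - y d)"
    using T[of 0] T[of 1] T[of 2] by (simp_all add: tetrahedron_def)
  note gx = graph_points[OF x] and gy = graph_points[OF y]
  have s: "t * (y a + y b + y c + y d) = t" using gy(3) by simp
  have e': "x a - x b = t * y a - t * y b" "x c - x d = t * y c - t * y d"
    "x a + x b - x c - x d = t * y a + t * y b - t * y c - t * y d" "t * y a + t * y b + t * y c + t * y d = t"
    using e s by (simp_all add: distrib_left right_diff_distrib)
  have "x a = t * y a + (1 - t) / 4" using e' gx(3) by (simp add: field_simps)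
  moreover have "x b = t * y b + (1 - t) / 4" using e' gx(3) by (simp add: field_simps)
  moreover have "x c = t * y c + (1 - t) / 4" using e' gx(3) by (simp add: field_simps)
  moreover have "x d = t * y d + (1 - t) / 4" using e' gx(3) by (simp add: field_simps)
  ultimately have v: "x a = t * y a + (1 - t) / 4" "x b = t * y b + (1 - t) / 4"
    "x c = t * y c + (1 - t) / 4" "x d = t * y d + (1 - t) / 4" .
  have "t * y a \<ge> 0" "t * y b \<ge> 0" "t * y c \<ge> 0" "t * y d \<ge> 0" using t gy(1) by simp_all
  then have "\<not> t < 1" using v gx(4) by (auto simp: field_simps)
  moreover have "\<not> 1 < t"
  proof
    assume "1 < t"
    from gy(4) show False using v gx(1)[of a] gx(1)[of b] gx(1)[of c] gx(1)[of d] \<open>1 < t\<close> by auto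
  qed
  ultimately have "t = 1" by simp
  then have "x v = y v" if "v \<in> V" for v using v that V by auto
  then show "x = y" using gx(2) gy(2) by (metis ext)
qed

lemma continuous_emb: "continuous_map (realization V E) (nsphere 3) emb"
proof (rule continuous_map_into_nsphere_3)
  have proj: "continuous_map (realization V E) euclideanreal (\<lambda>x. x v)" for v
    unfolding realization_def
    by (intro continuous_map_from_subtopology continuous_map_product_projection[OF UNIV_I])
  have "continuous_map (realization V E) euclideanreal (\<lambda>x. tetrahedron a b c d x i)" for i
    unfolding tetrahedron_def
    by (cases "i = 0"; cases "i = 1"; cases "i = 2")
      (auto intro!: continuous_map_diff continuous_map_add proj)
  moreover have "continuous_map (realization V E) euclideanreal nrm"
    unfolding tetrahedron_norm_def[abs_def]
    by (intro continuous_map_sqrt continuous_map_add continuous_map_real_pow continuous_map_diff proj)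
  ultimately show "continuous_map (realization V E) euclideanreal (\<lambda>x. emb x i)" for i
    unfolding spherical_tetrahedron_def using norm_pos
    by (intro continuous_map_real_divide) (auto simp: less_le)
  fix x assume "x \<in> topspace (realization V E)"
  then have pos: "0 < nrm x" by (rule norm_pos)
  have "(nrm x)\<^sup>2 = (x a - x b)\<^sup>2 + (x c - x d)\<^sup>2 + (x a + x b - x c - x d)\<^sup>2"
    by (simp add: tetrahedron_norm_def)
  moreover have "(nrm x)\<^sup>2 \<noteq> 0" using pos by simp
  ultimately have "((x a - x b) / nrm x)\<^sup>2 + ((x c - x d) / nrm x)\<^sup>2 + ((x a + x b - x c - x d) / nrm x)\<^sup>2 = 1"
    by (simp add: power_divide flip: add_divide_distrib)
  then show "emb x \<in> topspace (nsphere 3)"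
    by (simp add: topspace_nsphere_3 spherical_tetrahedron_def tetrahedron_def)
qed

lemma finite_E: "finite E"
proof -
  have "E \<subseteq> Pow V" by (auto simp: E)
  then show ?thesis using finite_subset[of E "Pow V"] by (simp add: V)
qed

lemma embedding: "graph_embedding (nsphere 3) V E emb"
  unfolding graph_embedding_def
proof (rule injective_closed_imp_embedding_map[OF continuous_emb _ inj_emb])
  have "Hausdorff_space (nsphere 3)"
    unfolding nsphere_def by (intro Hausdorff_space_subtopology Hausdorff_Euclidean_space)
  moreover have "compact_space (realization V E)"
    by (rule compact_space_realization) (use finite_E V E in auto)
  ultimately show "closed_map (realization V E) (nsphere 3) emb"
    using continuous_emb by (intro continuous_imp_closed_map_gen) (auto simp: Hausdorff_imp_kc_space)
qed

text \<open>An isometry that realizes a vertex involution carries each drawn edge onto the one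
  prescribed. Since \<open>a\<close> goes to \<open>b\<close>, it is nontrivial on the
  graph.\<close>

lemma symmetric_drawing:
  assumes inv: "\<And>v. \<tau> (\<tau> v) = v" and \<tau>: "\<tau> ` V \<subseteq> V" "\<tau> a = b"
    and col: "\<And>u v. u \<in> V \<Longrightarrow> v \<in> V \<Longrightarrow> u \<noteq> v \<Longrightarrow> col {\<tau> u, \<tau> v} = col {u, v}"
    and h: "continuous_map (nsphere 3) (nsphere 3) h" "\<And>x. h (h x) = x" "Brouwer_degree2 3 h = - 1"
    and equi: "\<And>x. h (emb x) = emb (x \<circ> \<tau>)"
  shows "color_preserving_homeomorphism (nsphere 3) V E col emb h \<and> orientation_reversing 3 h \<and>
    \<not> restricts_to_automorphism V E emb h id"
proof -
  have cell: "h ` emb ` geometric_cell s = emb ` geometric_cell (\<tau> ` s)" for s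
  proof -
    have "h ` emb ` geometric_cell s = emb ` (\<lambda>x. x \<circ> \<tau>) ` geometric_cell s"
      by (simp add: image_image equi)
    then show ?thesis using geometric_cell_involution[OF inv] by simp
  qed
  have inj: "\<tau> u = \<tau> v \<longleftrightarrow> u = v" for u v using inv by metis
  have tV: "\<tau> v \<in> V \<longleftrightarrow> v \<in> V" for v using inv \<tau>(1) by (metis image_subset_iff)
  have "v \<in> \<tau> ` V" if "v \<in> V" for v
    by (rule image_eqI[of _ _ "\<tau> v"]) (simp_all add: inv tV that)
  then have timg: "\<tau> ` V = V" using \<tau>(1) by blast
  have tE: "\<tau> ` e \<in> E" if e: "e \<in> E" for e
  proof -
    obtain u v where uv: "e = {u, v}" "u \<in> V" "v \<in> V" "u \<noteq> v" using e by (auto simp: E)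
    then have "\<tau> ` e = {\<tau> u, \<tau> v}" "\<tau> u \<in> V" "\<tau> v \<in> V" "\<tau> u \<noteq> \<tau> v" using tV inj by simp_all
    then show ?thesis unfolding E by blast
  qed
  have autom: "color_preserving_automorphism V E col \<tau>"
    unfolding color_preserving_automorphism_def graph_automorphism_def
  proof (intro conjI ballI)
    show "bij_betw \<tau> V V" using timg inj by (auto simp: bij_betw_def inj_on_def)
    have mem: "{u, v} \<in> E \<longleftrightarrow> u \<noteq> v" if "u \<in> V" "v \<in> V" for u v
      using that by (auto simp: E doubleton_eq_iff)
    show "{u, v} \<in> E \<longleftrightarrow> {\<tau> u, \<tau> v} \<in> E" if "u \<in> V" "v \<in> V" for u v
      using that tV mem inj by simp
    show "col (\<tau> ` e) = col e" if "e \<in> E" for e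
      using that col by (auto simp: E)
  qed
  have rest: "restricts_to_automorphism V E emb h \<tau>"
    unfolding restricts_to_automorphism_def using cell by simp
  have "h ` emb ` topspace (realization V E) = emb ` topspace (realization V E)"
  proof -
    have sub: "h ` emb ` topspace (realization V E) \<subseteq> emb ` topspace (realization V E)"
    proof
      fix z assume "z \<in> h ` emb ` topspace (realization V E)"
      then obtain x where x: "x \<in> topspace (realization V E)" "z = h (emb x)" by blast
      then obtain s where s: "x \<in> geometric_cell s" "(\<exists>v\<in>V. s = {v}) \<or> s \<in> E"
        by (auto simp: topspace_realization)
      then have "(\<exists>v\<in>V. \<tau> ` s = {v}) \<or> \<tau> ` s \<in> E" using tE tV by auto
      then have "geometric_cell (\<tau> ` s) \<subseteq> topspace (realization V E)" by (auto simp: topspace_realization)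
      moreover have "z \<in> emb ` geometric_cell (\<tau> ` s)" using x s cell by blast
      ultimately show "z \<in> emb ` topspace (realization V E)" by blast
    qed
    then have "h ` h ` emb ` topspace (realization V E) \<subseteq> h ` emb ` topspace (realization V E)" by blast
    then show ?thesis using sub h(2) by (simp add: image_image subset_antisym)
  qed
  moreover have "homeomorphic_map (nsphere 3) (nsphere 3) h"
    using h(1,2) by (intro homeomorphic_map_involution) auto
  ultimately have "color_preserving_homeomorphism (nsphere 3) V E col emb h"
    unfolding color_preserving_homeomorphism_def using autom rest by blast
  moreover have "\<not> restricts_to_automorphism V E emb h id"
  proof
    assume "restricts_to_automorphism V E emb h id"
    then have "h ` emb ` geometric_cell {a} = emb ` geometric_cell {a}"
      using V by (simp add: restricts_to_automorphism_def)
    then have "emb (vertex_point b) = emb (vertex_point a)"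
      using cell[of "{a}"] \<tau>(2) by (simp add: geometric_cell_singleton)
    moreover have "vertex_point v \<in> topspace (realization V E)" if "v \<in> V" for v
      using that by (auto simp: topspace_realization geometric_cell_singleton)
    ultimately have "vertex_point b = vertex_point a" using inj_emb V by (auto simp: inj_on_def)
    then have "vertex_point b a = vertex_point a a" by simp
    then show False using dist by (simp add: vertex_point_def)
  qed
  ultimately show ?thesis using h(3) by (simp add: orientation_reversing_def)
qed

text \<open>Before normalization \<open>a\<close>, \<open>b\<close> are drawn at (1, 0, 1), (-1, 0,
  1) and \<open>c\<close>, \<open>d\<close> at (0, 1, -1), (0, -1, -1), so exchanging
  \<open>a\<close> and \<open>b\<close> negates coordinate 0 only. The hypotheses concern the edges
  that move.\<close>

lemma transposition_symmetry:
  assumes "col {a, c} = col {b, c}" "col {a, d} = col {b, d}"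
  shows "\<exists>h. color_preserving_homeomorphism (nsphere 3) V E col emb h \<and> orientation_reversing 3 h \<and>
    \<not> restricts_to_automorphism V E emb h id"
proof -
  have "color_preserving_homeomorphism (nsphere 3) V E col emb reflect_first \<and> orientation_reversing 3 reflect_first \<and>
    \<not> restricts_to_automorphism V E emb reflect_first id"
  proof (rule symmetric_drawing[of "id(a := b, b := a)"])
    show "col {(id(a := b, b := a)) u, (id(a := b, b := a)) v} = col {u, v}"
      if "u \<in> V" "v \<in> V" "u \<noteq> v" for u v
      using that assms dist by (auto simp: V insert_commute)
    show "reflect_first (emb x) = emb (x \<circ> id(a := b, b := a))" for x
      using dist by (auto simp: reflect_first_def spherical_tetrahedron_def tetrahedron_def tetrahedron_norm_def
          power2_commute add.commute fun_eq_iff minus_divide_left)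
  qed (use V dist in \<open>auto simp: continuous_reflect_first degree_reflect_first, auto simp: reflect_first_def\<close>)
  then show ?thesis by blast
qed

text \<open>Exchanging both pairs negates coordinates 0 and 1. The edges \<open>{a, b}\<close> and
  \<open>{c, d}\<close> stay; the other four are exchanged as in the hypotheses.\<close>

lemma double_transposition_symmetry:
  assumes "col {a, c} = col {b, d}" "col {a, d} = col {b, c}"
  shows "\<exists>h. color_preserving_homeomorphism (nsphere 3) V E col emb h \<and> orientation_reversing 3 h \<and>
    \<not> restricts_to_automorphism V E emb h id"
proof -
  let ?h = half_turn_reflection and ?t = "id(a := b, b := a, c := d, d := c)"
  have "color_preserving_homeomorphism (nsphere 3) V E col emb ?h \<and> orientation_reversing 3 ?h \<and>
    \<not> restricts_to_automorphism V E emb ?h id"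
  proof (rule symmetric_drawing[of ?t])
    show "col {?t u, ?t v} = col {u, v}" if "u \<in> V" "v \<in> V" "u \<noteq> v" for u v
      using that assms dist by (auto simp: V insert_commute)
    have nrm: "nrm (x \<circ> ?t) = nrm x" for x
      using dist by (auto simp: tetrahedron_norm_def power2_commute algebra_simps)
    have tet: "tetrahedron a b c d (x \<circ> ?t) i =
        (if i \<in> {0, 1, 3} then - tetrahedron a b c d x i else tetrahedron a b c d x i)" for x i
      using dist by (simp add: tetrahedron_def)
    show "?h (emb x) = emb (x \<circ> ?t)" for x
    proof (rule ext)
      show "?h (emb x) i = emb (x \<circ> ?t) i" for i
        unfolding half_turn_reflection_eq spherical_tetrahedron_def nrm tet by simp
    qed
  qed (use V dist in \<open>auto simp: continuous_half_turn_reflection degree_half_turn_reflection, auto simp: half_turn_reflection_eq\<close>)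
  then show ?thesis by blast
qed

end

section \<open>Asymmetric colorings\<close>

text \<open>\<open>B\<close> will be the set of black edges. Asking only that \<open>B\<close> be
  mapped into itself reduces the verifications to chasing images of black edges.\<close>

definition determining :: "'a set \<Rightarrow> 'a set set \<Rightarrow> 'a set set \<Rightarrow> bool" where
  "determining V E B \<longleftrightarrow> B \<subseteq> E \<and>
     (\<forall>\<sigma>. edge_permutation E \<sigma> \<and> \<sigma> ` V = V \<and> (\<forall>u v. {u, v} \<in> B \<longrightarrow> {\<sigma> u, \<sigma> v} \<in> B) \<longrightarrow> (\<forall>x\<in>V. \<sigma> x = x))"

lemma determining_imp_trivial_automorphism:
  assumes E: "\<And>e. e \<in> E \<Longrightarrow> e \<subseteq> V" and B: "determining V E B"
    and \<sigma>: "color_preserving_automorphism V E (\<lambda>e. if e \<in> B then Black else Grey) \<sigma>" and x: "x \<in> V"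
  shows "\<sigma> x = x"
proof -
  let ?c = "\<lambda>e. if e \<in> B then Black else Grey"
  \<comment> \<open>Extension by the identity makes the automorphism a permutation of the whole
    type.\<close>
  define \<tau> where "\<tau> = (\<lambda>v. if v \<in> V then \<sigma> v else v)"
  have bb: "bij_betw \<sigma> V V" and edges: "\<And>u v. u \<in> V \<Longrightarrow> v \<in> V \<Longrightarrow> {u, v} \<in> E \<longleftrightarrow> {\<sigma> u, \<sigma> v} \<in> E"
    and col: "\<And>e. e \<in> E \<Longrightarrow> ?c (\<sigma> ` e) = ?c e"
    using \<sigma> unfolding color_preserving_automorphism_def graph_automorphism_def by blast+
  have "bij_betw \<tau> V V" using bb bij_betw_cong[of V \<tau> \<sigma>] by (simp add: \<tau>_def)
  moreover have "bij_betw \<tau> (- V) (- V)" using bij_betw_cong[of "- V" \<tau> id] by (simp add: \<tau>_def)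
  ultimately have "bij_betw \<tau> (V \<union> - V) (V \<union> - V)" by (rule bij_betw_combine) auto
  then have bij: "bij \<tau>" by simp
  have tV: "\<tau> v \<in> V \<longleftrightarrow> v \<in> V" for v using bb by (auto simp: \<tau>_def bij_betw_def)
  have "edge_permutation E \<tau>"
  proof
    fix u v
    show "{\<tau> u, \<tau> v} \<in> E \<longleftrightarrow> {u, v} \<in> E"
    proof (cases "u \<in> V \<and> v \<in> V")
      case True
      then show ?thesis using edges by (simp add: \<tau>_def)
    next
      case False
      then have "{u, v} \<notin> E" "{\<tau> u, \<tau> v} \<notin> E" using E tV by blast+
      then show ?thesis by simp
    qed
  qed (rule bij)
  moreover have "\<tau> ` V = V" using bb by (auto simp: \<tau>_def bij_betw_def)
  moreover have "{\<tau> u, \<tau> v} \<in> B" if uv: "{u, v} \<in> B" for u v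
  proof -
    have "{u, v} \<in> E" using B uv by (auto simp: determining_def)
    then have "{\<tau> u, \<tau> v} = \<sigma> ` {u, v}" "?c (\<sigma> ` {u, v}) = ?c {u, v}"
      using E[of "{u, v}"] col[of "{u, v}"] by (simp_all add: \<tau>_def)
    then show ?thesis using uv by (metis color.distinct(1))
  qed
  ultimately have "\<tau> x = x" using B x unfolding determining_def by blast
  then show ?thesis using x by (simp add: \<tau>_def)
qed

lemma trivial_automorphisms_imp_asymmetric:
  assumes "\<And>\<sigma> v. color_preserving_automorphism V E c \<sigma> \<Longrightarrow> v \<in> V \<Longrightarrow> \<sigma> v = v" "\<And>e. e \<in> E \<Longrightarrow> e \<subseteq> V"
    and "color_preserving_homeomorphism X V E c f h"
  shows "restricts_to_automorphism V E f h id"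
proof -
  obtain \<sigma> where \<sigma>: "color_preserving_automorphism V E c \<sigma>" "restricts_to_automorphism V E f h \<sigma>"
    using assms(3) by (auto simp: color_preserving_homeomorphism_def)
  have "\<sigma> ` e = e" if "e \<in> E" for e
    using assms(1)[OF \<sigma>(1)] assms(2)[OF that] by force
  then show ?thesis using \<sigma>(2) assms(1)[OF \<sigma>(1)] by (simp add: restricts_to_automorphism_def)
qed

text \<open>The center is the only vertex with three black neighbors, and the legs are told apart by
  their lengths. The resulting fixed claw takes care of all other vertices.\<close>

lemma spider_determining:
  assumes V: "finite V" "\<And>e. e \<in> E \<Longrightarrow> e \<subseteq> V" and conn: "vertex_connected 3 V E" and nominor: "\<not> k33_minor E"
    and sp: "spider E v a b b' c c' c''"
  shows "determining V E {{v, a}, {v, b}, {b, b'}, {v, c}, {c, c'}, {c', c''}}" (is "determining V E ?B")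
  unfolding determining_def
proof (intro conjI allI impI ballI)
  have d: "distinct [v, a, b, b', c, c', c'']" using sp by (simp add: spider_def)
  show BE: "?B \<subseteq> E" using sp unfolding spider_def by (rule conjunct2)
  fix \<sigma> x assume H: "edge_permutation E \<sigma> \<and> \<sigma> ` V = V \<and> (\<forall>u v. {u, v} \<in> ?B \<longrightarrow> {\<sigma> u, \<sigma> v} \<in> ?B)"
  note ep = H[THEN conjunct1] and sV = H[THEN conjunct2, THEN conjunct1]
    and sB = H[THEN conjunct2, THEN conjunct2, rule_format]
  assume "x \<in> V"
  have inj: "\<sigma> u = \<sigma> w \<longleftrightarrow> u = w" for u w using edge_permutation.inj[OF ep] by (simp add: inj_eq)
  define nb where "nb y z \<longleftrightarrow> {y, z} \<in> ?B" for y z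
  have nb: "nb y z \<longleftrightarrow> (y = v \<and> (z = a \<or> z = b \<or> z = c)) \<or> (y = a \<and> z = v) \<or> (y = b \<and> (z = v \<or> z = b')) \<or>
      (y = b' \<and> z = b) \<or> (y = c \<and> (z = v \<or> z = c')) \<or> (y = c' \<and> (z = c \<or> z = c'')) \<or> (y = c'' \<and> z = c')" for y z
    unfolding nb_def by (auto simp: doubleton_eq_iff)
  have s: "nb (\<sigma> v) (\<sigma> a)" "nb (\<sigma> v) (\<sigma> b)" "nb (\<sigma> b) (\<sigma> b')" "nb (\<sigma> v) (\<sigma> c)" "nb (\<sigma> c) (\<sigma> c')" "nb (\<sigma> c') (\<sigma> c'')"
    unfolding nb_def by (rule sB, simp add: doubleton_eq_iff)+
  have di: "\<sigma> a \<noteq> \<sigma> b" "\<sigma> a \<noteq> \<sigma> c" "\<sigma> b \<noteq> \<sigma> c" "\<sigma> b' \<noteq> \<sigma> v" "\<sigma> c' \<noteq> \<sigma> v" "\<sigma> c'' \<noteq> \<sigma> c"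
    using d by (auto simp: inj)
  have "y = v" if "nb y p" "nb y q" "nb y r" "p \<noteq> q" "p \<noteq> r" "q \<noteq> r" for y p q r
    using that d unfolding nb by auto
  then have v: "\<sigma> v = v" using s(1,2,4) di(1,2,3) by blast
  have abc: "\<sigma> a \<in> {a, b, c}" "\<sigma> b \<in> {a, b, c}" "\<sigma> c \<in> {a, b, c}"
    using s(1,2,4) d unfolding v nb by auto
  have na: "z = v" if "nb a z" for z using that d unfolding nb by auto
  have nbb: "z = v \<or> z = b'" if "nb b z" for z using that d unfolding nb by auto
  have nb': "z = b" if "nb b' z" for z using that d unfolding nb by auto
  have "\<sigma> b \<noteq> a" using na[of "\<sigma> b'"] s(3) di(4) v by metis
  have "\<sigma> c \<noteq> a" using na[of "\<sigma> c'"] s(5) di(5) v by metis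
  \<comment> \<open>If the leg of length 3 went onto the leg of length 2, it would have to turn back
    at \<open>b'\<close>.\<close>
  have "\<sigma> c \<noteq> b"
  proof
    assume "\<sigma> c = b"
    then have "\<sigma> c' = b'" using nbb[of "\<sigma> c'"] s(5) di(5) v by metis
    then show False using nb'[of "\<sigma> c''"] s(6) di(6) \<open>\<sigma> c = b\<close> by metis
  qed
  then have c: "\<sigma> c = c" using abc(3) \<open>\<sigma> c \<noteq> a\<close> by blast
  then have b: "\<sigma> b = b" using abc(2) \<open>\<sigma> b \<noteq> a\<close> di(3) by auto
  then have a: "\<sigma> a = a" using abc(1) di(1,2) c by auto
  show "\<sigma> x = x"
    by (rule edge_permutation.fixing_claw_eq_identity[OF ep V sV conn nominor _ _ _ _ _ _ _ v a b c \<open>x \<in> V\<close>])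
      (use BE d in auto)
qed

text \<open>The black graph is a six-cycle without \<open>{p3, p4}\<close> but with the chord
  \<open>{p0, p2}\<close>: a triangle with a tail of length 1 at \<open>p2\<close> and one of length
  2 at \<open>p0\<close>. It spans \<open>V\<close>, so its asymmetry fixes all vertices
  directly.\<close>

lemma six_vertices_determining:
  assumes d: "distinct [p0, p1, p2, p3, p4, p5]" and V: "V = {p0, p1, p2, p3, p4, p5}"
    and BE: "{{p0, p1}, {p1, p2}, {p0, p2}, {p2, p3}, {p0, p5}, {p5, p4}} \<subseteq> E" (is "?B \<subseteq> E")
  shows "determining V E {{p0, p1}, {p1, p2}, {p0, p2}, {p2, p3}, {p0, p5}, {p5, p4}}"
  unfolding determining_def
proof (intro conjI allI impI)
  show "?B \<subseteq> E" by (rule BE)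
  fix \<sigma> assume H: "edge_permutation E \<sigma> \<and> \<sigma> ` V = V \<and> (\<forall>u v. {u, v} \<in> ?B \<longrightarrow> {\<sigma> u, \<sigma> v} \<in> ?B)"
  note ep = H[THEN conjunct1] and sB = H[THEN conjunct2, THEN conjunct2, rule_format]
  have inj: "\<sigma> u = \<sigma> w \<longleftrightarrow> u = w" for u w using edge_permutation.inj[OF ep] by (simp add: inj_eq)
  define nb where "nb y z \<longleftrightarrow> {y, z} \<in> ?B" for y z
  have nb: "nb y z \<longleftrightarrow> (y = p0 \<and> (z = p1 \<or> z = p2 \<or> z = p5)) \<or> (y = p1 \<and> (z = p0 \<or> z = p2)) \<or>
      (y = p2 \<and> (z = p0 \<or> z = p1 \<or> z = p3)) \<or> (y = p3 \<and> z = p2) \<or> (y = p4 \<and> z = p5) \<or> (y = p5 \<and> (z = p0 \<or> z = p4))" for y z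
    unfolding nb_def by (auto simp: doubleton_eq_iff)
  have s: "nb (\<sigma> p0) (\<sigma> p1)" "nb (\<sigma> p0) (\<sigma> p2)" "nb (\<sigma> p0) (\<sigma> p5)" "nb (\<sigma> p2) (\<sigma> p0)" "nb (\<sigma> p2) (\<sigma> p1)"
     "nb (\<sigma> p2) (\<sigma> p3)" "nb (\<sigma> p5) (\<sigma> p4)"
    unfolding nb_def by (rule sB, simp add: doubleton_eq_iff)+
  have di: "\<sigma> p0 \<noteq> \<sigma> p1" "\<sigma> p0 \<noteq> \<sigma> p2" "\<sigma> p0 \<noteq> \<sigma> p3" "\<sigma> p0 \<noteq> \<sigma> p4" "\<sigma> p1 \<noteq> \<sigma> p2" "\<sigma> p1 \<noteq> \<sigma> p3"
    "\<sigma> p1 \<noteq> \<sigma> p5" "\<sigma> p2 \<noteq> \<sigma> p5"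
    using d by (auto simp: inj)
  have "y = p0 \<or> y = p2" if "nb y p" "nb y q" "nb y r" "p \<noteq> q" "p \<noteq> r" "q \<noteq> r" for y p q r
    using that d unfolding nb by auto
  then have s02: "\<sigma> p0 = p0 \<or> \<sigma> p0 = p2" "\<sigma> p2 = p0 \<or> \<sigma> p2 = p2"
    using s di by blast+
  have n0: "z = p1 \<or> z = p2 \<or> z = p5" if "nb p0 z" for z using that d unfolding nb by auto
  have n2: "z = p0 \<or> z = p1 \<or> z = p3" if "nb p2 z" for z using that d unfolding nb by auto
  have n3: "z = p2" if "nb p3 z" for z using that d unfolding nb by auto
  have n5: "z = p0 \<or> z = p4" if "nb p5 z" for z using that d unfolding nb by auto
  \<comment> \<open>Exchanging the two vertices of degree 3 would send the longer tail into the
    shorter one, which ends at \<open>p3\<close>.\<close>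
  have "\<sigma> p0 \<noteq> p2"
  proof
    assume 0: "\<sigma> p0 = p2"
    then have 2: "\<sigma> p2 = p0" using s02 di(2) by metis
    have 1: "\<sigma> p1 = p1" using n0[of "\<sigma> p1"] n2[of "\<sigma> p1"] s(1,5) 0 2 di(1,5) d by (metis distinct_length_2_or_more)
    have "\<sigma> p5 = p3" using n2[of "\<sigma> p5"] s(3) 0 2 1 di(7,8) by metis
    then show False using n3[of "\<sigma> p4"] s(7) 0 di(4) by metis
  qed
  then have 0: "\<sigma> p0 = p0" and 2: "\<sigma> p2 = p2" using s02 di(2) by metis+
  have 1: "\<sigma> p1 = p1" using n0[of "\<sigma> p1"] n2[of "\<sigma> p1"] s(1,5) 0 2 di(1,5) d by (metis distinct_length_2_or_more)
  have 3: "\<sigma> p3 = p3" using n2[of "\<sigma> p3"] s(6) 0 1 2 di(3,6) by metis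
  have 5: "\<sigma> p5 = p5" using n0[of "\<sigma> p5"] s(3) 0 1 2 di(7,8) by metis
  have 4: "\<sigma> p4 = p4" using n5[of "\<sigma> p4"] s(7) 0 5 di(4) by metis
  show "\<forall>x\<in>V. \<sigma> x = x" using 0 1 2 3 4 5 V by simp
qed

text \<open>The black edges form a path of length 2, chosen so that its two ends differ in having a
  non-neighbor in the graph; hence the path cannot be reversed.\<close>

lemma five_vertices_determining:
  assumes d: "distinct [p, q, x, y, z]" and V: "V = {p, q, x, y, z}" and pq: "{p, q} \<notin> E"
    and E: "{p, x} \<in> E" "{p, y} \<in> E" "{p, z} \<in> E" "{q, x} \<in> E" "{q, y} \<in> E" "{q, z} \<in> E" "{x, y} \<in> E" "{x, z} \<in> E"
  shows "\<exists>B. determining V E B"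
proof -
  \<comment> \<open>The vertex \<open>q\<close> is the only non-neighbor of \<open>p\<close>, so it
    is fixed with \<open>p\<close>, and then \<open>z\<close> is the only vertex left.\<close>
  have fin: "\<forall>w\<in>V. \<sigma> w = w"
    if ep: "edge_permutation E \<sigma>" "\<sigma> ` V = V" and fx: "\<sigma> p = p" "\<sigma> x = x" "\<sigma> y = y" for \<sigma>
  proof -
    have inj: "\<sigma> u = \<sigma> w \<longleftrightarrow> u = w" for u w using edge_permutation.inj[OF ep(1)] by (simp add: inj_eq)
    have "\<sigma> q \<in> V" "\<sigma> z \<in> V" using ep(2) V by auto
    moreover have "{p, \<sigma> q} \<notin> E" using edge_permutation.edge_iff[OF ep(1), of p q] fx pq by simp
    ultimately have q: "\<sigma> q = q" using inj[of q p] fx d E V by auto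
    have "\<sigma> z = z" using \<open>\<sigma> z \<in> V\<close> inj[of z p] inj[of z x] inj[of z y] inj[of z q] fx q d V by auto
    then show ?thesis using q fx V by simp
  qed
  have path: "\<sigma> v = v \<and> ((\<sigma> u = u \<and> \<sigma> w = w) \<or> (\<sigma> u = w \<and> \<sigma> w = u))"
    if "edge_permutation E \<sigma>" "\<And>s t. {s, t} \<in> {{u, v}, {v, w}} \<Longrightarrow> {\<sigma> s, \<sigma> t} \<in> {{u, v}, {v, w}}"
      "u \<noteq> v" "v \<noteq> w" "u \<noteq> w" for \<sigma> u v w
  proof -
    have inj: "\<sigma> s = \<sigma> t \<longleftrightarrow> s = t" for s t using edge_permutation.inj[OF that(1)] by (simp add: inj_eq)
    have "{\<sigma> u, \<sigma> v} \<in> {{u, v}, {v, w}}" "{\<sigma> v, \<sigma> w} \<in> {{u, v}, {v, w}}" by (rule that(2), simp)+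
    moreover have "\<sigma> u \<noteq> \<sigma> v" "\<sigma> v \<noteq> \<sigma> w" "\<sigma> u \<noteq> \<sigma> w" using that inj by simp_all
    ultimately show ?thesis using that(3-5) by (auto simp: doubleton_eq_iff)
  qed
  show ?thesis
  proof (cases "{y, z} \<in> E")
    case True
    \<comment> \<open>Here only \<open>{p, q}\<close> is missing: \<open>p\<close> has a
      non-neighbor, while \<open>y\<close> has none.\<close>
    have "determining V E {{p, x}, {x, y}}"
      unfolding determining_def
    proof (intro conjI allI impI)
      fix \<sigma> assume H: "edge_permutation E \<sigma> \<and> \<sigma> ` V = V \<and> (\<forall>u v. {u, v} \<in> {{p, x}, {x, y}} \<longrightarrow> {\<sigma> u, \<sigma> v} \<in> {{p, x}, {x, y}})"
      note ep = H[THEN conjunct1] H[THEN conjunct2, THEN conjunct1]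
        and sB = H[THEN conjunct2, THEN conjunct2, rule_format]
      have inj: "\<sigma> u = \<sigma> w \<longleftrightarrow> u = w" for u w using edge_permutation.inj[OF ep(1)] by (simp add: inj_eq)
      have "p \<noteq> x" "x \<noteq> y" "p \<noteq> y" using d by auto
      note P = path[OF ep(1) sB this]
      have "\<sigma> p \<noteq> y"
      proof
        assume py: "\<sigma> p = y"
        have "\<sigma> q \<in> V" "\<sigma> q \<noteq> y" using ep(2) V inj[of q p] py d by auto
        then have "{y, \<sigma> q} \<in> E" using E True by (auto simp: V insert_commute)
        then show False using edge_permutation.edge_iff[OF ep(1), of p q] py pq by simp
      qed
      then show "\<forall>w\<in>V. \<sigma> w = w" using fin[OF ep] P by metis
    qed (use E in auto)
    then show ?thesis ..
  next
    case False
    \<comment> \<open>Here the graph is a wheel with hub \<open>x\<close>: the hub has no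
      non-neighbor, while \<open>y\<close> misses \<open>z\<close>.\<close>
    have "determining V E {{x, p}, {p, y}}"
      unfolding determining_def
    proof (intro conjI allI impI)
      fix \<sigma> assume H: "edge_permutation E \<sigma> \<and> \<sigma> ` V = V \<and> (\<forall>u v. {u, v} \<in> {{x, p}, {p, y}} \<longrightarrow> {\<sigma> u, \<sigma> v} \<in> {{x, p}, {p, y}})"
      note ep = H[THEN conjunct1] H[THEN conjunct2, THEN conjunct1]
        and sB = H[THEN conjunct2, THEN conjunct2, rule_format]
      have "x \<noteq> p" "p \<noteq> y" "x \<noteq> y" using d by auto
      note P = path[OF ep(1) sB this]
      have "\<sigma> x \<noteq> y"
      proof
        assume xy: "\<sigma> x = y"
        have "z \<in> \<sigma> ` V" using ep(2) V by simp
        then obtain t where t: "t \<in> V" "z = \<sigma> t" by blast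
        then have "t \<noteq> x" using xy d by auto
        then have "{x, t} \<in> E" using E t(1) by (auto simp: V insert_commute)
        then show False using edge_permutation.edge_iff[OF ep(1), of x t] xy t False by simp
      qed
      then show "\<forall>w\<in>V. \<sigma> w = w" using fin[OF ep] P by metis
    qed (use E in \<open>auto simp: insert_commute\<close>)
    then show ?thesis ..
  qed
qed

text \<open>A longest cycle is spanning, since a nonspanning one would need six vertices and a
  seventh off it. A chord between vertices two steps apart gives the asymmetric black graph; without
  such chords the graph is a hexagon with its long diagonals, which is
  \<open>K\<^sub>3\<^sub>,\<^sub>3\<close>.\<close>

lemma exists_determining_six:
  assumes E: "\<And>e. e \<in> E \<Longrightarrow> e \<subseteq> V" and conn: "vertex_connected 3 V E" and fin: "finite V" and V: "card V = 6"
    and nominor: "\<not> k33_minor E"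
  shows "\<exists>B. determining V E B"
proof -
  obtain xs where xs: "longest_cycle E xs" using exists_longest_cycle[OF E conn fin] by blast
  then have cyc: "graph_cycle E xs" and d: "distinct xs" by (auto simp: longest_cycle_def graph_cycle_def graph_path_def)
  have "set xs = V"
  proof (rule ccontr)
    assume ne: "set xs \<noteq> V"
    obtain ys w where ys: "graph_cycle E ys" "6 \<le> length ys" "{hd ys, w} \<in> E" "w \<notin> set ys"
      using nonspanning_longest_cycle[OF E conn fin xs ne] by metis
    have "set (w # ys) \<subseteq> V"
      using graph_path_vertices_subset[OF E, where xs = ys] ys E[OF ys(3)] by (auto simp: graph_cycle_def)
    then have "card (set (w # ys)) \<le> 6" using card_mono[OF fin] V by metis
    moreover have "distinct (w # ys)" using ys by (simp add: graph_cycle_def graph_path_def)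
    ultimately show False using distinct_card[of "w # ys"] ys(2) by simp
  qed
  then have "length xs = 6" using distinct_card[OF d] V by simp
  then obtain a b c d' e f where xs': "xs = [a, b, c, d', e, f]"
    by (auto simp: eval_nat_numeral length_Suc_conv)
  have dd: "distinct [a, b, c, d', e, f]" and VV: "V = {a, b, c, d', e, f}"
    using d \<open>set xs = V\<close> xs' by auto
  have ed: "{a, b} \<in> E" "{b, c} \<in> E" "{c, d'} \<in> E" "{d', e} \<in> E" "{e, f} \<in> E" "{f, a} \<in> E"
    using cyc xs' by (auto simp: graph_cycle_def graph_path_def)
  have short: "\<exists>B. determining V E B"
    if "{p0, p1} \<in> E" "{p1, p2} \<in> E" "{p2, p3} \<in> E" "{p3, p4} \<in> E" "{p4, p5} \<in> E" "{p5, p0} \<in> E" "{p0, p2} \<in> E"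
      "distinct [p0, p1, p2, p3, p4, p5]" "V = {p0, p1, p2, p3, p4, p5}" for p0 p1 p2 p3 p4 p5
    using six_vertices_determining[OF that(8,9)] that(1-7) by (auto simp: insert_commute)
  show ?thesis
  proof (cases "{a, c} \<in> E \<or> {b, d'} \<in> E \<or> {c, e} \<in> E \<or> {d', f} \<in> E \<or> {e, a} \<in> E \<or> {f, b} \<in> E")
    case True
    then consider "{a, c} \<in> E" | "{b, d'} \<in> E" | "{c, e} \<in> E" | "{d', f} \<in> E" | "{e, a} \<in> E" | "{f, b} \<in> E" by blast
    then show ?thesis
    proof cases
      case 1 show ?thesis by (rule short[of a b c d' e f]) (use 1 ed dd VV in auto)
    next
      case 2 show ?thesis by (rule short[of b c d' e f a]) (use 2 ed dd VV in auto)
    next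
      case 3 show ?thesis by (rule short[of c d' e f a b]) (use 3 ed dd VV in auto)
    next
      case 4 show ?thesis by (rule short[of d' e f a b c]) (use 4 ed dd VV in auto)
    next
      case 5 show ?thesis by (rule short[of e f a b c d']) (use 5 ed dd VV in auto)
    next
      case 6 show ?thesis by (rule short[of f a b c d' e]) (use 6 ed dd VV in auto)
    qed
  next
    case False
    \<comment> \<open>A vertex needs a third neighbor besides its two neighbors on the hexagon, and
      only the opposite vertex is left.\<close>
    have long: "{u, w} \<in> E" if "u \<in> V" "neighborhood E {u} \<subseteq> {p, q, w}" for u w p q
    proof (rule ccontr)
      assume "{u, w} \<notin> E"
      then have "neighborhood E {u} \<subseteq> {p, q}" using that(2) by (auto simp: neighborhood_singleton)
      then have "card (neighborhood E {u}) \<le> card {p, q}" by (intro card_mono) auto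
      also have "\<dots> \<le> 2" by (simp add: card_insert_if)
      finally show False using three_le_degree[OF E conn that(1) fin] by simp
    qed
    have mem: "x \<in> V" if "{u, x} \<in> E" for u x using E[OF that] by blast
    have comm: "{u, v} \<in> E \<longleftrightarrow> {v, u} \<in> E" for u v by (simp add: insert_commute)
    have nE: "{a, c} \<notin> E" "{a, e} \<notin> E" "{c, a} \<notin> E" "{c, e} \<notin> E" "{e, a} \<notin> E" "{e, c} \<notin> E"
      using False by (simp_all add: insert_commute)
    have nb: "neighborhood E {u} \<subseteq> {p, q, w}"
      if "\<And>x. x \<in> V \<Longrightarrow> x \<noteq> u \<Longrightarrow> {u, x} \<in> E \<Longrightarrow> x \<in> {p, q, w}" for u p q w
      using that mem unfolding neighborhood_singleton by blast
    have ad: "{a, d'} \<in> E"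
      by (rule long[of _ b f]) (use nE VV in \<open>auto intro!: nb\<close>)
    have cf: "{c, f} \<in> E"
      by (rule long[of _ b d']) (use nE VV in \<open>auto intro!: nb\<close>)
    have eb: "{e, b} \<in> E"
      by (rule long[of _ d' f]) (use nE VV in \<open>auto intro!: nb\<close>)
    have "k33_minor E"
      by (rule k33_minorI[of E "{a}" "{c}" "{e}" "{b}" "{d'}" "{f}"])
        (use ad cf eb ed dd comm in \<open>auto simp: connected_in_singleton adjacent_def\<close>)
    then show ?thesis using nominor by blast
  qed
qed

text \<open>Degree at least 3 joins both \<open>p\<close> and \<open>q\<close> to all of
  \<open>x\<close>, \<open>y\<close>, \<open>z\<close>. Each of these three needs a neighbor among
  the other two, so one of them is adjacent to both.\<close>

lemma exists_determining_five:
  assumes E: "\<And>e. e \<in> E \<Longrightarrow> e \<subseteq> V" and conn: "vertex_connected 3 V E" and fin: "finite V" and V: "card V = 5"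
    and pq: "p \<in> V" "q \<in> V" "p \<noteq> q" "{p, q} \<notin> E"
  shows "\<exists>B. determining V E B"
proof -
  have "card (V - {p, q}) = 3" using V pq fin by (simp add: card_Diff_subset)
  then obtain x y z where xyz: "V - {p, q} = {x, y, z}" "x \<noteq> y" "y \<noteq> z" "x \<noteq> z" by (auto simp: card_3_iff)
  then have VV: "V = {p, q, x, y, z}" using pq by auto
  have d: "distinct [p, q, x, y, z]" using xyz pq(3) by auto
  have mem: "s \<in> V" if "{u, s} \<in> E" for u s using E[OF that] by blast
  have comm: "{u, v} \<in> E \<longleftrightarrow> {v, u} \<in> E" for u v by (simp add: insert_commute)
  have full: "neighborhood E {u} = A" if "u \<in> V" "neighborhood E {u} \<subseteq> A" "card A = 3" "finite A" for u A
    using card_subset_eq[OF that(4,2)] card_mono[OF that(4,2)] three_le_degree[OF E conn that(1) fin] that(3) by simp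
  have qp: "{q, p} \<notin> E" using pq(4) comm by blast
  have "neighborhood E {p} = {x, y, z}"
    by (rule full) (use VV pq xyz mem in \<open>auto simp: neighborhood_singleton\<close>)
  moreover have "neighborhood E {q} = {x, y, z}"
    by (rule full) (use VV pq qp xyz mem in \<open>auto simp: neighborhood_singleton\<close>)
  ultimately have pe: "{p, x} \<in> E" "{p, y} \<in> E" "{p, z} \<in> E" "{q, x} \<in> E" "{q, y} \<in> E" "{q, z} \<in> E"
    by (auto simp: neighborhood_singleton)
  have one: "{u, s} \<in> E \<or> {u, t} \<in> E" if "u \<in> V" "V = {p, q, u, s, t}" for u s t
  proof (rule ccontr)
    assume "\<not> ({u, s} \<in> E \<or> {u, t} \<in> E)"
    then have "neighborhood E {u} \<subseteq> {p, q}" using that mem by (auto simp: neighborhood_singleton)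
    then have "card (neighborhood E {u}) \<le> card {p, q}" by (intro card_mono) auto
    also have "\<dots> \<le> 2" by (simp add: card_insert_if)
    finally show False using three_le_degree[OF E conn that(1) fin] by simp
  qed
  have "{x, y} \<in> E \<or> {x, z} \<in> E" "{y, x} \<in> E \<or> {y, z} \<in> E" "{z, x} \<in> E \<or> {z, y} \<in> E"
    by (rule one; use VV in auto)+
  then consider (x) "{x, y} \<in> E" "{x, z} \<in> E" | (y) "{y, x} \<in> E" "{y, z} \<in> E" | (z) "{z, x} \<in> E" "{z, y} \<in> E"
    using comm by blast
  then show ?thesis
  proof cases
    case x
    then show ?thesis using five_vertices_determining[OF d VV pq(4)] pe by blast
  next
    case y
    show ?thesis by (rule five_vertices_determining[of p q y x z]) (use y d VV pq pe in auto)
  next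
    case z
    show ?thesis by (rule five_vertices_determining[of p q z x y]) (use z d VV pq pe in auto)
  qed
qed

text \<open>Deleting two vertices leaves a connected graph on the other two, which must be an
  edge.\<close>

lemma complete_graph_4_if_card_4:
  assumes g: "\<And>e. e \<in> E \<Longrightarrow> e \<subseteq> V \<and> card e = 2" and conn: "vertex_connected 3 V E" and V: "card V = 4"
  shows "complete_graph 4 V E"
proof -
  have "{u, v} \<in> E" if uv: "u \<in> V" "v \<in> V" "u \<noteq> v" for u v
  proof -
    have fin: "finite V" using V by (metis card.infinite zero_neq_numeral)
    have "card (V - {u, v}) < 3" using V uv fin by (simp add: card_Diff_subset)
    then have "connected_in E (V - (V - {u, v}))"
      by (intro vertex_connected_diff[OF _ conn]) (use g in auto)
    moreover have "V - (V - {u, v}) = {u, v}" using uv by blast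
    ultimately have con: "connected_in E {u, v}" by simp
    obtain x y where "x \<in> {u}" "y \<in> {u, v} - {u}" "{x, y} \<in> E"
      by (rule connected_in_cut[OF con, of "{u}"]) (use uv in auto)
    then show ?thesis by auto
  qed
  moreover have "\<exists>u v. e = {u, v} \<and> u \<in> V \<and> v \<in> V \<and> u \<noteq> v" if "e \<in> E" for e
    using g[OF that] by (auto simp: card_2_iff)
  ultimately show ?thesis using V by (auto simp: complete_graph_def)
qed

lemma exists_determining:
  assumes G: "graph V E" and conn: "vertex_connected 3 V E" and pl: "planar V E" and K4: "\<not> complete_graph 4 V E"
  shows "\<exists>B. determining V E B"
proof -
  have fin: "finite V" and edge: "\<And>e. e \<in> E \<Longrightarrow> e \<subseteq> V \<and> card e = 2" using G by (auto simp: graph_def)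
  then have E: "\<And>e. e \<in> E \<Longrightarrow> e \<subseteq> V" by blast
  obtain f where f: "graph_embedding (euclidean :: complex topology) V E f" using pl by (auto simp: planar_def)
  interpret plane_drawing V E f by unfold_locales (use edge f in auto)
  have "3 < card V" using conn by (simp add: vertex_connected_def)
  moreover have "card V \<noteq> 4" using complete_graph_4_if_card_4[OF edge conn] K4 by blast
  ultimately consider "card V = 5" | "card V = 6" | "7 \<le> card V" by linarith
  then show ?thesis
  proof cases
    case 1
    \<comment> \<open>Five vertices are too few for a \<open>K\<^sub>3\<^sub>,\<^sub>3\<close>
      minor, so \<open>K\<^sub>5\<close> needs its own exclusion.\<close>
    have "\<exists>p\<in>V. \<exists>q\<in>V. p \<noteq> q \<and> {p, q} \<notin> E"
    proof (rule ccontr)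
      assume "\<not> (\<exists>p\<in>V. \<exists>q\<in>V. p \<noteq> q \<and> {p, q} \<notin> E)"
      then have all: "{p, q} \<in> E" if "p \<in> V" "q \<in> V" "p \<noteq> q" for p q using that by blast
      obtain vs where vs: "set vs = V" "distinct vs" using finite_distinct_list[OF fin] by blast
      then have "length vs = 5" using distinct_card[OF vs(2)] 1 by simp
      then obtain v1 v2 v3 v4 v5 where v: "vs = [v1, v2, v3, v4, v5]"
        by (auto simp: eval_nat_numeral length_Suc_conv)
      show False by (rule no_k5[of v1 v2 v3 v4 v5]) (use vs v all in auto)
    qed
    then show ?thesis using exists_determining_five[OF E conn fin 1] by blast
  next
    case 2
    then show ?thesis using exists_determining_six[OF E conn fin _ no_k33_minor] by blast
  next
    case 3
    then show ?thesis using exists_spider[OF E conn fin] spider_determining[OF fin E conn no_k33_minor] by metis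
  qed
qed

text \<open>Consider the three pairs of opposite edges. If two pairs are monochromatic, a double
  transposition preserves the coloring. Otherwise two pairs are bichromatic, say \<open>ac\<close>,
  \<open>bd\<close> and \<open>ad\<close>, \<open>bc\<close>; then either \<open>ac = ad\<close> and
  \<open>bc = bd\<close>, or \<open>ac = bc\<close> and \<open>ad = bd\<close>, and a transposition
  does.\<close>

lemma k4_has_symmetric_drawing:
  fixes E :: "'a set set" and col :: "'a set \<Rightarrow> color"
  assumes "complete_graph 4 V E"
  shows "\<exists>f h. graph_embedding (nsphere 3) V E f \<and> color_preserving_homeomorphism (nsphere 3) V E col f h \<and>
    orientation_reversing 3 h \<and> \<not> restricts_to_automorphism V E f h id"
proof -
  have V: "card V = 4" and E: "E = {{u, v} |u v. u \<in> V \<and> v \<in> V \<and> u \<noteq> v}"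
    using assms unfolding complete_graph_def by blast+
  have "finite V" using V by (metis card.infinite zero_neq_numeral)
  then obtain vs where vs: "set vs = V" "distinct vs" using finite_distinct_list by blast
  then have "length vs = 4" using distinct_card[OF vs(2)] V by simp
  then obtain a b c d where v: "vs = [a, b, c, d]" by (auto simp: eval_nat_numeral length_Suc_conv)
  have VV: "V = {a, b, c, d}" and dd: "distinct [a, b, c, d]" using vs v by auto
  let ?goal = ?thesis
  have single: ?goal if "V = {p, q, r, s}" "distinct [p, q, r, s]" "col {p, r} = col {q, r}" "col {p, s} = col {q, s}"
    for p q r s
  proof -
    interpret k4 V E p q r s by unfold_locales (rule that E)+
    show ?thesis using embedding transposition_symmetry[OF that(3,4)] by blast
  qed
  have double: ?goal if "V = {p, q, r, s}" "distinct [p, q, r, s]" "col {p, r} = col {q, s}" "col {p, s} = col {q, r}"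
    for p q r s
  proof -
    interpret k4 V E p q r s by unfold_locales (rule that E)+
    show ?thesis using embedding double_transposition_symmetry[OF that(3,4)] by blast
  qed
  have perm: "V = {a, c, b, d}" "V = {a, d, b, c}" "V = {b, c, a, d}" "V = {b, d, a, c}" "V = {c, d, a, b}"
    "distinct [a, c, b, d]" "distinct [a, d, b, c]" "distinct [b, c, a, d]" "distinct [b, d, a, c]" "distinct [c, d, a, b]"
    using VV dd by auto
  define ab ac ad bc bd cd where "ab = col {a, b}" and "ac = col {a, c}" and "ad = col {a, d}"
    and "bc = col {b, c}" and "bd = col {b, d}" and "cd = col {c, d}"
  note defs = ab_def ac_def ad_def bc_def bd_def cd_def
  \<comment> \<open>The six transpositions come first, then the three double transpositions.\<close>
  consider "ac = bc" "ad = bd" | "ab = bc" "ad = cd" | "ab = bd" "ac = cd" | "ab = ac" "bd = cd" | "ab = ad" "bc = cd"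
    | "ac = ad" "bc = bd" | "ac = bd" "ad = bc" | "ab = cd" "ad = bc" | "ab = cd" "ac = bd"
    by (cases ab; cases ac; cases ad; cases bc; cases bd; cases cd; simp)
  then show ?thesis
  proof cases
    case 1 then show ?thesis using single[OF VV dd] by (simp add: defs)
  next
    case 2 then show ?thesis using single[OF perm(1,6)] by (simp add: defs insert_commute)
  next
    case 3 then show ?thesis using single[OF perm(2,7)] by (simp add: defs insert_commute)
  next
    case 4 then show ?thesis using single[OF perm(3,8)] by (simp add: defs insert_commute)
  next
    case 5 then show ?thesis using single[OF perm(4,9)] by (simp add: defs insert_commute)
  next
    case 6 then show ?thesis using single[OF perm(5,10)] by (simp add: defs insert_commute)
  next
    case 7 then show ?thesis using double[OF VV dd] by (simp add: defs)
  next
    case 8 then show ?thesis using double[OF perm(1,6)] by (simp add: defs insert_commute)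
  next
    case 9 then show ?thesis using double[OF perm(2,7)] by (simp add: defs insert_commute)
  qed
qed

theorem theorem1:
  fixes V :: "'a set" and E :: "'a set set"
  assumes "graph V E" and "vertex_connected 3 V E" and "planar V E"
  shows "((\<exists>c. intrinsically_asymmetric (nsphere 3) V E c) \<longleftrightarrow> \<not> complete_graph 4 V E) \<and>
         ((\<exists>c. intrinsically_faithfully_chiral 3 V E c) \<longleftrightarrow> \<not> complete_graph 4 V E)"
proof -
  have E: "\<And>e. e \<in> E \<Longrightarrow> e \<subseteq> V" using assms(1) by (auto simp: graph_def)
  \<comment> \<open>The symmetry of the drawing reverses orientation, so it refutes both properties
    at once.\<close>
  have "\<not> intrinsically_asymmetric (nsphere 3) V E c \<and> \<not> intrinsically_faithfully_chiral 3 V E c"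
    if "complete_graph 4 V E" for c
    using k4_has_symmetric_drawing[OF that, of c]
    unfolding intrinsically_asymmetric_def intrinsically_faithfully_chiral_def by blast
  moreover have "\<exists>c. intrinsically_asymmetric (nsphere 3) V E c \<and> intrinsically_faithfully_chiral 3 V E c"
    if K4: "\<not> complete_graph 4 V E"
  proof -
    obtain B where B: "determining V E B" using exists_determining[OF assms K4] by blast
    let ?c = "\<lambda>e. if e \<in> B then Black else Grey"
    have trivial: "\<sigma> v = v" if "color_preserving_automorphism V E ?c \<sigma>" "v \<in> V" for \<sigma> v
      using determining_imp_trivial_automorphism E B that by metis
    have "restricts_to_automorphism V E f h id" if "color_preserving_homeomorphism (nsphere 3) V E ?c f h" for f h
      using trivial_automorphisms_imp_asymmetric trivial E that by metis
    then have "intrinsically_asymmetric (nsphere 3) V E ?c \<and> intrinsically_faithfully_chiral 3 V E ?c"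
      unfolding intrinsically_asymmetric_def intrinsically_faithfully_chiral_def by blast
    then show ?thesis by blast
  qed
  ultimately show ?thesis by blast
qed

end
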